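(* Let $\mathcal{G}$ be the Grigorchuk group. For each $n\ge 5$, the product replacement graph $\Gamma_n(\mathcal{G})$ has exponential growth.
   Context: Let $\mathbf{T}=\{0,1\}^*$ be the rooted binary tree of finite binary strings. Let $a$ be the automorphism flipping the first bit of a string. Define automorphisms $b,c,d$ by: each fixes every string $1^n$, and for $n\ge0$ and any string $s$, each maps $1^n0s$ either to $1^n0s$ or to $1^n0a(s)$, where $d$ applies $a$ to $s$ iff $n\equiv 1,2\pmod 3$, $c$ iff $n\equiv 0,2\pmod 3$, and $b$ iff $n\equiv 0,1\pmod 3$. The Grigorchuk group is $\mathcal{G}=\langle a,b,c,d\rangle$. For a group $G$, a generating $n$-tuple is $(g_1,\dots,g_n)\in G^n$ generating $G$; the product replacement graph $\Gamma_n(G)$ has the generating $n$-tuples as vertices, with edges from $(g_1,\dots,g_n)$ to the tuples obtained by replacing $g_j$ with $g_jg_i^{\pm1}$ or $g_i^{\pm1}g_j$, for all ordered pairs $i\neq j$. For a graph $\Gamma$ and vertex $v$, $B_\Gamma(v,r)$ is the set of vertices at path distance at most $r$ from $v$; $\Gamma$ has exponential growth from $v$ if there is $\alpha>1$ with $|B_\Gamma(v,r)|\ge\alpha^r$ for all sufficiently large $r$. A graph has exponential growth if it is connected and has exponential growth from some (equivalently every) vertex. *)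

theory Defs
  imports "HOL-Algebra.Algebra"
begin

text \<open>Vertices of the binary tree: finite binary strings, bit 1 = True, bit 0 = False.\<close>

fun flip_a :: "bool list \<Rightarrow> bool list" where
  "flip_a [] = []"
| "flip_a (x # s) = (\<not> x) # s"

text \<open>grig_aux P n w: acts on the suffix w of a string whose already-read prefix is 1^n;
  on 1^m 0 s (read from prefix 1^n) applies a to s iff P (n+m).\<close>
fun grig_aux :: "(nat \<Rightarrow> bool) \<Rightarrow> nat \<Rightarrow> bool list \<Rightarrow> bool list" where
  "grig_aux P n [] = []"
| "grig_aux P n (True # s) = True # grig_aux P (Suc n) s"
| "grig_aux P n (False # s) = False # (if P n then flip_a s else s)"

definition gen_b :: "bool list \<Rightarrow> bool list" where
  "gen_b = grig_aux (\<lambda>n. n mod 3 = 0 \<or> n mod 3 = 1) 0"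
definition gen_c :: "bool list \<Rightarrow> bool list" where
  "gen_c = grig_aux (\<lambda>n. n mod 3 = 0 \<or> n mod 3 = 2) 0"
definition gen_d :: "bool list \<Rightarrow> bool list" where
  "gen_d = grig_aux (\<lambda>n. n mod 3 = 1 \<or> n mod 3 = 2) 0"

text \<open>The Grigorchuk group as a subgroup of the group of all bijections of the tree.\<close>
definition Grigorchuk :: "(bool list \<Rightarrow> bool list) monoid" where
  "Grigorchuk = (BijGroup (UNIV :: bool list set))
     \<lparr>carrier := generate (BijGroup (UNIV :: bool list set)) {flip_a, gen_b, gen_c, gen_d}\<rparr>"

text \<open>Generating n-tuples (tuples as lists of length n).\<close>
definition gen_tuples :: "('a, 'b) monoid_scheme \<Rightarrow> nat \<Rightarrow> 'a list set" where
  "gen_tuples G n = {xs. length xs = n \<and> set xs \<subseteq> carrier G \<and> generate G (set xs) = carrier G}"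

text \<open>Elementary Nielsen moves: replace g_j by g_j g_i^{+-1} or g_i^{+-1} g_j, i \<noteq> j.\<close>
definition pr_move :: "('a, 'b) monoid_scheme \<Rightarrow> 'a list \<Rightarrow> 'a list \<Rightarrow> bool" where
  "pr_move G xs ys \<longleftrightarrow> (\<exists>i j. i < length xs \<and> j < length xs \<and> i \<noteq> j \<and>
     (ys = xs[j := xs ! j \<otimes>\<^bsub>G\<^esub> xs ! i] \<or> ys = xs[j := xs ! j \<otimes>\<^bsub>G\<^esub> inv\<^bsub>G\<^esub> (xs ! i)] \<or>
      ys = xs[j := xs ! i \<otimes>\<^bsub>G\<^esub> xs ! j] \<or> ys = xs[j := inv\<^bsub>G\<^esub> (xs ! i) \<otimes>\<^bsub>G\<^esub> xs ! j]))"

text \<open>Edge set of the (undirected) product replacement graph Gamma_n(G).\<close>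
definition pr_edges :: "('a, 'b) monoid_scheme \<Rightarrow> nat \<Rightarrow> ('a list \<times> 'a list) set" where
  "pr_edges G n = {(xs, ys). xs \<in> gen_tuples G n \<and> ys \<in> gen_tuples G n \<and>
      (pr_move G xs ys \<or> pr_move G ys xs)}"

text \<open>Generic graph notions for a graph with vertex set V and edge relation E.\<close>
definition graph_ball :: "('v \<times> 'v) set \<Rightarrow> 'v \<Rightarrow> nat \<Rightarrow> 'v set" where
  "graph_ball E v r = {w. \<exists>k\<le>r. (v, w) \<in> E ^^ k}"

definition graph_connected :: "'v set \<Rightarrow> ('v \<times> 'v) set \<Rightarrow> bool" where
  "graph_connected V E \<longleftrightarrow> (\<forall>v\<in>V. \<forall>w\<in>V. (v, w) \<in> E\<^sup>*)"

definition exp_growth_from :: "('v \<times> 'v) set \<Rightarrow> 'v \<Rightarrow> bool" where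
  "exp_growth_from E v \<longleftrightarrow> (\<exists>\<alpha>::real. \<alpha> > 1 \<and>
     (\<forall>\<^sub>F r in sequentially. real (card (graph_ball E v r)) \<ge> \<alpha> ^ r))"

definition has_exp_growth :: "'v set \<Rightarrow> ('v \<times> 'v) set \<Rightarrow> bool" where
  "has_exp_growth V E \<longleftrightarrow> graph_connected V E \<and> (\<exists>v\<in>V. exp_growth_from E v)"

end

theory Submission
  imports Defs
begin

text \<open>
Connectivity rests on Pervova's theorem, in the form: a subgroup \<open>H\<close> of \<open>G\<close> that maps onto the
abelianisation \<open>(\<int>/2)\<^sup>3\<close> (a dense subgroup) is \<open>G\<close>. Density passes to the groups of sections of the
vertex stabilisers of \<open>H\<close>, and if such a group of sections is \<open>G\<close>, then \<open>H\<close> contains a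
subgroup \<open>N\<close> with \<open>G/N\<close> a finite 2-group, whence \<open>H = G\<close>. So it suffices to descend in the tree until
the group contains \<open>a, b, c, d\<close>. Passing to sections does not increase the number of letters
\<open>b, c, d\<close> in a word and shifts them by \<open>b \<mapsto> c \<mapsto> d \<mapsto> b\<close>. This first yields two different letters up
to conjugation, then conjugates of \<open>a\<close> and of these two letters; the total length of the three
conjugators decreases because \<open>d = (1, b)\<close> has a trivial section.

By Pervova's theorem, three entries of a generating tuple already generate \<open>G\<close>; the other two
entries give enough room to move the tuple to \<open>(a, c, d, 1, \<dots>, 1)\<close>.

For growth, let \<open>x \<noteq> 1\<close> act only below one vertex of level \<open>m\<close>, with a word of length \<open>O(2\<^sup>m)\<close>. A walk
of length \<open>O(2\<^sup>m)\<close> in the Schreier graph visits all vertices of that level; conjugating \<open>x\<close> along it and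
multiplying the conjugates selected by a set of vertices into another entry produces \<open>2 ^ 2\<^sup>m\<close>
different tuples \<open>(a, c, d, x', y, 1, \<dots>)\<close> within distance \<open>O(2\<^sup>m)\<close>.
\<close>

section \<open>The Grigorchuk group as a type\<close>

text \<open>Density controls every quotient that is inspected, because these are finite 2-groups:
  series with steps of index at most 2 take the place of a Frattini argument, and each homomorphism
  to Z/2 factors through the type. The descent is not a plain induction on words. Elements of
  \<open>H\<close> are known only up to conjugation, each vertex has its own conjugator, and
  \<open>d\<close> yields no conjugate of \<open>a\<close> until the shift has turned it into
  \<open>b\<close>. So the length may stall for a few sections, and the position in the cycle
  \<open>b\<close>, \<open>c\<close>, \<open>d\<close> has to be followed as well. The number five
  enters twice. Setting an entry at will involves up to four named positions, a generating triple
  and the target, and one spare position. The growth argument keeps \<open>a\<close>,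
  \<open>c\<close>, \<open>d\<close> beside the two working entries.\<close>

inductive_set grig_maps :: "(bool list \<Rightarrow> bool list) set" where
  gm_id: "id \<in> grig_maps"
| gm_a: "f \<in> grig_maps \<Longrightarrow> flip_a \<circ> f \<in> grig_maps"
| gm_b: "f \<in> grig_maps \<Longrightarrow> gen_b \<circ> f \<in> grig_maps"
| gm_c: "f \<in> grig_maps \<Longrightarrow> gen_c \<circ> f \<in> grig_maps"
| gm_d: "f \<in> grig_maps \<Longrightarrow> gen_d \<circ> f \<in> grig_maps"

text \<open>The counter enters only through the tail of the predicate. The three predicates have
  period 3 and shift into one another, which yields the recursion \<open>b = (a, c)\<close>,
  \<open>c = (a, d)\<close>, \<open>d = (1, b)\<close>.\<close>

lemma grig_aux_cong: "(\<And>i. P (n + i) = Q (m + i)) \<Longrightarrow> grig_aux P n s = grig_aux Q m s"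
proof (induction P n s arbitrary: m rule: grig_aux.induct)
  case (2 P n s)
  have "grig_aux P (Suc n) s = grig_aux Q (Suc m) s"
    by (rule "2.IH") (use "2.prems"[of "Suc _"] in simp)
  then show ?case by simp
next
  case (3 P n s)
  then show ?case using "3.prems"[of 0] by simp
qed simp_all

lemma gen_simps [simp]:
  "gen_b [] = []" "gen_b (False # s) = False # flip_a s" "gen_b (True # s) = True # gen_c s"
  "gen_c [] = []" "gen_c (False # s) = False # flip_a s" "gen_c (True # s) = True # gen_d s"
  "gen_d [] = []" "gen_d (False # s) = False # s" "gen_d (True # s) = True # gen_b s"
  unfolding gen_b_def gen_c_def gen_d_def by (simp_all, (rule grig_aux_cong, presburger)+)

lemma flip_flip [simp]: "flip_a (flip_a s) = s"
  by (cases s) auto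

lemma gen_invol [simp]:
  "gen_b (gen_b s) = s \<and> gen_c (gen_c s) = s \<and> gen_d (gen_d s) = s"
proof (induction s)
  case (Cons x s) then show ?case by (cases x) auto
qed simp

lemma gen_prod:
  "gen_b (gen_c s) = gen_d s \<and> gen_c (gen_b s) = gen_d s \<and> gen_b (gen_d s) = gen_c s \<and>
   gen_d (gen_b s) = gen_c s \<and> gen_c (gen_d s) = gen_b s \<and> gen_d (gen_c s) = gen_b s"
proof (induction s)
  case (Cons x s) then show ?case by (cases x) auto
qed simp

lemma grig_maps_gens: "flip_a \<in> grig_maps" "gen_b \<in> grig_maps" "gen_c \<in> grig_maps" "gen_d \<in> grig_maps"
  using grig_maps.intros(2-)[OF gm_id] by (simp_all only: comp_id)

lemma grig_maps_comp:
  assumes "f \<in> grig_maps" "g \<in> grig_maps" shows "f \<circ> g \<in> grig_maps"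
  using assms(1) by induction (simp_all only: id_comp assms(2) comp_assoc grig_maps.intros)

text \<open>The generators are involutions, so words without inverse letters already form a group.
  This justifies induction over left multiplication by \<open>a\<close>, \<open>b\<close>,
  \<open>c\<close>, \<open>d\<close> alone.\<close>

lemma grig_maps_inverse:
  assumes "f \<in> grig_maps" shows "\<exists>g\<in>grig_maps. g \<circ> f = id \<and> f \<circ> g = id"
  using assms
proof induction
  have *: "\<exists>g\<in>grig_maps. g \<circ> (t \<circ> f) = id \<and> (t \<circ> f) \<circ> g = id"
    if "t \<in> grig_maps" "\<And>s. t (t s) = s" "\<exists>g\<in>grig_maps. g \<circ> f = id \<and> f \<circ> g = id" for t f
  proof -
    note ex = that(3) and t = that(1,2)
    obtain g where g: "g \<in> grig_maps" "\<And>s. g (f s) = s" "\<And>s. f (g s) = s"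
      using ex by (auto simp: fun_eq_iff)
    show ?thesis
      by (rule bexI[OF _ grig_maps_comp[OF g(1) t(1)]]) (simp add: fun_eq_iff g t)
  qed
  {
    case gm_id show ?case by (rule bexI[OF _ grig_maps.gm_id]) simp
  next
    case (gm_a f) show ?case by (rule *[OF grig_maps_gens(1) flip_flip gm_a.IH])
  next
    case (gm_b f) show ?case by (rule *[OF grig_maps_gens(2) gen_invol[THEN conjunct1] gm_b.IH])
  next
    case (gm_c f) show ?case by (rule *[OF grig_maps_gens(3) gen_invol[THEN conjunct2, THEN conjunct1] gm_c.IH])
  next
    case (gm_d f) show ?case by (rule *[OF grig_maps_gens(4) gen_invol[THEN conjunct2, THEN conjunct2] gm_d.IH])
  }
qed

lemma grig_maps_bij: assumes "f \<in> grig_maps" shows "bij f"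
proof -
  obtain g where "g \<circ> f = id" "f \<circ> g = id" using grig_maps_inverse[OF assms] by blast
  then show ?thesis by (rule o_bij)
qed

lemma grig_maps_inv: assumes "f \<in> grig_maps" shows "inv_into UNIV f \<in> grig_maps"
proof -
  obtain g where g: "g \<in> grig_maps" "g \<circ> f = id" "f \<circ> g = id"
    using grig_maps_inverse[OF assms] by blast
  have "inv_into UNIV f = g" by (rule inv_unique_comp[OF g(3,2)])
  with g(1) show ?thesis by (simp only:)
qed

typedef grig = grig_maps
  morphisms act grig_of by (rule exI, rule gm_id)

setup_lifting type_definition_grig

instantiation grig :: "{monoid_mult, inverse}"
begin
lift_definition one_grig :: grig is id by (rule gm_id)
lift_definition times_grig :: "grig \<Rightarrow> grig \<Rightarrow> grig" is "(\<circ>)" by (rule grig_maps_comp)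
lift_definition inverse_grig :: "grig \<Rightarrow> grig" is "inv_into UNIV" by (rule grig_maps_inv)
definition divide_grig :: "grig \<Rightarrow> grig \<Rightarrow> grig" where "divide_grig x y = x * inverse y"
instance by standard (transfer; auto simp: fun_eq_iff)+
end

lemma inv_left [simp]: "inverse x * x = (1::grig)"
  by transfer (simp add: grig_maps_bij bij_is_inj)

lemma inv_right [simp]: "x * inverse x = (1::grig)"
  by transfer (simp add: fun_eq_iff surj_f_inv_f grig_maps_bij bij_is_surj)

lemma inv_cancel [simp]: "inverse x * (x * y) = (y::grig)" "x * (inverse x * y) = (y::grig)"
  by (simp_all flip: mult.assoc)

lemma left_cancel [simp]: "x * y = x * z \<longleftrightarrow> y = (z::grig)"
proof
  assume "x * y = x * z"
  then have "inverse x * (x * y) = inverse x * (x * z)" by (rule arg_cong)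
  then show "y = z" by (simp only: inv_cancel)
qed simp

lemma right_cancel [simp]: "y * x = z * x \<longleftrightarrow> y = (z::grig)"
proof
  assume "y * x = z * x"
  then have "y * x * inverse x = z * x * inverse x" by (rule arg_cong)
  then show "y = z" by (simp only: mult.assoc inv_right mult_1_right)
qed simp

lemma inv_unique: "x * y = (1::grig) \<Longrightarrow> inverse x = y"
  using inv_cancel(1)[of x y] by simp

lemma inv_inv [simp]: "inverse (inverse x) = (x::grig)"
  by (rule inv_unique) simp

lemma inv_mult [simp]: "inverse (x * y) = inverse y * inverse (x::grig)"
  by (rule inv_unique) (simp add: mult.assoc)

lemma inv_one [simp]: "inverse 1 = (1::grig)"
  by (rule inv_unique) simp

lift_definition ga :: grig is flip_a by (rule grig_maps_gens)
lift_definition gb :: grig is gen_b by (rule grig_maps_gens)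
lift_definition gc :: grig is gen_c by (rule grig_maps_gens)
lift_definition gd :: grig is gen_d by (rule grig_maps_gens)

lemma act_simps [simp]:
  "act 1 s = s" "act (g * h) s = act g (act h s)"
  "act ga = flip_a" "act gb = gen_b" "act gc = gen_c" "act gd = gen_d"
  by (transfer; simp)+

lemma act_inject_iff: "g = h \<longleftrightarrow> (\<forall>s. act g s = act h s)"
  by (simp add: act_inject[symmetric] fun_eq_iff)

lemma gens_mult [simp]:
  "ga * ga = 1" "gb * gb = 1" "gc * gc = 1" "gd * gd = 1"
  "gb * gc = gd" "gc * gb = gd" "gb * gd = gc" "gd * gb = gc" "gc * gd = gb" "gd * gc = gb"
  by (simp_all add: act_inject_iff gen_prod)

lemma gens_mult2 [simp]:
  "ga * (ga * x) = x" "gb * (gb * x) = x" "gc * (gc * x) = x" "gd * (gd * x) = x"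
  "gb * (gc * x) = gd * x" "gc * (gb * x) = gd * x" "gb * (gd * x) = gc * x"
  "gd * (gb * x) = gc * x" "gc * (gd * x) = gb * x" "gd * (gc * x) = gb * x"
  by (simp_all flip: mult.assoc)

lemma gens_inv [simp]: "inverse ga = ga" "inverse gb = gb" "inverse gc = gc" "inverse gd = gd"
  by (simp_all add: inv_unique)

lemma grig_induct [case_names one a b c d]:
  assumes "P 1" "\<And>g. P g \<Longrightarrow> P (ga * g)" "\<And>g. P g \<Longrightarrow> P (gb * g)"
    "\<And>g. P g \<Longrightarrow> P (gc * g)" "\<And>g. P g \<Longrightarrow> P (gd * g)"
  shows "P g"
proof -
  have "P (grig_of f)" if "f \<in> grig_maps" for f
    using that
  proof (induction rule: grig_maps.induct)
    case gm_id then show ?case using assms(1) by (simp add: one_grig_def id_def)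
  next
    case (gm_a f) then show ?case using assms(2)[OF gm_a.IH]
      by (simp add: times_grig_def ga_def grig_of_inverse grig_maps_gens o_def)
  next
    case (gm_b f) then show ?case using assms(3)[OF gm_b.IH]
      by (simp add: times_grig_def gb_def grig_of_inverse grig_maps_gens o_def)
  next
    case (gm_c f) then show ?case using assms(4)[OF gm_c.IH]
      by (simp add: times_grig_def gc_def grig_of_inverse grig_maps_gens o_def)
  next
    case (gm_d f) then show ?case using assms(5)[OF gm_d.IH]
      by (simp add: times_grig_def gd_def grig_of_inverse grig_maps_gens o_def)
  qed
  from this[OF act[of g]] show ?thesis by (simp add: act_inverse)
qed

section \<open>Wreath recursion on the first level\<close>

definition wreath :: "grig \<Rightarrow> bool \<Rightarrow> grig \<Rightarrow> grig \<Rightarrow> bool" where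
  "wreath g e l r \<longleftrightarrow> (\<forall>s. act g (e # s) = False # act l s \<and> act g ((\<not> e) # s) = True # act r s)"

lemma wreath_mult:
  assumes "wreath g e l r" "wreath h e' l' r'"
  shows "wreath (g * h) (e \<noteq> e') (l * (if e then r' else l')) (r * (if e then l' else r'))"
  using assms by (cases e; cases e'; simp add: wreath_def)

lemma wreath_gens:
  "wreath 1 False 1 1" "wreath ga True 1 1" "wreath gb False ga gc" "wreath gc False ga gd"
  "wreath gd False 1 gb"
  by (simp_all add: wreath_def)

lemma wreath_exists: "\<exists>e l r. wreath g e l r"
proof (induction g rule: grig_induct)
  case one show ?case using wreath_gens(1) by blast
next
  case (a g) then show ?case using wreath_mult[OF wreath_gens(2)] by blast
next
  case (b g) then show ?case using wreath_mult[OF wreath_gens(3)] by blast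
next
  case (c g) then show ?case using wreath_mult[OF wreath_gens(4)] by blast
next
  case (d g) then show ?case using wreath_mult[OF wreath_gens(5)] by blast
qed

lemma wreath_unique:
  assumes "wreath g e l r" "wreath g e' l' r'" shows "e = e' \<and> l = l' \<and> r = r'"
proof -
  have "e = e'"
  proof (rule ccontr)
    assume "e \<noteq> e'"
    then have "e = (\<not> e')" by simp
    then have "act g (e # []) = True # act r' []" using assms(2) by (simp only: wreath_def)
    moreover have "act g (e # []) = False # act l []" using assms(1) by (simp only: wreath_def)
    ultimately show False by simp
  qed
  then show ?thesis using assms by (simp add: wreath_def act_inject_iff)
qed

text \<open>The decomposition \<open>g = (lft g, rgt g) a\<^sup>e\<close> with \<open>e = 1\<close> iff \<open>flips g\<close>. The sections are
  indexed by the first bit of the image.\<close>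

definition flips :: "grig \<Rightarrow> bool" where "flips g = (SOME e. \<exists>l r. wreath g e l r)"
definition lft :: "grig \<Rightarrow> grig" where "lft g = (SOME l. \<exists>e r. wreath g e l r)"
definition rgt :: "grig \<Rightarrow> grig" where "rgt g = (SOME r. \<exists>e l. wreath g e l r)"

lemma wreath_eq: assumes "wreath g e l r" shows "flips g = e" "lft g = l" "rgt g = r"
  unfolding flips_def lft_def rgt_def
  by (rule some_equality; use assms wreath_unique[OF assms] in blast)+

lemma wreath: "wreath g (flips g) (lft g) (rgt g)"
proof -
  obtain e l r where w: "wreath g e l r" using wreath_exists by blast
  show ?thesis using w unfolding wreath_eq[OF w] .
qed

lemma act_Nil [simp]: "act g [] = []"
  by (induction g rule: grig_induct) simp_all

lemma wreath_eqI: assumes "flips g = flips h" "lft g = lft h" "rgt g = rgt h" shows "g = h"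
  unfolding act_inject_iff
proof
  fix s show "act g s = act h s"
  proof (cases s)
    case (Cons x s')
    show ?thesis
    proof (cases "x = flips g")
      case True
      then show ?thesis using wreath[of g] wreath[of h] assms Cons by (simp add: wreath_def)
    next
      case False
      then have "x = (\<not> flips g)" by simp
      then show ?thesis using wreath[of g] wreath[of h] assms Cons by (simp add: wreath_def)
    qed
  qed simp
qed

text \<open>As sections are attached to the image vertex, only the flip of the left factor decides
  which section of the right factor it meets.\<close>

lemma wreath_section_mult [simp]:
  "flips (g * h) \<longleftrightarrow> flips g \<noteq> flips h"
  "lft (g * h) = lft g * (if flips g then rgt h else lft h)"
  "rgt (g * h) = rgt g * (if flips g then lft h else rgt h)"
  using wreath_eq[OF wreath_mult[OF wreath wreath]] by simp_all

lemma wreath_section_gens [simp]: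
  "flips 1 = False" "lft 1 = 1" "rgt 1 = 1"
  "flips ga = True" "lft ga = 1" "rgt ga = 1"
  "flips gb = False" "lft gb = ga" "rgt gb = gc"
  "flips gc = False" "lft gc = ga" "rgt gc = gd"
  "flips gd = False" "lft gd = 1" "rgt gd = gb"
  using wreath_gens[THEN wreath_eq(1)] wreath_gens[THEN wreath_eq(2)] wreath_gens[THEN wreath_eq(3)]
  by simp_all

lemma wreath_section_inverse [simp]:
  "flips (inverse g) = flips g"
  "lft (inverse g) = (if flips g then inverse (rgt g) else inverse (lft g))"
  "rgt (inverse g) = (if flips g then inverse (lft g) else inverse (rgt g))"
proof -
  have 1: "flips (inverse g) = flips g"
    using wreath_section_mult(1)[of "inverse g" g] unfolding inv_left wreath_section_gens by simp
  have 2: "lft (inverse g) * (if flips g then rgt g else lft g) = 1"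
    using wreath_section_mult(2)[of "inverse g" g] unfolding inv_left wreath_section_gens 1 by (rule sym)
  have 3: "rgt (inverse g) * (if flips g then lft g else rgt g) = 1"
    using wreath_section_mult(3)[of "inverse g" g] unfolding inv_left wreath_section_gens 1 by (rule sym)
  show "flips (inverse g) = flips g" by (rule 1)
  show "lft (inverse g) = (if flips g then inverse (rgt g) else inverse (lft g))"
    using inv_unique[OF 2] inv_inv[of "lft (inverse g)"] by (cases "flips g") simp_all
  show "rgt (inverse g) = (if flips g then inverse (lft g) else inverse (rgt g))"
    using inv_unique[OF 3] inv_inv[of "rgt (inverse g)"] by (cases "flips g") simp_all
qed

section \<open>Dense subgroups and central series\<close>

definition subgrp :: "grig set \<Rightarrow> bool" where
  "subgrp H \<longleftrightarrow> 1 \<in> H \<and> (\<forall>x\<in>H. \<forall>y\<in>H. x * y \<in> H) \<and> (\<forall>x\<in>H. inverse x \<in> H)"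

definition nsubgrp :: "grig set \<Rightarrow> bool" where
  "nsubgrp N \<longleftrightarrow> subgrp N \<and> (\<forall>x\<in>N. \<forall>g. g * x * inverse g \<in> N)"

lemma subgrpD:
  assumes "subgrp H"
  shows "1 \<in> H" "x \<in> H \<Longrightarrow> y \<in> H \<Longrightarrow> x * y \<in> H" "x \<in> H \<Longrightarrow> inverse x \<in> H"
  using assms by (auto simp: subgrp_def)

lemma subgrp_mult_iff:
  assumes "subgrp H" "x \<in> H" shows "x * y \<in> H \<longleftrightarrow> y \<in> H" "y * x \<in> H \<longleftrightarrow> y \<in> H"
proof -
  show "x * y \<in> H \<longleftrightarrow> y \<in> H"
    using subgrpD(2)[OF assms(1) subgrpD(3)[OF assms], of "x * y"] subgrpD(2)[OF assms] by auto
  show "y * x \<in> H \<longleftrightarrow> y \<in> H"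
    using subgrpD(2)[OF assms(1), of "y * x" "inverse x"] subgrpD(2)[OF assms(1) _ assms(2), of y]
      subgrpD(3)[OF assms] by (auto simp: mult.assoc)
qed

lemma subgrp_inverse_iff: "subgrp H \<Longrightarrow> inverse x \<in> H \<longleftrightarrow> x \<in> H"
  using subgrpD(3)[of H x] subgrpD(3)[of H "inverse x"] by auto

lemma nsubgrpD:
  assumes "nsubgrp N"
  shows "subgrp N" "x \<in> N \<Longrightarrow> g * x * inverse g \<in> N" "x \<in> N \<Longrightarrow> inverse g * x * g \<in> N"
  using assms unfolding nsubgrp_def by (auto dest!: bspec[of N _ x] dest: spec[of _ g] spec[of _ "inverse g"])

lemma nsubgrp_conj_iff: "nsubgrp N \<Longrightarrow> g * x * inverse g \<in> N \<longleftrightarrow> x \<in> N"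
  using nsubgrpD(2)[of N x g] nsubgrpD(3)[of N "g * x * inverse g" g] by (auto simp: mult.assoc)

section \<open>The abelianisation\<close>

definition chi1 :: "grig \<Rightarrow> bool" where "chi1 g \<longleftrightarrow> flips (lft g) \<noteq> flips (rgt g)"
definition chi2 :: "grig \<Rightarrow> bool" where "chi2 g \<longleftrightarrow> chi1 (lft g) \<noteq> chi1 (rgt g)"

text \<open>In any word for \<open>g\<close>, \<open>flips\<close> is the parity of the letters
  \<open>a\<close>, \<open>chi1\<close> that of \<open>b\<close> and \<open>c\<close> together,
  \<open>chi2\<close> that of \<open>b\<close> and \<open>d\<close> together. Read off from the
  action, they are well defined without a study of relations.\<close>

definition abtype :: "grig \<Rightarrow> bool \<times> bool \<times> bool" where "abtype g = (flips g, chi1 g, chi2 g)"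

lemma chi_mult [simp]:
  "chi1 (g * h) \<longleftrightarrow> chi1 g \<noteq> chi1 h" "chi2 (g * h) \<longleftrightarrow> chi2 g \<noteq> chi2 h"
proof -
  show *: "chi1 (g * h) \<longleftrightarrow> chi1 g \<noteq> chi1 h" for g h by (auto simp: chi1_def)
  show "chi2 (g * h) \<longleftrightarrow> chi2 g \<noteq> chi2 h" by (auto simp: chi2_def *)
qed

lemma chi_gens [simp]:
  "chi1 1 = False" "chi1 ga = False" "chi1 gb = True" "chi1 gc = True" "chi1 gd = False"
  "chi2 1 = False" "chi2 ga = False" "chi2 gb = True" "chi2 gc = False" "chi2 gd = True"
  by (simp_all add: chi1_def chi2_def)

lemma chi_inverse [simp]: "chi1 (inverse g) = chi1 g" "chi2 (inverse g) = chi2 g"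
  using chi_mult[of "inverse g" g] unfolding inv_left chi_gens by simp_all

lemma abtype_eq_iff: "abtype g = abtype h \<longleftrightarrow> flips g = flips h \<and> chi1 g = chi1 h \<and> chi2 g = chi2 h"
  by (simp add: abtype_def)

text \<open>Together with the definition of \<open>chi2\<close>, this computes the type of
  \<open>lft g * rgt g\<close> from the type of \<open>g\<close>: on \<open>chi1\<close> and
  \<open>chi2\<close> it is the shift of letters \<open>b\<close> to \<open>c\<close> to
  \<open>d\<close> to \<open>b\<close>.\<close>

lemma chi2_sections: "(chi2 (lft g) \<noteq> chi2 (rgt g)) \<longleftrightarrow> (chi1 g \<noteq> chi2 g)"
  by (induction g rule: grig_induct) auto

text \<open>Since \<open>b = cd\<close>, a homomorphism to Z/2 is fixed by its values on
  \<open>a\<close>, \<open>c\<close>, \<open>d\<close>; the abelianisation is thus no larger than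
  the target of \<open>abtype\<close>.\<close>

lemma hom_abtype:
  assumes "\<And>g h. f (g * h) \<longleftrightarrow> f g \<noteq> f h"
  shows "f g \<longleftrightarrow> ((flips g \<and> f ga) \<noteq> ((chi1 g \<and> f gc) \<noteq> (chi2 g \<and> f gd)))"
proof -
  have b: "f gb \<longleftrightarrow> f gc \<noteq> f gd" using assms[of gc gd] by simp
  have "\<not> f 1" using assms[of 1 1] by simp
  then show ?thesis
    by (induction g rule: grig_induct) (auto simp: assms b)
qed

text \<open>Modulo squares the group is abelian of exponent 2, so each element agrees with a product
  of powers of \<open>a\<close>, \<open>c\<close>, \<open>d\<close> whose exponents are its type.
  \<open>C\<close> is normal because it contains all commutators.\<close>

lemma squares_abtype_kernel:
  assumes C: "subgrp C" and sq: "\<And>g. g * g \<in> C" and g: "abtype g = abtype 1"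
  shows "g \<in> C"
proof -
  define st where "st p q r = (if p then ga else 1) * ((if q then gc else 1) * (if r then gd else 1))" for p q r
  have comm: "g * h * inverse g * inverse h \<in> C" for g h
  proof -
    \<comment> \<open>The commutator of \<open>g\<close> and \<open>h\<close> is the product of the
      squares of \<open>g * h\<close>, \<open>inverse h * inverse g * h\<close> and
      \<open>inverse h\<close>.\<close>
    have "(g * h) * (g * h) * ((inverse h * inverse g * h) * (inverse h * inverse g * h)) * (inverse h * inverse h) \<in> C"
      by (intro subgrpD(2)[OF C] sq)
    then show ?thesis by (simp add: mult.assoc)
  qed
  have norm: "g * x * inverse g \<in> C" if "x \<in> C" for g x
    using subgrpD(2)[OF C comm[of g x] that] by (simp add: mult.assoc)
  have "\<exists>k\<in>C. g = k * st (flips g) (chi1 g) (chi2 g)" for g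
  proof (induction g rule: grig_induct)
    case one show ?case using subgrpD(1)[OF C] by (auto simp: st_def)
  next
    case (a g)
    then obtain k where k: "k \<in> C" "g = k * st (flips g) (chi1 g) (chi2 g)" by blast
    show ?case
    proof (rule bexI[of _ "ga * k * inverse ga"])
      show "ga * k * inverse ga \<in> C" by (rule norm[OF k(1)])
      show "ga * g = ga * k * inverse ga * st (flips (ga * g)) (chi1 (ga * g)) (chi2 (ga * g))"
        by (subst k(2)) (simp add: st_def mult.assoc)
    qed
  next
    case (b g)
    then obtain k where k: "k \<in> C" "g = k * st (flips g) (chi1 g) (chi2 g)" by blast
    \<comment> \<open>Moving the letter past a possible \<open>a\<close> costs its commutator with
      \<open>e\<close>, which lies in \<open>C\<close>.\<close>
    define e where "e = (if flips g then ga else 1)"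
    show ?case
    proof (rule bexI[of _ "(gb * k * inverse gb) * (gb * e * inverse gb * inverse e)"])
      show "(gb * k * inverse gb) * (gb * e * inverse gb * inverse e) \<in> C"
        by (intro norm[OF k(1)] comm subgrpD(2)[OF C])
      show "gb * g = (gb * k * inverse gb) * (gb * e * inverse gb * inverse e)
          * st (flips (gb * g)) (chi1 (gb * g)) (chi2 (gb * g))"
        by (subst k(2)) (simp add: st_def e_def mult.assoc)
    qed
  next
    case (c g)
    then obtain k where k: "k \<in> C" "g = k * st (flips g) (chi1 g) (chi2 g)" by blast
    define e where "e = (if flips g then ga else 1)"
    show ?case
    proof (rule bexI[of _ "(gc * k * inverse gc) * (gc * e * inverse gc * inverse e)"])
      show "(gc * k * inverse gc) * (gc * e * inverse gc * inverse e) \<in> C"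
        by (intro norm[OF k(1)] comm subgrpD(2)[OF C])
      show "gc * g = (gc * k * inverse gc) * (gc * e * inverse gc * inverse e)
          * st (flips (gc * g)) (chi1 (gc * g)) (chi2 (gc * g))"
        by (subst k(2)) (simp add: st_def e_def mult.assoc)
    qed
  next
    case (d g)
    then obtain k where k: "k \<in> C" "g = k * st (flips g) (chi1 g) (chi2 g)" by blast
    define e where "e = (if flips g then ga else 1)"
    show ?case
    proof (rule bexI[of _ "(gd * k * inverse gd) * (gd * e * inverse gd * inverse e)"])
      show "(gd * k * inverse gd) * (gd * e * inverse gd * inverse e) \<in> C"
        by (intro norm[OF k(1)] comm subgrpD(2)[OF C])
      show "gd * g = (gd * k * inverse gd) * (gd * e * inverse gd * inverse e)
          * st (flips (gd * g)) (chi1 (gd * g)) (chi2 (gd * g))"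
        by (subst k(2)) (simp add: st_def e_def mult.assoc)
    qed
  qed
  from this[of g] show ?thesis using g unfolding abtype_eq_iff by (auto simp: st_def)
qed

text \<open>A series of normal subgroups of G from G down to \<open>N\<close>. The condition on
  \<open>x\<close> and \<open>y\<close> says that \<open>M\<close> has index at most 2 in the
  preceding term, so G/\<open>N\<close> is a finite 2-group.\<close>

inductive chain :: "grig set \<Rightarrow> bool" where
  chain_UNIV: "chain UNIV"
| chain_step: "chain N \<Longrightarrow> nsubgrp M \<Longrightarrow> M \<subseteq> N \<Longrightarrow>
    (\<And>x y. x \<in> N \<Longrightarrow> y \<in> N \<Longrightarrow> x \<notin> M \<Longrightarrow> y \<notin> M \<Longrightarrow> x * inverse y \<in> M) \<Longrightarrow> chain M"

lemma chain_nsubgrp: "chain N \<Longrightarrow> nsubgrp N"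
  by (induction rule: chain.induct) (auto simp: nsubgrp_def subgrp_def)

definition dense :: "grig set \<Rightarrow> bool" where
  "dense H \<longleftrightarrow> subgrp H \<and> (\<forall>g. \<exists>h\<in>H. abtype h = abtype g)"

text \<open>If \<open>S = H M\<close> were proper, then \<open>g \<notin> S\<close> would define a homomorphism onto \<open>\<int>/2\<close> that vanishes on \<open>H\<close>,
  although it factors through \<open>abtype\<close>.\<close>

lemma dense_chain:
  assumes "chain N" "dense H" shows "\<exists>h\<in>H. \<exists>n\<in>N. g = h * n"
  using assms(1)
proof (induction arbitrary: g rule: chain.induct)
  case chain_UNIV
  have "1 \<in> H" using assms(2) by (auto simp: dense_def subgrp_def)
  then show ?case by (intro bexI[of _ 1] bexI[of _ g]) auto
next
  case (chain_step N M)
  note N = nsubgrpD[OF chain_nsubgrp[OF chain_step.hyps(1)]] and M = nsubgrpD[OF chain_step.hyps(2)]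
  note sN = subgrpD[OF N(1)] and sM = subgrpD[OF M(1)]
  have H: "subgrp H" using assms(2) by (simp add: dense_def)
  define S where "S = {h * m | h m. h \<in> H \<and> m \<in> M}"
  have HS: "h \<in> H \<Longrightarrow> h \<in> S" for h unfolding S_def using sM(1) by force
  have S: "subgrp S" unfolding subgrp_def
  proof (intro conjI ballI)
    show "1 \<in> S" using HS subgrpD(1)[OF H] .
    show "x * y \<in> S" if xy: "x \<in> S" "y \<in> S" for x y
    proof -
      obtain h m h' m' where *: "x = h * m" "y = h' * m'" "h \<in> H" "h' \<in> H" "m \<in> M" "m' \<in> M"
        using xy unfolding S_def by blast
      have "x * y = (h * h') * ((inverse h' * m * h') * m')" by (simp add: * mult.assoc)
      then show ?thesis unfolding S_def using * M(3) sM(2) subgrpD(2)[OF H] by blast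
    qed
    show "inverse x \<in> S" if xy: "x \<in> S" for x
    proof -
      obtain h m where *: "x = h * m" "h \<in> H" "m \<in> M"
        using xy unfolding S_def by blast
      have "inverse x = inverse h * (h * inverse m * inverse h)" by (simp add: * mult.assoc)
      then show ?thesis unfolding S_def using * M(2) sM(3) subgrpD(3)[OF H] by blast
    qed
  qed
  note sS = subgrpD[OF S]
  have MS: "m \<in> M \<Longrightarrow> m \<in> S" for m unfolding S_def using subgrpD(1)[OF H] by force
  have "S = UNIV"
  proof (rule ccontr)
    assume "S \<noteq> UNIV"
    have "\<not> N \<subseteq> S"
    proof
      assume "N \<subseteq> S"
      then have "g \<in> S" for g using chain_step.IH[of g] HS sS(2) by auto
      with \<open>S \<noteq> UNIV\<close> show False by blast
    qed
    then obtain z where z: "z \<in> N" "z \<notin> S" by blast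
    have zM: "z \<notin> M" using z MS by blast
    have zz: "z * z \<in> S"
      using chain_step.hyps(4)[of z "inverse z"] z zM sN(3) subgrp_inverse_iff[OF M(1)] MS by simp
    \<comment> \<open>\<open>z\<close> and its conjugate by \<open>h\<close> lie in the same
      nontrivial coset of \<open>M\<close> in \<open>N\<close>; so \<open>z\<close> commutes with
      \<open>h\<close> up to \<open>M\<close> and normalises \<open>S\<close>.\<close>
    have conj: "z * s * inverse z \<in> S" if xy: "s \<in> S" for s
    proof -
      obtain h m where *: "s = h * m" "h \<in> H" "m \<in> M"
        using xy unfolding S_def by blast
      have 1: "inverse h * z * h \<in> N" "inverse h * z * h \<notin> M"
        using N(3)[OF z(1)] zM nsubgrp_conj_iff[OF chain_step.hyps(2), of "inverse h" z] by auto
      have "inverse h * z * h * inverse z \<in> M"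
        by (rule chain_step.hyps(4)) (use 1 z zM in auto)
      moreover have "z * m * inverse z \<in> M" using M(2) * by blast
      ultimately have "h * ((inverse h * z * h * inverse z) * (z * m * inverse z)) \<in> S"
        using * HS MS sS(2) by blast
      then show ?thesis by (simp add: * mult.assoc)
    qed
    \<comment> \<open>\<open>S\<close> has index 2: in \<open>g = h * n\<close> the factor
      \<open>n\<close> lies outside \<open>M\<close>, hence in the coset of
      \<open>z\<close>.\<close>
    have co: "g * inverse z \<in> S" if "g \<notin> S" for g
    proof -
      obtain h n where *: "h \<in> H" "n \<in> N" "g = h * n" using chain_step.IH[of g] by blast
      have "n \<notin> M" using * that MS HS sS(2) by blast
      then have "n * inverse z \<in> M" using chain_step.hyps(4) * z zM by blast
      then have "h * (n * inverse z) \<in> S" using * HS MS sS(2) by blast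
      then show ?thesis by (simp add: * mult.assoc)
    qed
    define f where "f g \<longleftrightarrow> g \<notin> S" for g
    have hom: "f (g * h) \<longleftrightarrow> f g \<noteq> f h" for g h
    proof (cases "g \<in> S")
      case True then show ?thesis using subgrp_mult_iff[OF S] by (simp add: f_def)
    next
      case g: False
      show ?thesis
      proof (cases "h \<in> S")
        case True then show ?thesis using subgrp_mult_iff[OF S] by (simp add: f_def)
      next
        case h: False
        have "(g * inverse z) * (z * (h * inverse z) * inverse z) * (z * z) \<in> S"
          by (rule sS(2)[OF sS(2)[OF co[OF g] conj[OF co[OF h]]] zz])
        then show ?thesis using g h by (simp add: f_def mult.assoc)
      qed
    qed
    obtain h where h: "h \<in> H" "abtype h = abtype z" using assms(2) unfolding dense_def by blast
    have "f h = f z" using h(2) unfolding hom_abtype[of f, OF hom, of h] hom_abtype[of f, OF hom, of z]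
      by (simp add: abtype_eq_iff)
    then show False using HS h z by (simp add: f_def)
  qed
  then have "g \<in> S" by simp
  then show ?case unfolding S_def by blast
qed

lemma set_multI: "x = n * m \<Longrightarrow> n \<in> N \<Longrightarrow> m \<in> M \<Longrightarrow> x \<in> {n * m | n m. n \<in> N \<and> m \<in> M}"
  by blast

text \<open>The image of the series in G/\<open>M\<close>, pulled back to G; its steps still have
  index at most 2.\<close>

lemma chain_mult:
  assumes "chain N" "nsubgrp M" shows "chain {n * m | n m. n \<in> N \<and> m \<in> M}"
  using assms(1)
proof (induction rule: chain.induct)
  case chain_UNIV
  have "{n * m | n m. n \<in> UNIV \<and> m \<in> M} = UNIV"
    using subgrpD(1)[OF nsubgrpD(1)[OF assms(2)]] by force
  then show ?case by (simp add: chain.chain_UNIV)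
next
  case (chain_step N N')
  note M = nsubgrpD[OF assms(2)] and N' = nsubgrpD[OF chain_step.hyps(2)]
  note sM = subgrpD[OF M(1)] and sN' = subgrpD[OF N'(1)]
  show ?case
  proof (rule chain.chain_step[OF chain_step.IH])
    show "{n * m | n m. n \<in> N' \<and> m \<in> M} \<subseteq> {n * m | n m. n \<in> N \<and> m \<in> M}"
      using chain_step.hyps(3) by blast
    show "nsubgrp {n * m | n m. n \<in> N' \<and> m \<in> M}"
      unfolding nsubgrp_def subgrp_def
    proof (intro conjI ballI allI)
      show "1 \<in> {n * m | n m. n \<in> N' \<and> m \<in> M}" using sM(1) sN'(1) by force
    next
      fix x y assume "x \<in> {n * m | n m. n \<in> N' \<and> m \<in> M}" "y \<in> {n * m | n m. n \<in> N' \<and> m \<in> M}"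
      then obtain n m n' m' where *: "x = n * m" "y = n' * m'" "n \<in> N'" "n' \<in> N'" "m \<in> M" "m' \<in> M"
        by blast
      have "x * y = (n * n') * ((inverse n' * m * n') * m')" by (simp add: * mult.assoc)
      moreover have "n * n' \<in> N'" "(inverse n' * m * n') * m' \<in> M" using * M(3) sM(2) sN'(2) by auto
      ultimately show "x * y \<in> {n * m | n m. n \<in> N' \<and> m \<in> M}" by (rule set_multI)
    next
      fix x assume "x \<in> {n * m | n m. n \<in> N' \<and> m \<in> M}"
      then obtain n m where *: "x = n * m" "n \<in> N'" "m \<in> M" by blast
      have "inverse x = inverse n * (n * inverse m * inverse n)" by (simp add: * mult.assoc)
      moreover have "inverse n \<in> N'" "n * inverse m * inverse n \<in> M" using * M(2) sM(3) sN'(3) by auto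
      ultimately show "inverse x \<in> {n * m | n m. n \<in> N' \<and> m \<in> M}" by (rule set_multI)
    next
      fix x g assume "x \<in> {n * m | n m. n \<in> N' \<and> m \<in> M}"
      then obtain n m where *: "x = n * m" "n \<in> N'" "m \<in> M" by blast
      have "g * x * inverse g = (g * n * inverse g) * (g * m * inverse g)" by (simp add: * mult.assoc)
      moreover have "g * n * inverse g \<in> N'" "g * m * inverse g \<in> M" using * M(2) N'(2) by auto
      ultimately show "g * x * inverse g \<in> {n * m | n m. n \<in> N' \<and> m \<in> M}" by (rule set_multI)
    qed
    fix x y
    assume xy: "x \<in> {n * m | n m. n \<in> N \<and> m \<in> M}" "y \<in> {n * m | n m. n \<in> N \<and> m \<in> M}"
      "x \<notin> {n * m | n m. n \<in> N' \<and> m \<in> M}" "y \<notin> {n * m | n m. n \<in> N' \<and> m \<in> M}"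
    then obtain n m n' m' where *: "x = n * m" "y = n' * m'" "n \<in> N" "n' \<in> N" "m \<in> M" "m' \<in> M"
      by blast
    have "n \<notin> N'" using xy(3) set_multI[OF *(1) _ *(5)] by blast
    moreover have "n' \<notin> N'" using xy(4) set_multI[OF *(2) _ *(6)] by blast
    ultimately
    have 1: "n * inverse n' \<in> N'" by (rule chain_step.hyps(4)[OF *(3,4)])
    have 2: "n' * (m * inverse m') * inverse n' \<in> M" by (intro M(2) sM(2,3) *)
    have "x * inverse y = (n * inverse n') * (n' * (m * inverse m') * inverse n')"
      by (simp add: * mult.assoc)
    from this 1 2 show "x * inverse y \<in> {n * m | n m. n \<in> N' \<and> m \<in> M}" by (rule set_multI)
  qed
qed

text \<open>If \<open>M\<close> contains \<open>N\<close>, multiplying the series by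
  \<open>M\<close> ends in \<open>M\<close> itself. This reduces finiteness of a 2-quotient to
  finding a smaller subgroup of known kind.\<close>

lemma chain_superset:
  assumes "chain N" "nsubgrp M" "N \<subseteq> M" shows "chain M"
proof -
  have "{n * m | n m. n \<in> N \<and> m \<in> M} = M"
  proof (intro equalityI subsetI)
    fix x assume "x \<in> {n * m | n m. n \<in> N \<and> m \<in> M}"
    then show "x \<in> M" using subgrpD(2)[OF nsubgrpD(1)[OF assms(2)]] assms(3) by auto
  next
    fix x assume "x \<in> M"
    then show "x \<in> {n * m | n m. n \<in> N \<and> m \<in> M}"
      by (intro set_multI[of _ 1 x] subgrpD(1)[OF nsubgrpD(1)[OF chain_nsubgrp[OF assms(1)]]]) simp_all
  qed
  then show ?thesis using chain_mult[OF assms(1,2)] by simp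
qed

lemma chain_kernel:
  assumes "chain N" "\<And>g h. f (g * h) \<longleftrightarrow> f g \<noteq> f h" shows "chain {g \<in> N. \<not> f g}"
proof -
  have 1: "\<not> f 1" using assms(2)[of 1 1] by simp
  have i: "f (inverse g) \<longleftrightarrow> f g" for g using assms(2)[of "inverse g" g] 1 by simp
  note N = chain_nsubgrp[OF assms(1)]
  show ?thesis
    by (rule chain_step[OF assms(1)]; use N 1 in \<open>auto simp: nsubgrp_def subgrp_def assms(2) i\<close>)
qed

lemma chain_abtype_kernel: "chain {g. abtype g = abtype 1}"
proof -
  have "chain {g \<in> {g \<in> {g \<in> UNIV. \<not> flips g}. \<not> chi1 g}. \<not> chi2 g}"
    by (intro chain_kernel chain_UNIV) simp_all
  then show ?thesis by (simp add: abtype_eq_iff conj_assoc)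
qed

section \<open>Section groups of dense subgroups\<close>

definition both_sections :: "grig set \<Rightarrow> grig set" where
  "both_sections N = {g. \<not> flips g \<and> lft g \<in> N \<and> rgt g \<in> N}"

lemma nsubgrp_both_sections: assumes "nsubgrp N" shows "nsubgrp (both_sections N)"
  unfolding nsubgrp_def subgrp_def both_sections_def
  using subgrpD[OF nsubgrpD(1)[OF assms]] nsubgrpD(2)[OF assms] by simp

lemma chain_both_sections: "chain N \<Longrightarrow> chain (both_sections N)"
proof (induction rule: chain.induct)
  case chain_UNIV
  have "both_sections UNIV = {g \<in> UNIV. \<not> flips g}" by (simp add: both_sections_def)
  then show ?case using chain_kernel[OF chain.chain_UNIV, of flips] by simp
next
  case (chain_step N M)
  note N = chain_nsubgrp[OF chain_step.hyps(1)] and M = chain_step.hyps(2)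
  note sM = subgrpD[OF nsubgrpD(1)[OF M]] and sN = subgrpD[OF nsubgrpD(1)[OF N]]
  have ind: "u * v \<in> M \<longleftrightarrow> (u \<in> M \<longleftrightarrow> v \<in> M)" if "u \<in> N" "v \<in> N" for u v
    using chain_step.hyps(4)[of u "inverse v"] that sN(3) subgrp_mult_iff[OF nsubgrpD(1)[OF M]]
      subgrp_inverse_iff[OF nsubgrpD(1)[OF M]] by auto
  note im = subgrp_inverse_iff[OF nsubgrpD(1)[OF M]]
  \<comment> \<open>The two sections together may cost index 4, so an intermediate group is
    inserted. Asking only for the left section to lie in \<open>M\<close> would not be invariant
    under \<open>a\<close>, which exchanges the sections; "both or neither" is.\<close>
  define P where "P = {g \<in> both_sections N. lft g \<in> M \<longleftrightarrow> rgt g \<in> M}"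
  have "chain P"
  proof (rule chain.chain_step[OF chain_step.IH])
    show "nsubgrp P" unfolding nsubgrp_def subgrp_def P_def both_sections_def
      using sN sM(1) nsubgrpD(2)[OF N] nsubgrp_conj_iff[OF M] by (auto simp: ind im)
    show "P \<subseteq> both_sections N" by (auto simp: P_def)
    fix x y assume "x \<in> both_sections N" "y \<in> both_sections N" "x \<notin> P" "y \<notin> P"
    then show "x * inverse y \<in> P" using sN by (auto simp: P_def both_sections_def ind im)
  qed
  then show ?case
  proof (rule chain.chain_step)
    show "nsubgrp (both_sections M)" by (rule nsubgrp_both_sections[OF M])
    show "both_sections M \<subseteq> P" using chain_step.hyps(3) by (auto simp: P_def both_sections_def)
    fix x y assume "x \<in> P" "y \<in> P" "x \<notin> both_sections M" "y \<notin> both_sections M"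
    then show "x * inverse y \<in> both_sections M" using sN by (auto simp: P_def both_sections_def ind im)
  qed
qed

definition left_sections :: "grig set \<Rightarrow> grig set" where "left_sections H = {lft h | h. h \<in> H \<and> \<not> flips h}"
definition right_sections :: "grig set \<Rightarrow> grig set" where "right_sections H = {rgt h | h. h \<in> H \<and> \<not> flips h}"
definition conj_set :: "grig \<Rightarrow> grig set \<Rightarrow> grig set" where "conj_set g H = {x. inverse g * x * g \<in> H}"

text \<open>Self-replication: \<open>b\<close>, \<open>ada\<close>, \<open>aba\<close>,
  \<open>aca\<close> fix the first level and have left sections \<open>a\<close>, \<open>b\<close>,
  \<open>c\<close>, \<open>d\<close>.\<close>

lemma lft_surj: "\<exists>g. \<not> flips g \<and> lft g = x"
proof (induction x rule: grig_induct)
  case one show ?case by (intro exI[of _ 1]) simp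
next
  case (a x) then obtain g where "\<not> flips g" "lft g = x" by blast
  then show ?case by (intro exI[of _ "gb * g"]) simp
next
  case (b x) then obtain g where "\<not> flips g" "lft g = x" by blast
  then show ?case by (intro exI[of _ "ga * gd * ga * g"]) simp
next
  case (c x) then obtain g where "\<not> flips g" "lft g = x" by blast
  then show ?case by (intro exI[of _ "ga * gb * ga * g"]) simp
next
  case (d x) then obtain g where "\<not> flips g" "lft g = x" by blast
  then show ?case by (intro exI[of _ "ga * gc * ga * g"]) simp
qed

lemma subgrp_left_sections: assumes "subgrp H" shows "subgrp (left_sections H)"
  unfolding subgrp_def
proof (intro conjI ballI)
  show "1 \<in> left_sections H" unfolding left_sections_def using subgrpD(1)[OF assms] wreath_section_gens(1,2) by (intro CollectI exI[of _ 1]) simp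
  fix x assume "x \<in> left_sections H"
  then obtain g where g: "g \<in> H" "\<not> flips g" "x = lft g" unfolding left_sections_def by blast
  show "inverse x \<in> left_sections H" unfolding left_sections_def using subgrpD(3)[OF assms g(1)] g
    by (intro CollectI exI[of _ "inverse g"]) simp
  fix y assume "y \<in> left_sections H"
  then obtain h where h: "h \<in> H" "\<not> flips h" "y = lft h" unfolding left_sections_def by blast
  show "x * y \<in> left_sections H" unfolding left_sections_def using subgrpD(2)[OF assms g(1) h(1)] g h
    by (intro CollectI exI[of _ "g * h"]) simp
qed

lemma subgrp_conj_set: assumes "subgrp H" shows "subgrp (conj_set g H)"
  unfolding subgrp_def conj_set_def
proof (simp add: subgrpD(1)[OF assms], intro conjI allI impI)
  fix x assume x: "inverse g * x * g \<in> H"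
  then show "inverse g * inverse x * g \<in> H" using subgrpD(3)[OF assms x] by (simp add: mult.assoc)
  fix y assume y: "inverse g * y * g \<in> H"
  then show "inverse g * (x * y) * g \<in> H" using subgrpD(2)[OF assms x y] by (simp add: mult.assoc)
qed

lemma dense_conj_set: assumes "dense H" shows "dense (conj_set g H)"
  unfolding dense_def
proof (intro conjI allI)
  show "subgrp (conj_set g H)" using assms subgrp_conj_set unfolding dense_def by blast
  fix x obtain h where h: "h \<in> H" "abtype h = abtype x" using assms unfolding dense_def by blast
  then show "\<exists>h\<in>conj_set g H. abtype h = abtype x"
    by (intro bexI[of _ "g * h * inverse g"]) (auto simp: conj_set_def mult.assoc abtype_eq_iff)
qed

lemma conj_set_UNIV: "conj_set g H = UNIV \<Longrightarrow> H = UNIV"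
proof -
  assume *: "conj_set g H = UNIV"
  have "x \<in> H" for x
  proof -
    have "g * x * inverse g \<in> conj_set g H" using * by simp
    then show ?thesis by (simp add: conj_set_def mult.assoc)
  qed
  then show ?thesis by blast
qed

text \<open>An element with a prescribed left section is approximated by \<open>H\<close> modulo the
  elements whose two sections have trivial type.\<close>

lemma dense_left_sections: assumes "dense H" shows "dense (left_sections H)"
  unfolding dense_def
proof (intro conjI allI)
  show "subgrp (left_sections H)" using assms subgrp_left_sections unfolding dense_def by blast
  fix x
  obtain g where g: "\<not> flips g" "lft g = x" using lft_surj by blast
  obtain h n where "h \<in> H" "n \<in> both_sections {g. abtype g = abtype 1}" "g = h * n"
    using dense_chain[OF chain_both_sections[OF chain_abtype_kernel] assms] by blast
  then show "\<exists>h\<in>left_sections H. abtype h = abtype x"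
    using g by (intro bexI[of _ "lft h"]) (auto simp: left_sections_def both_sections_def abtype_eq_iff)
qed

lemma dense_flips: assumes "dense H" obtains x where "x \<in> H" "flips x"
proof -
  obtain h where "h \<in> H" "abtype h = abtype ga" using assms unfolding dense_def by blast
  then show ?thesis using that by (auto simp: abtype_eq_iff)
qed

text \<open>Conjugation by an element of \<open>H\<close> that flips the first bit carries one
  section group to the other. Results on the left side thereby transfer to the right side.\<close>

lemma right_sections_eq_conj_set_left_sections: assumes "subgrp H" "x \<in> H" "flips x" shows "right_sections H = conj_set (rgt x) (left_sections H)"
proof (intro equalityI subsetI)
  fix y assume "y \<in> right_sections H"
  then obtain h where h: "h \<in> H" "\<not> flips h" "y = rgt h" unfolding right_sections_def by blast
  have "inverse x * h * x \<in> H" using assms h by (simp add: subgrpD)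
  then show "y \<in> conj_set (rgt x) (left_sections H)" unfolding conj_set_def left_sections_def using h assms(3)
    by (intro CollectI exI[of _ "inverse x * h * x"]) simp
next
  fix y assume "y \<in> conj_set (rgt x) (left_sections H)"
  then obtain h where h: "h \<in> H" "\<not> flips h" "inverse (rgt x) * y * rgt x = lft h"
    unfolding conj_set_def left_sections_def by blast
  have "x * h * inverse x \<in> H" using assms h by (simp add: subgrpD)
  moreover have "rgt (x * h * inverse x) = y" using h(2) assms(3) by (simp add: h(3)[symmetric] mult.assoc)
  ultimately show "y \<in> right_sections H" unfolding right_sections_def using h assms(3)
    by (intro CollectI exI[of _ "x * h * inverse x"]) simp
qed

section \<open>The branching subgroup\<close>

definition normal_closure :: "grig set \<Rightarrow> grig set" where
  "normal_closure A = {x. \<forall>N. nsubgrp N \<longrightarrow> A \<subseteq> N \<longrightarrow> x \<in> N}"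

lemma nsubgrp_normal_closure: "nsubgrp (normal_closure A)"
  unfolding normal_closure_def nsubgrp_def subgrp_def by simp

lemma normal_closure_incl: "x \<in> A \<Longrightarrow> x \<in> normal_closure A"
  unfolding normal_closure_def by blast

lemma normal_closure_least: "nsubgrp N \<Longrightarrow> A \<subseteq> N \<Longrightarrow> normal_closure A \<subseteq> N"
  unfolding normal_closure_def by blast

text \<open>The classical regular branch subgroup, generated as a normal subgroup by the square of
  \<open>ab\<close>. It contains a copy of itself below a vertex of level 1, see
  \<open>K_grp_lift\<close>. \<open>K_der\<close> is its commutator subgroup.\<close>

definition K_grp :: "grig set" where "K_grp = normal_closure {ga * gb * ga * gb}"
definition K_der :: "grig set" where
  "K_der = normal_closure {x * y * inverse x * inverse y | x y. x \<in> K_grp \<and> y \<in> K_grp}"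

lemmas K_grp_normal = nsubgrpD[OF nsubgrp_normal_closure[of "{ga * gb * ga * gb}", folded K_grp_def]]
lemmas K_grp_subgrp = subgrpD[OF K_grp_normal(1)]
lemmas K_der_normal = nsubgrpD[OF nsubgrp_normal_closure[of "{x * y * inverse x * inverse y | x y. x \<in> K_grp \<and> y \<in> K_grp}", folded K_der_def]]
lemma K_grp_gen: "ga * gb * ga * gb \<in> K_grp"
  unfolding K_grp_def by (rule normal_closure_incl) simp

lemma K_der_comm: "x \<in> K_grp \<Longrightarrow> y \<in> K_grp \<Longrightarrow> x * y * inverse x * inverse y \<in> K_der"
  unfolding K_der_def by (rule normal_closure_incl) blast

lemma K_grp_least: "nsubgrp N \<Longrightarrow> ga * gb * ga * gb \<in> N \<Longrightarrow> K_grp \<subseteq> N"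
  unfolding K_grp_def by (rule normal_closure_least) auto

lemma K_der_least:
  "nsubgrp N \<Longrightarrow> (\<And>x y. x \<in> K_grp \<Longrightarrow> y \<in> K_grp \<Longrightarrow> x * y * inverse x * inverse y \<in> N) \<Longrightarrow> K_der \<subseteq> N"
  unfolding K_der_def by (rule normal_closure_least) auto

text \<open>\<open>G / K_grp\<close> has order 16: it is generated by the central involution \<open>b\<close> and the dihedral group
  \<open>\<langle>a, d\<rangle>\<close> of order 8, whose centre is generated by \<open>z = (ad)\<^sup>2\<close>.\<close>

lemma chain_K_grp: "chain K_grp"
proof -
  define z where "z = ga * gd * ga * gd"
  have zz: "z * z = 1" by (rule wreath_eqI) (simp_all add: z_def)
  then have zi: "inverse z = z" by (rule inv_unique)
  have zz': "z * (z * x) = x" for x using zz by (simp flip: mult.assoc)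
  have baba: "gb * ga * gb * ga \<in> K_grp" using K_grp_subgrp(3)[OF K_grp_gen] by (simp add: mult.assoc)
  have zcen: "g * z * inverse g * z \<in> K_grp" for g
  proof -
    have m: "g * h * z * inverse (g * h) * z \<in> K_grp"
      if "g * z * inverse g * z \<in> K_grp" "h * z * inverse h * z \<in> K_grp" for g h
    proof -
      have "g * (h * z * inverse h * z) * inverse g * (g * z * inverse g * z) \<in> K_grp"
        by (intro K_grp_subgrp(2) K_grp_normal(2) that)
      then show ?thesis by (simp add: mult.assoc zz')
    qed
    have a: "ga * z * inverse ga * z \<in> K_grp" using K_grp_subgrp(1) by (simp add: z_def mult.assoc)
    have d: "gd * z * inverse gd * z \<in> K_grp"
    proof -
      have "gd * z * inverse gd * z = z * z" by (rule wreath_eqI) (simp_all add: z_def)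
      then show ?thesis using K_grp_subgrp(1) zz by simp
    qed
    have b: "gb * z * inverse gb * z \<in> K_grp"
    proof -
      \<comment> \<open>The trivial factor \<open>z * z\<close> is the relation that makes this
        product of conjugates of the inverse generator agree with
        \<open>gb * z * inverse gb * z\<close> as a word.\<close>
      have "(gb * ga * gb * ga) * ((ga * gd) * (gb * ga * gb * ga) * inverse (ga * gd)) * (z * z) \<in> K_grp"
        unfolding zz by (intro K_grp_subgrp(1,2) K_grp_normal(2) baba)
      moreover have "(gb * ga * gb * ga) * ((ga * gd) * (gb * ga * gb * ga) * inverse (ga * gd)) * (z * z)
         = gb * z * inverse gb * z"
        by (simp add: z_def mult.assoc)
      ultimately show ?thesis by simp
    qed
    have c: "gc * z * inverse gc * z \<in> K_grp" using m[OF b d] by simp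
    show ?thesis
    proof (induction g rule: grig_induct)
      case one show ?case using K_grp_subgrp(1) zz by simp
    qed (intro m a b c d; assumption)+
  qed
  \<comment> \<open>The product of \<open>K_grp\<close> and the group of order 2 generated by
    \<open>z\<close>. Modulo \<open>N\<close> the generators commute and are involutions, so
    \<open>N\<close> contains all squares and hence the kernel of the type; \<open>K_grp\<close> has
    index at most 2 in it.\<close>
  define N where "N = {x. x \<in> K_grp \<or> x * z \<in> K_grp}"
  have Nz: "x * z \<in> N \<longleftrightarrow> x \<in> N" for x by (auto simp: N_def mult.assoc zz)
  have zconj: "z * x * z \<in> K_grp \<longleftrightarrow> x \<in> K_grp" for x
    using nsubgrp_conj_iff[of K_grp z x] nsubgrp_normal_closure[of "{ga * gb * ga * gb}"] unfolding K_grp_def zi by blast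
  have Nmult: "x * y \<in> N" if "x \<in> N" "y \<in> N" for x y
  proof -
    have 1: "x' * y' \<in> K_grp \<and> x' * z * y' * z \<in> K_grp" if "x' \<in> K_grp" "y' \<in> K_grp" for x' y'
      using K_grp_subgrp(2)[OF that] K_grp_subgrp(2)[OF that(1), of "z * y' * z"] that zconj by (simp add: mult.assoc)
    show ?thesis
    proof (cases "x \<in> K_grp"; cases "y \<in> K_grp")
      assume "x \<in> K_grp" "y \<in> K_grp" then show ?thesis using 1 by (auto simp: N_def)
    next
      assume "x \<in> K_grp" "y \<notin> K_grp" then show ?thesis
        using 1[of x "y * z"] that by (auto simp: N_def mult.assoc)
    next
      assume "x \<notin> K_grp" "y \<in> K_grp" then show ?thesis
        using 1[of "x * z" y] that by (auto simp: N_def mult.assoc zz')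
    next
      assume "x \<notin> K_grp" "y \<notin> K_grp" then show ?thesis
        using 1[of "x * z" "y * z"] that by (auto simp: N_def mult.assoc zz zz')
    qed
  qed
  have KN: "x \<in> K_grp \<Longrightarrow> x \<in> N" for x by (simp add: N_def)
  have zN: "z \<in> N" using K_grp_subgrp(1) zz by (simp add: N_def)
  have Ninv: "inverse x \<in> N" if "x \<in> N" for x
  proof (cases "x \<in> K_grp")
    case True then show ?thesis using K_grp_subgrp(3) KN by blast
  next
    case False
    then have "x * z \<in> K_grp" using that by (simp add: N_def)
    then have "z * inverse (x * z) \<in> N" using K_grp_subgrp(3) KN Nmult zN by blast
    then show ?thesis by (simp add: zi zz')
  qed
  have Nconj: "g * x * inverse g \<in> N" if "x \<in> N" for x g
  proof (cases "x \<in> K_grp")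
    case True then show ?thesis using K_grp_normal(2) KN by blast
  next
    case False
    then have "x * z \<in> K_grp" using that by (simp add: N_def)
    then have "g * (x * z) * inverse g \<in> N" using K_grp_normal(2) KN by blast
    from Nmult[OF this KN[OF zcen[of g]]] have "g * x * inverse g * z \<in> N" by (simp add: mult.assoc zz')
    then show ?thesis using Nz by blast
  qed
  have Ns: "subgrp N" unfolding subgrp_def using Nmult Ninv KN K_grp_subgrp(1) by blast
  have comm: "g * h * inverse g * inverse h \<in> N" for g h
  proof -
    have m: "g * g' * h * inverse (g * g') * inverse h \<in> N"
      if "g * h * inverse g * inverse h \<in> N" "g' * h * inverse g' * inverse h \<in> N" for g g' h
      using Nmult[OF Nconj[OF that(2), of g] that(1)] by (simp add: mult.assoc)
    have sw: "h * g * inverse h * inverse g \<in> N" if "g * h * inverse g * inverse h \<in> N" for g h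
      using Ninv[OF that] by (simp add: mult.assoc)
    have aa: "ga * ga * inverse ga * inverse ga \<in> N" using KN K_grp_subgrp(1) by simp
    have bb: "gb * gb * inverse gb * inverse gb \<in> N" using KN K_grp_subgrp(1) by simp
    have dd: "gd * gd * inverse gd * inverse gd \<in> N" using KN K_grp_subgrp(1) by simp
    have ab: "ga * gb * inverse ga * inverse gb \<in> N" using KN K_grp_gen by simp
    have ad: "ga * gd * inverse ga * inverse gd \<in> N" using zN by (simp add: z_def)
    have bd: "gb * gd * inverse gb * inverse gd \<in> N" using KN K_grp_subgrp(1) by simp
    have gen: "g * h * inverse g * inverse h \<in> N"
      if "ga * h * inverse ga * inverse h \<in> N" "gb * h * inverse gb * inverse h \<in> N"
         "gd * h * inverse gd * inverse h \<in> N" for g h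
    proof (induction g rule: grig_induct)
      case one show ?case using KN K_grp_subgrp(1) by simp
    next
      case (a g) then show ?case by (rule m[OF that(1)])
    next
      case (b g) then show ?case by (rule m[OF that(2)])
    next
      case (c g)
      from m[OF m[OF that(2,3)] this] show ?case by simp
    next
      case (d g) then show ?case by (rule m[OF that(3)])
    qed
    show ?thesis
      by (rule gen; rule sw; rule gen; (rule aa bb dd ab ad bd sw[OF ab] sw[OF ad] sw[OF bd]))
  qed
  have sq: "g * g \<in> N" for g
  proof (induction g rule: grig_induct)
    case one show ?case using KN K_grp_subgrp(1) by simp
  next
    case (a g) from Nmult[OF Nconj[OF comm[of g ga], of ga] this] show ?case by (simp add: mult.assoc)
  next
    case (b g) from Nmult[OF Nconj[OF comm[of g gb], of gb] this] show ?case by (simp add: mult.assoc)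
  next
    case (c g) from Nmult[OF Nconj[OF comm[of g gc], of gc] this] show ?case by (simp add: mult.assoc)
  next
    case (d g) from Nmult[OF Nconj[OF comm[of g gd], of gd] this] show ?case by (simp add: mult.assoc)
  qed
  have nN: "nsubgrp N" unfolding nsubgrp_def using Ns Nconj by blast
  have "{g. abtype g = abtype 1} \<subseteq> N" using squares_abtype_kernel[OF Ns sq] by blast
  then have "chain N" by (rule chain_superset[OF chain_abtype_kernel nN])
  then show ?thesis
  proof (rule chain_step)
    show "nsubgrp K_grp" unfolding K_grp_def by (rule nsubgrp_normal_closure)
    show "K_grp \<subseteq> N" using KN by blast
    fix x y assume "x \<in> N" "y \<in> N" "x \<notin> K_grp" "y \<notin> K_grp"
    then have "x * z \<in> K_grp" "y * z \<in> K_grp" by (auto simp: N_def)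
    from K_grp_subgrp(2)[OF this(1) K_grp_subgrp(3)[OF this(2)]] show "x * inverse y \<in> K_grp"
      by (simp add: mult.assoc)
  qed
qed

text \<open>A copy of \<open>x\<close> acting only below the vertex 00. Level 2 is used because the
  element at hand later fixes level 1 and moves vertices of level 2, so that its commutators with
  such copies are accessible.\<close>

definition at00 :: "grig \<Rightarrow> grig \<Rightarrow> bool" where
  "at00 u x \<longleftrightarrow> \<not> flips u \<and> rgt u = 1 \<and> \<not> flips (lft u) \<and> lft (lft u) = x \<and> rgt (lft u) = 1"

text \<open>By \<open>lft_surj\<close>, applied twice, every conjugation at the vertex 00 is induced
  by an element of G. Hence it suffices to place normal generators.\<close>

lemma nsubgrp_at00: assumes "nsubgrp Q" shows "nsubgrp {x. \<exists>u\<in>Q. at00 u x}"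
proof -
  note Q = nsubgrpD[OF assms] and sQ = subgrpD[OF nsubgrpD(1)[OF assms]]
  show ?thesis unfolding nsubgrp_def subgrp_def
  proof (intro conjI ballI allI)
    show "1 \<in> {x. \<exists>u\<in>Q. at00 u x}" using sQ(1) by (auto simp: at00_def intro!: bexI[of _ 1])
    fix x assume "x \<in> {x. \<exists>u\<in>Q. at00 u x}"
    then obtain u where u: "u \<in> Q" "at00 u x" by blast
    then show "inverse x \<in> {x. \<exists>u\<in>Q. at00 u x}"
      using sQ(3)[OF u(1)] by (auto simp: at00_def intro!: bexI[of _ "inverse u"])
    {
      fix y assume "y \<in> {x. \<exists>u\<in>Q. at00 u x}"
      then obtain v where v: "v \<in> Q" "at00 v y" by blast
      then show "x * y \<in> {x. \<exists>u\<in>Q. at00 u x}"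
        using sQ(2)[OF u(1) v(1)] u(2) by (auto simp: at00_def intro!: bexI[of _ "u * v"])
    }
    fix g
    obtain h where h: "\<not> flips h" "lft h = g" using lft_surj by blast
    obtain k where k: "\<not> flips k" "lft k = h" using lft_surj by blast
    show "g * x * inverse g \<in> {x. \<exists>u\<in>Q. at00 u x}"
      using Q(2)[OF u(1), of k] u(2) h k by (auto simp: at00_def intro!: bexI[of _ "k * u * inverse k"])
  qed
qed

text \<open>Conjugation by \<open>b\<close>, by \<open>a\<close>, and by both in turn carries the
  vertex 00 to 01, 10 and 11 without changing the section found there; so \<open>g\<close> is a
  product of four placed elements.\<close>

lemma both_sections_both_sections_subset:
  assumes Q: "nsubgrp Q" and lift: "\<And>x. x \<in> N \<Longrightarrow> \<exists>u\<in>Q. at00 u x"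
  shows "both_sections (both_sections N) \<subseteq> Q"
proof
  fix g assume "g \<in> both_sections (both_sections N)"
  then have g: "\<not> flips g" "\<not> flips (lft g)" "\<not> flips (rgt g)" "lft (lft g) \<in> N" "rgt (lft g) \<in> N"
    "lft (rgt g) \<in> N" "rgt (rgt g) \<in> N" by (auto simp: both_sections_def)
  obtain u where u: "u \<in> Q" "at00 u (lft (lft g))" using lift[OF g(4)] by blast
  obtain v where v: "v \<in> Q" "at00 v (rgt (lft g))" using lift[OF g(5)] by blast
  obtain w where w: "w \<in> Q" "at00 w (lft (rgt g))" using lift[OF g(6)] by blast
  obtain x where x: "x \<in> Q" "at00 x (rgt (rgt g))" using lift[OF g(7)] by blast
  define y where "y = gb * x * inverse gb"
  define y' where "y' = ga * y * inverse ga"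
  define v' where "v' = gb * v * inverse gb"
  define w' where "w' = ga * w * inverse ga"
  note n = nsubgrpD(2)[OF Q]
  have "y' \<in> Q" "v' \<in> Q" "w' \<in> Q" unfolding y'_def y_def v'_def w'_def by (intro n u(1) v(1) w(1) x(1))+
  then have "u * v' * (w' * y') \<in> Q" by (intro subgrpD(2)[OF nsubgrpD(1)[OF Q]] u(1))
  moreover have "u * v' * (w' * y') = g"
    using u(2) v(2) w(2) x(2) g(1-3)
    by (intro wreath_eqI[of "u * v' * (w' * y')" g] wreath_eqI[of "lft (u * v' * (w' * y'))" "lft g"]
        wreath_eqI[of "rgt (u * v' * (w' * y'))" "rgt g"])
      (simp_all add: at00_def y'_def y_def v'_def w'_def)
  ultimately show "g \<in> Q" by simp
qed

lemma K_grp_lift: assumes "x \<in> K_grp" shows "\<exists>u\<in>K_grp. \<not> flips u \<and> lft u = x \<and> rgt u = 1"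
proof -
  let ?N = "{x. \<exists>u\<in>K_grp. \<not> flips u \<and> lft u = x \<and> rgt u = 1}"
  have "nsubgrp ?N" unfolding nsubgrp_def subgrp_def
  proof (intro conjI ballI allI)
    show "1 \<in> ?N" using K_grp_subgrp(1) by (auto intro!: bexI[of _ 1])
    fix x assume "x \<in> ?N"
    then obtain u where u: "u \<in> K_grp" "\<not> flips u \<and> lft u = x \<and> rgt u = 1" by blast
    then show "inverse x \<in> ?N" using K_grp_subgrp(3)[OF u(1)] by (auto intro!: bexI[of _ "inverse u"])
    {
      fix y assume "y \<in> ?N"
      then obtain v where v: "v \<in> K_grp" "\<not> flips v \<and> lft v = y \<and> rgt v = 1" by blast
      then show "x * y \<in> ?N" using K_grp_subgrp(2)[OF u(1) v(1)] u(2) by (auto intro!: bexI[of _ "u * v"])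
    }
    fix g
    obtain h where h: "\<not> flips h" "lft h = g" using lft_surj by blast
    show "g * x * inverse g \<in> ?N"
      using K_grp_normal(2)[OF u(1), of h] u(2) h by (auto intro!: bexI[of _ "h * u * inverse h"])
  qed
  \<comment> \<open>The sections of \<open>abab\<close> are \<open>(ca, ac)\<close> and those of
    \<open>ada\<close> are \<open>(b, 1)\<close>. In the witness the right sections cancel, and the
    left one is \<open>ac * bcab = abab\<close>.\<close>
  moreover have "ga * gb * ga * gb \<in> ?N"
  proof (intro CollectI bexI[of _ "inverse (ga * gb * ga * gb) *
        ((ga * gd * ga) * (ga * gb * ga * gb) * inverse (ga * gd * ga))"] conjI)
    show "inverse (ga * gb * ga * gb) *
        ((ga * gd * ga) * (ga * gb * ga * gb) * inverse (ga * gd * ga)) \<in> K_grp"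
      by (intro K_grp_subgrp(2,3) K_grp_normal(2) K_grp_gen)
  qed (simp_all add: mult.assoc)
  ultimately show ?thesis using K_grp_least[of ?N] assms by blast
qed

lemma chain_K_der: "chain K_der"
proof (rule chain_superset[OF chain_both_sections[OF chain_both_sections[OF chain_K_grp]]])
  show n: "nsubgrp K_der" unfolding K_der_def by (rule nsubgrp_normal_closure)
  obtain u where u: "u \<in> K_grp" "\<not> flips u" "lft u = ga * gb * ga * gb" "rgt u = 1"
    using K_grp_lift[OF K_grp_gen] by blast
  define k where "k = ga * gb * ga * gb"
  \<comment> \<open>With \<open>u = (k, 1)\<close> and \<open>k = (ca, ac)\<close>, the commutator
    has left section \<open>(abad)^2\<close>, which is \<open>abab\<close> placed at its right
    vertex. So \<open>abab\<close> sits at 01, and conjugation by \<open>b\<close> brings it to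
    00.\<close>
  have "gb * (u * k * inverse u * inverse k) * inverse gb \<in> K_der"
    by (intro K_der_normal(2) K_der_comm u) (simp add: k_def K_grp_gen)
  moreover have "at00 (gb * (u * k * inverse u * inverse k) * inverse gb) (ga * gb * ga * gb)"
    using u by (simp add: at00_def k_def mult.assoc)
  ultimately have "ga * gb * ga * gb \<in> {x. \<exists>u\<in>K_der. at00 u x}" by blast
  then have "K_grp \<subseteq> {x. \<exists>u\<in>K_der. at00 u x}" by (rule K_grp_least[OF nsubgrp_at00[OF n]])
  then show "both_sections (both_sections K_grp) \<subseteq> K_der" by (intro both_sections_both_sections_subset[OF n]) blast
qed

lemma K_grp_at00: assumes "x \<in> K_grp" shows "\<exists>u. at00 u x"
proof -
  obtain v where "v \<in> K_grp" "\<not> flips v" "lft v = x" "rgt v = 1" using K_grp_lift[OF assms] by blast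
  moreover obtain u where "\<not> flips u" "lft u = v" "rgt u = 1" using K_grp_lift[OF calculation(1)] by blast
  ultimately show ?thesis by (auto simp: at00_def)
qed

text \<open>The group \<open>R\<close> of all \<open>g\<close> with \<open>(g, 1) \<in> H\<close> is normal in \<open>G\<close> and contains an element of the type of \<open>b\<close>, which
  moves a vertex of level 2; its commutators with rigid elements show that \<open>R\<close> is large.\<close>

lemma dense_left_sections_UNIV:
  assumes H: "dense H" and L: "left_sections H = UNIV" shows "H = UNIV"
proof -
  have sH: "subgrp H" using H by (simp add: dense_def)
  note H1 = subgrpD[OF sH]
  have Lx: "\<exists>h\<in>H. \<not> flips h \<and> lft h = x" for x
  proof -
    have "x \<in> left_sections H" using L by simp
    then show ?thesis by (auto simp: left_sections_def)
  qed
  obtain s where s: "s \<in> H" "flips s" using dense_flips[OF H] .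
  have Rx: "\<exists>h\<in>H. \<not> flips h \<and> rgt h = x" for x
  proof -
    obtain h where h: "h \<in> H" "\<not> flips h" "lft h = inverse (rgt s) * x * rgt s" using Lx by blast
    then show ?thesis using s H1
      by (intro bexI[of _ "s * h * inverse s"]) (simp_all add: mult.assoc)
  qed
  define R where "R = {g. \<exists>h\<in>H. \<not> flips h \<and> rgt h = 1 \<and> lft h = g}"
  have nR: "nsubgrp R" unfolding nsubgrp_def subgrp_def
  proof (intro conjI ballI allI)
    show "1 \<in> R" using H1(1) by (auto simp: R_def intro!: bexI[of _ 1])
    fix x assume "x \<in> R"
    then obtain u where u: "u \<in> H" "\<not> flips u \<and> rgt u = 1 \<and> lft u = x" unfolding R_def by blast
    then show "inverse x \<in> R" using H1(3)[OF u(1)] by (auto simp: R_def intro!: bexI[of _ "inverse u"])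
    {
      fix y assume "y \<in> R"
      then obtain v where v: "v \<in> H" "\<not> flips v \<and> rgt v = 1 \<and> lft v = y" unfolding R_def by blast
      then show "x * y \<in> R" using H1(2)[OF u(1) v(1)] u(2) by (auto simp: R_def intro!: bexI[of _ "u * v"])
    }
    fix g
    obtain h where h: "h \<in> H" "\<not> flips h" "lft h = g" using Lx by blast
    have "h * u * inverse h \<in> H" by (intro H1(2,3) h(1) u(1))
    then show "g * x * inverse g \<in> R"
      using u(2) h by (auto simp: R_def intro!: bexI[of _ "h * u * inverse h"])
  qed
  note Rn = nsubgrpD[OF nR]
  note sR = subgrpD[OF Rn(1)]
  \<comment> \<open>The model for \<open>r\<close> is \<open>ada = (b, 1)\<close>. Density gives an
    \<open>h\<close> in \<open>H\<close> whose sections have the types of \<open>b\<close> and of 1;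
    its right section remains to be made trivial.\<close>
  obtain r where r: "r \<in> R" "\<not> flips r" "chi1 r"
  proof -
    obtain h n where h: "h \<in> H" "n \<in> both_sections {g. abtype g = abtype 1}" "ga * gd * ga = h * n"
      using dense_chain[OF chain_both_sections[OF chain_abtype_kernel] H] by blast
    have n: "\<not> flips n" "abtype (lft n) = abtype 1" "abtype (rgt n) = abtype 1" using h(2) by (auto simp: both_sections_def)
    have h': "\<not> flips h" using arg_cong[OF h(3), of flips] n by simp
    have "lft h * lft n = gb" "rgt h * rgt n = 1"
      using arg_cong[OF h(3), of lft] arg_cong[OF h(3), of rgt] h' by simp_all
    then have "flips (lft h * lft n) = flips gb" "chi1 (lft h * lft n) = chi1 gb"
      "abtype (rgt h * rgt n) = abtype 1" by simp_all
    then have t: "\<not> flips (lft h)" "chi1 (lft h)" "abtype (rgt h) = abtype 1"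
      using n by (simp_all add: abtype_eq_iff)
    \<comment> \<open>The right sections of elements of \<open>H\<close> whose left section has
      trivial type. \<open>C\<close> contains all squares, because both sections of
      \<open>u * u\<close> are squares. Thus the right section of \<open>h\<close> can be cancelled
      without changing the type of the left one.\<close>
    define C where "C = {g. \<exists>x\<in>H. \<not> flips x \<and> rgt x = g \<and> abtype (lft x) = abtype 1}"
    have "subgrp C" unfolding subgrp_def
    proof (intro conjI ballI)
      show "1 \<in> C" using H1(1) by (auto simp: C_def intro!: bexI[of _ 1])
      fix x assume "x \<in> C"
      then obtain u where u: "u \<in> H" "\<not> flips u \<and> rgt u = x \<and> abtype (lft u) = abtype 1" unfolding C_def by blast
      then show "inverse x \<in> C" using H1(3)[OF u(1)]
        by (auto simp: C_def abtype_eq_iff intro!: bexI[of _ "inverse u"])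
      fix y assume "y \<in> C"
      then obtain v where v: "v \<in> H" "\<not> flips v \<and> rgt v = y \<and> abtype (lft v) = abtype 1" unfolding C_def by blast
      then show "x * y \<in> C" using H1(2)[OF u(1) v(1)] u(2)
        by (auto simp: C_def abtype_eq_iff intro!: bexI[of _ "u * v"])
    qed
    moreover have "g * g \<in> C" for g
    proof -
      obtain u where u: "u \<in> H" "\<not> flips u" "rgt u = g" using Rx by blast
      then show ?thesis using H1(2)[OF u(1) u(1)] 
        by (auto simp: C_def abtype_eq_iff intro!: bexI[of _ "u * u"])
    qed
    ultimately have "rgt h \<in> C" using t(3) by (rule squares_abtype_kernel)
    then obtain x where x: "x \<in> H" "\<not> flips x" "rgt x = rgt h" "abtype (lft x) = abtype 1"
      unfolding C_def by blast
    have "h * inverse x \<in> H" by (intro H1(2,3) h(1) x(1))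
    then have "lft (h * inverse x) \<in> R" using x h' by (auto simp: R_def intro!: bexI[of _ "h * inverse x"])
    moreover have "\<not> flips (lft (h * inverse x))" "chi1 (lft (h * inverse x))"
      using x h' t by (simp_all add: abtype_eq_iff)
    ultimately show thesis using that by blast
  qed
  obtain q where q: "q \<in> R" "\<not> flips q" "flips (lft q)"
  proof (cases "flips (lft r)")
    case True then show ?thesis using that r by blast
  next
    case False
    then have "flips (lft (ga * r * inverse ga))" using r by (simp add: chi1_def)
    moreover have "ga * r * inverse ga \<in> R" by (rule Rn(2)[OF r(1)])
    ultimately show ?thesis using that[of "ga * r * inverse ga"] r by simp
  qed
  have "K_der \<subseteq> {x. \<exists>u\<in>R. at00 u x}"
  proof (rule K_der_least[OF nsubgrp_at00[OF nR]])
    fix x y assume "x \<in> K_grp" "y \<in> K_grp"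
    then obtain u v where u: "at00 u (inverse x)" and v: "at00 v y"
      using K_grp_at00[OF K_grp_subgrp(3), of x] K_grp_at00[of y] by blast
    \<comment> \<open>The conjugate of \<open>u\<close> by \<open>q\<close> lives below 01, so this
      element is \<open>x\<close> at 00 times something at 01. Taking the commutator with
      \<open>v\<close>, which lives below 00, removes the part at 01 and leaves the commutator of
      \<open>x\<close> and \<open>y\<close>.\<close>
    have qR: "q * (u * inverse q * inverse u) \<in> R" by (rule sR(2)[OF q(1) Rn(2)[OF sR(3)[OF q(1)]]])
    define p where "p = (q * (u * inverse q * inverse u)) * (v * inverse (q * (u * inverse q * inverse u)) * inverse v)"
    have "p \<in> R" unfolding p_def by (rule sR(2)[OF qR Rn(2)[OF sR(3)[OF qR]]])
    moreover have "at00 p (x * y * inverse x * inverse y)"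
      unfolding p_def at00_def using u v q(2,3) by (simp add: at00_def mult.assoc)
    ultimately show "x * y * inverse x * inverse y \<in> {x. \<exists>u\<in>R. at00 u x}" by blast
  qed
  then have RR: "both_sections (both_sections K_der) \<subseteq> R" by (intro both_sections_both_sections_subset[OF nR]) blast
  have "both_sections (both_sections (both_sections K_der)) \<subseteq> H"
  proof
    fix g assume "g \<in> both_sections (both_sections (both_sections K_der))"
    then have g: "\<not> flips g" "lft g \<in> R" "rgt g \<in> R" using RR by (auto simp: both_sections_def)
    obtain u where u: "u \<in> H" "\<not> flips u" "rgt u = 1" "lft u = lft g" using g(2) by (auto simp: R_def)
    have "inverse (rgt s) * rgt g * rgt s \<in> R" by (rule Rn(3)[OF g(3)])
    then obtain v where v: "v \<in> H" "\<not> flips v" "rgt v = 1" "lft v = inverse (rgt s) * rgt g * rgt s"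
      by (auto simp: R_def)
    have "u * (s * v * inverse s) \<in> H" by (intro H1(2,3) u(1) v(1) s(1))
    moreover have "u * (s * v * inverse s) = g"
      by (rule wreath_eqI) (use u v s g in \<open>simp_all add: mult.assoc\<close>)
    ultimately show "g \<in> H" by simp
  qed
  moreover have "g \<in> H" if sub: "both_sections (both_sections (both_sections K_der)) \<subseteq> H" for g
  proof -
    obtain h n where "h \<in> H" "n \<in> both_sections (both_sections (both_sections K_der))" "g = h * n"
      using dense_chain[OF chain_both_sections[OF chain_both_sections[OF chain_both_sections[OF chain_K_der]]] H] by blast
    then show ?thesis using H1(2)[of h n] sub by auto
  qed
  ultimately show "H = UNIV" by blast
qed

lemma dense_right_sections: assumes "dense H" shows "dense (right_sections H)" "right_sections H = UNIV \<Longrightarrow> H = UNIV"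
proof -
  obtain x where x: "x \<in> H" "flips x" using dense_flips[OF assms] .
  have *: "right_sections H = conj_set (rgt x) (left_sections H)" using right_sections_eq_conj_set_left_sections x assms by (simp add: dense_def)
  show "dense (right_sections H)" unfolding * by (intro dense_conj_set dense_left_sections assms)
  show "right_sections H = UNIV \<Longrightarrow> H = UNIV" unfolding * using conj_set_UNIV dense_left_sections_UNIV[OF assms] by blast
qed

section \<open>Lengths and sections\<close>

definition klein :: "grig set" where "klein = {1, gb, gc, gd}"

lemma gens_distinct [simp]:
  "gb \<noteq> 1" "gc \<noteq> 1" "gd \<noteq> 1" "gb \<noteq> gc" "gb \<noteq> gd" "gc \<noteq> gb" "gc \<noteq> gd" "gd \<noteq> gb" "gd \<noteq> gc"
  "1 \<noteq> gb" "1 \<noteq> gc" "1 \<noteq> gd"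
  by (metis chi_gens)+

lemma klein_mult: "x \<in> klein \<Longrightarrow> y \<in> klein \<Longrightarrow> x * y \<in> klein"
  by (auto simp: klein_def)

lemma klein_props:
  assumes "x \<in> klein"
  shows "\<not> flips x" "lft x \<in> {1, ga}" "rgt x \<in> klein" "inverse x = x" "x * x = 1"
    "chi1 (rgt x) = chi2 x" "chi2 (rgt x) = (chi1 x \<noteq> chi2 x)" "rgt x = 1 \<longleftrightarrow> x = 1"
    "x = 1 \<longleftrightarrow> \<not> chi1 x \<and> \<not> chi2 x"
  using assms by (auto simp: klein_def)

lemma klein_chi_eq: "x \<in> klein \<Longrightarrow> y \<in> klein \<Longrightarrow> x = y \<longleftrightarrow> chi1 x = chi1 y \<and> chi2 x = chi2 y"
  by (auto simp: klein_def)

text \<open>\<open>W k\<close> consists of the elements represented by words with at most \<open>k\<close> letters from \<open>{b, c, d}\<close>.\<close>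

fun W :: "nat \<Rightarrow> grig set" where
  "W 0 = {1, ga}"
| "W (Suc k) = {x * u * e | x u e. x \<in> W k \<and> u \<in> klein \<and> e \<in> {1, ga}}"

lemma W_SucI: "x \<in> W k \<Longrightarrow> u \<in> klein \<Longrightarrow> e \<in> {1, ga} \<Longrightarrow> x * u * e \<in> W (Suc k)"
  by auto

lemma W_SucE:
  assumes "y \<in> W (Suc k)"
  obtains x u e where "x \<in> W k" "u \<in> klein" "e \<in> {1, ga}" "y = x * u * e"
  using assms by auto

lemma W_Suc: "x \<in> W k \<Longrightarrow> x \<in> W (Suc k)"
  using W_SucI[of x k 1 1] by (simp add: klein_def)

lemma W_mono: "x \<in> W i \<Longrightarrow> i \<le> j \<Longrightarrow> x \<in> W j"
  by (induction j) (auto simp: le_Suc_eq simp del: W.simps(2) intro: W_Suc)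

lemma W_mult_AA: "x \<in> W k \<Longrightarrow> e \<in> {1, ga} \<Longrightarrow> x * e \<in> W k"
proof (cases k)
  case (Suc j)
  assume "x \<in> W k" "e \<in> {1, ga}"
  then obtain y u e' where *: "y \<in> W j" "u \<in> klein" "e' \<in> {1, ga}" "x = y * u * e'"
    using Suc W_SucE by blast
  have "y * u * (e' * e) \<in> W (Suc j)"
    using *(3) \<open>e \<in> {1, ga}\<close> by (intro W_SucI *(1,2)) auto
  then show ?thesis using * Suc by (simp add: mult.assoc del: W.simps)
qed auto

lemma W_mult: "x \<in> W i \<Longrightarrow> y \<in> W j \<Longrightarrow> x * y \<in> W (i + j)"
proof (induction j arbitrary: y)
  case 0 then show ?case using W_mult_AA[of x i y] by simp
next
  case (Suc j)
  then obtain z u e where *: "z \<in> W j" "u \<in> klein" "e \<in> {1, ga}" "y = z * u * e"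
    using W_SucE by blast
  then show ?case using W_SucI[OF Suc.IH[OF Suc.prems(1) *(1)] *(2,3)] by (simp add: mult.assoc del: W.simps)
qed

lemma klein_W: "u \<in> klein \<Longrightarrow> u \<in> W 1"
  using W_SucI[of 1 0 u 1] by simp

lemma W_inverse: "x \<in> W k \<Longrightarrow> inverse x \<in> W k"
proof (induction k arbitrary: x)
  case (Suc k)
  then obtain z u e where *: "z \<in> W k" "u \<in> klein" "e \<in> {1, ga}" "x = z * u * e"
    using W_SucE by blast
  have "e \<in> W 0" using *(3) by simp
  from W_mult[OF W_mult[OF this klein_W[OF *(2)]] Suc.IH[OF *(1)]] have "e * u * inverse z \<in> W (Suc k)"
    by (simp del: W.simps)
  moreover have "inverse x = e * u * inverse z" using * klein_props(4)[OF *(2)] by (auto simp: mult.assoc)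
  ultimately show ?case by (simp only:)
qed auto

lemma W_ex: "\<exists>k. x \<in> W k"
proof (induction x rule: grig_induct)
  case one show ?case by (intro exI[of _ 0]) simp
next
  case (a x) then obtain k where "x \<in> W k" by blast
  from W_mult[OF _ this, of ga 0] show ?case by auto
next
  case (b x) then obtain k where "x \<in> W k" by blast
  from W_mult[OF klein_W[of gb] this] show ?case by (auto simp: klein_def simp del: W.simps)
next
  case (c x) then obtain k where "x \<in> W k" by blast
  from W_mult[OF klein_W[of gc] this] show ?case by (auto simp: klein_def simp del: W.simps)
next
  case (d x) then obtain k where "x \<in> W k" by blast
  from W_mult[OF klein_W[of gd] this] show ?case by (auto simp: klein_def simp del: W.simps)
qed

lemma sections_mult_letter:
  assumes "u \<in> klein" "e \<in> {1, ga}"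
  shows "lft (x * u * e) = lft x * (if flips x then rgt u else lft u)"
    "rgt (x * u * e) = rgt x * (if flips x then lft u else rgt u)"
  using assms by auto

text \<open>Each of \<open>b\<close>, \<open>c\<close>, \<open>d\<close> has one section in {1,
  \<open>a\<close>} and the other in \<open>klein\<close>, so it is counted in only one of the two
  sections.\<close>

lemma W_sections: "x \<in> W k \<Longrightarrow> \<exists>i j. lft x \<in> W i \<and> rgt x \<in> W j \<and> i + j \<le> k"
proof (induction k arbitrary: x)
  case 0 then show ?case by (intro exI[of _ 0]) auto
next
  case (Suc k)
  then obtain z u e where *: "z \<in> W k" "u \<in> klein" "e \<in> {1, ga}" "x = z * u * e"
    using W_SucE by blast
  obtain i j where ij: "lft z \<in> W i" "rgt z \<in> W j" "i + j \<le> k" using Suc.IH[OF *(1)] by blast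
  note u = klein_props(2)[OF *(2)] klein_W[OF klein_props(3)[OF *(2)]]
  show ?case
  proof (cases "flips z")
    case True
    then show ?thesis using ij W_mult[OF ij(1) u(2)] W_mult_AA[OF ij(2) u(1)]
      by (intro exI[of _ "i + 1"] exI[of _ j]) (simp add: *(4) sections_mult_letter[OF *(2,3)] del: W.simps wreath_section_mult)
  next
    case False
    then show ?thesis using ij W_mult[OF ij(2) u(2)] W_mult_AA[OF ij(1) u(1)]
      by (intro exI[of _ i] exI[of _ "j + 1"]) (simp add: *(4) sections_mult_letter[OF *(2,3)] del: W.simps wreath_section_mult)
  qed
qed

lemma W1_E:
  assumes "x \<in> W 1"
  obtains e u e' where "e \<in> {1, ga}" "u \<in> klein" "e' \<in> {1, ga}" "x = e * u * e'"
  using assms by auto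

text \<open>Two letters separated by \<open>a\<close> contribute to different sections. Hence
  neither section receives all letters, unless the word merges into a single letter.\<close>

lemma W_sections_strict:
  "x \<in> W k \<Longrightarrow> x \<in> W 1 \<or> (\<exists>i j. lft x \<in> W i \<and> rgt x \<in> W j \<and> i < k \<and> j < k)"
proof (induction k arbitrary: x)
  case 0 then show ?case using W_Suc[of x 0] by simp
next
  case (Suc k)
  then obtain z u e where *: "z \<in> W k" "u \<in> klein" "e \<in> {1, ga}" "x = z * u * e"
    using W_SucE by blast
  note u = klein_props(2)[OF *(2)] klein_W[OF klein_props(3)[OF *(2)]]
  from Suc.IH[OF *(1)] show ?case
  proof
    assume "\<exists>i j. lft z \<in> W i \<and> rgt z \<in> W j \<and> i < k \<and> j < k"
    then obtain i j where ij: "lft z \<in> W i" "rgt z \<in> W j" "i < k" "j < k" by blast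
    have "lft z * rgt u \<in> W (i + 1)" "rgt z * rgt u \<in> W (j + 1)" "lft z * lft u \<in> W i" "rgt z * lft u \<in> W j"
      using W_mult[OF ij(1) u(2)] W_mult[OF ij(2) u(2)] W_mult_AA[OF ij(1) u(1)] W_mult_AA[OF ij(2) u(1)] .
    moreover have "i + 1 < Suc k" "j + 1 < Suc k" "i < Suc k" "j < Suc k" using ij by auto
    ultimately show ?case unfolding *(4) sections_mult_letter[OF *(2,3)] by (cases "flips z") (simp_all only: if_True if_False; blast)+
  next
    assume "z \<in> W 1"
    then obtain e0 v e1 where z: "e0 \<in> {1, ga}" "v \<in> klein" "e1 \<in> {1, ga}" "z = e0 * v * e1" by (rule W1_E)
    note v = klein_props(2)[OF z(2)] klein_W[OF klein_props(3)[OF z(2)]]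
    show ?case
    proof (cases "e1 = 1 \<or> k = 0")
      case True
      then show ?thesis
      proof
        assume "e1 = 1"
        then have "x = e0 * (v * u) * e" by (simp add: * z mult.assoc)
        then show ?thesis using W_SucI[of e0 0 "v * u" e] z *(3) klein_mult[OF z(2) *(2)] by auto
      qed (use Suc.prems in simp)
    next
      case False
      then have e1: "e1 = ga" and k: "0 < k" using z(3) by auto
      have "lft v * rgt u \<in> W (0 + 1)" "rgt v * lft u \<in> W 1"
        using W_mult[OF _ u(2), of "lft v" 0] v(1) W_mult_AA[OF v(2) u(1)] by auto
      then have "lft x \<in> W 1 \<and> rgt x \<in> W 1"
        using z(1) klein_props(1)[OF z(2)] unfolding *(4) sections_mult_letter[OF *(2,3)] z(4) e1
        by (auto simp del: W.simps)
      then show ?thesis using k by (intro disjI2 exI[of _ 1]) simp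
    qed
  qed
qed

text \<open>The parity of the conjugator decides which section of \<open>u\<close> appears on which
  side. Multiplying it by an element of \<open>H\<close> that flips makes both parities
  available.\<close>

lemma conj_sections:
  assumes "dense H" "u \<in> klein" "inverse h * u * h \<in> H"
  shows "\<exists>h'. inverse h' * rgt u * h' \<in> left_sections H" "\<exists>h'. inverse h' * lft u * h' \<in> left_sections H"
    "\<exists>h'. inverse h' * rgt u * h' \<in> right_sections H"
proof -
  have sH: "subgrp H" using assms(1) by (simp add: dense_def)
  obtain x where x: "x \<in> H" "flips x" using dense_flips[OF assms(1)] .
  have hx: "inverse (h * x) * u * (h * x) \<in> H"
  proof -
    have "inverse x * (inverse h * u * h) * x \<in> H" by (intro subgrpD(2,3)[OF sH] x(1) assms(3))
    then show ?thesis by (simp add: mult.assoc)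
  qed
  obtain h1 where h1: "flips h1" "inverse h1 * u * h1 \<in> H"
    using that[of h] that[of "h * x"] assms(3) hx x(2) by (cases "flips h") simp_all
  obtain h0 where h0: "\<not> flips h0" "inverse h0 * u * h0 \<in> H"
    using that[of h] that[of "h * x"] assms(3) hx x(2) by (cases "flips h") simp_all
  note u = klein_props(1)[OF assms(2)]
  show "\<exists>h'. inverse h' * rgt u * h' \<in> left_sections H" unfolding left_sections_def
    by (rule exI[of _ "rgt h1"], rule CollectI, rule exI[of _ "inverse h1 * u * h1"]) (use u h1 in simp)
  show "\<exists>h'. inverse h' * lft u * h' \<in> left_sections H" unfolding left_sections_def
    by (rule exI[of _ "lft h0"], rule CollectI, rule exI[of _ "inverse h0 * u * h0"]) (use u h0 in simp)
  show "\<exists>h'. inverse h' * rgt u * h' \<in> right_sections H" unfolding right_sections_def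
    by (rule exI[of _ "rgt h0"], rule CollectI, rule exI[of _ "inverse h0 * u * h0"]) (use u h0 in simp)
qed

text \<open>How often an element must be replaced by the left section of its square until it fixes
  the first level: types \<open>ab\<close>, \<open>ac\<close>, \<open>ad\<close> take 3, 2, 1
  rounds. The bound 3 explains the weight 4 on the length in the later induction.\<close>

definition stage :: "grig \<Rightarrow> nat" where
  "stage y = (if \<not> flips y then 0 else if chi1 y then (if chi2 y then 3 else 2) else 1)"

lemma stage_le: "stage y \<le> 3" by (simp add: stage_def)

text \<open>Passing to sections shortens \<open>y\<close> while its type stays outside \<open>\<langle>a, u\<rangle>\<close>; the type of \<open>y\<close> and the
  letter \<open>u\<close> are shifted in the same way by \<open>b \<mapsto> c \<mapsto> d \<mapsto> b\<close>.\<close>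

lemma reduce_to_letter:
  assumes fin: "\<And>H v u h. dense H \<Longrightarrow> v \<in> klein \<Longrightarrow> v \<noteq> 1 \<Longrightarrow> v \<in> H \<Longrightarrow> u \<in> klein \<Longrightarrow> u \<noteq> v \<Longrightarrow>
    (u = 1 \<longleftrightarrow> fl) \<Longrightarrow> inverse h * u * h \<in> H \<Longrightarrow> H = UNIV"
  shows "dense H \<Longrightarrow> u \<in> klein \<Longrightarrow> (u = 1 \<longleftrightarrow> fl) \<Longrightarrow> inverse h * u * h \<in> H \<Longrightarrow> y \<in> H \<Longrightarrow> y \<in> W k \<Longrightarrow>
    chi1 y \<or> chi2 y \<Longrightarrow> chi1 y \<noteq> chi1 u \<or> chi2 y \<noteq> chi2 u \<Longrightarrow> H = UNIV"
proof (induction "4 * k + stage y" arbitrary: H u h y k rule: less_induct)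
  case less
  have sH: "subgrp H" using less.prems(1) by (simp add: dense_def)
  note u = klein_props[OF less.prems(2)]
  obtain hl where hl: "inverse hl * rgt u * hl \<in> left_sections H" using conj_sections(1)[OF less.prems(1,2,4)] ..
  obtain hr where hr: "inverse hr * rgt u * hr \<in> right_sections H" using conj_sections(3)[OF less.prems(1,2,4)] ..
  have fl: "rgt u = 1 \<longleftrightarrow> fl" using u(8) less.prems(3) by simp
  have left: "H = UNIV" if "z \<in> left_sections H" "z \<in> W k'" "4 * k' + stage z < 4 * k + stage y"
    "chi1 z \<or> chi2 z" "chi1 z \<noteq> chi1 (rgt u) \<or> chi2 z \<noteq> chi2 (rgt u)" for z k'
    by (rule dense_left_sections_UNIV[OF less.prems(1) less.hyps[OF that(3) dense_left_sections[OF less.prems(1)] u(3) fl hl that(1,2,4,5)]])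
  have right: "H = UNIV" if "z \<in> right_sections H" "z \<in> W k'" "4 * k' + stage z < 4 * k + stage y"
    "chi1 z \<or> chi2 z" "chi1 z \<noteq> chi1 (rgt u) \<or> chi2 z \<noteq> chi2 (rgt u)" for z k'
    by (rule dense_right_sections(2)[OF less.prems(1) less.hyps[OF that(3) dense_right_sections(1)[OF less.prems(1)] u(3) fl hr that(1,2,4,5)]])
  show ?case
  proof (cases "flips y")
    case True
    obtain i j where ij: "lft y \<in> W i" "rgt y \<in> W j" "i + j \<le> k" using W_sections[OF less.prems(6)] by blast
    \<comment> \<open>An element that flips is replaced by the left section of its square. The
      length need not drop, but \<open>stage\<close> does.\<close>
    have s: "flips (lft y * rgt y) = chi1 y" "chi1 (lft y * rgt y) = chi2 y"
      "chi2 (lft y * rgt y) = (chi1 y \<noteq> chi2 y)"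
      using chi2_sections[of y] by (simp_all add: chi1_def[of y] chi2_def[of y])
    show ?thesis
    proof (rule left)
      show "lft y * rgt y \<in> left_sections H" unfolding left_sections_def
        using subgrpD(2)[OF sH less.prems(5,5)] True by (intro CollectI exI[of _ "y * y"]) simp
      show "lft y * rgt y \<in> W k" using W_mono[OF W_mult[OF ij(1,2)] ij(3)] .
      show "4 * k + stage (lft y * rgt y) < 4 * k + stage y"
        using True less.prems(7) s unfolding stage_def by auto
    qed (use s u(6,7) less.prems(7,8) in auto)
  next
    case nf: False
    from W_sections_strict[OF less.prems(6)] show ?thesis
    proof
      assume "y \<in> W 1"
      then obtain e v e' where y: "e \<in> {1, ga}" "v \<in> klein" "e' \<in> {1, ga}" "y = e * v * e'" by (rule W1_E)
      note v = klein_props[OF y(2)]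
      have "e' = e" using nf v(1) y by auto
      then have y': "y = e * v * e" using y by simp
      have ei: "inverse e = e" "e * e = 1" using y(1) by auto
      have cv: "chi1 y = chi1 v" "chi2 y = chi2 v" using y(1) y' by auto
      show ?thesis
      proof (rule conj_set_UNIV[of e], rule fin)
        show "dense (conj_set e H)" by (rule dense_conj_set[OF less.prems(1)])
        show "v \<in> klein" "u \<in> klein" by fact+
        show "v \<noteq> 1" "u \<noteq> v" using v(9) cv less.prems(7,8) by auto
        show "v \<in> conj_set e H" using less.prems(5) y' ei by (simp add: conj_set_def)
        show "u = 1 \<longleftrightarrow> fl" by fact
        show "inverse (h * e) * u * (h * e) \<in> conj_set e H"
        proof -
          have "e * (e * z) = z" for z using ei(2) by (simp flip: mult.assoc)
          then show ?thesis using less.prems(4) ei by (simp add: conj_set_def mult.assoc)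
        qed
      qed
    next
      assume "\<exists>i j. lft y \<in> W i \<and> rgt y \<in> W j \<and> i < k \<and> j < k"
      then obtain i j where ij: "lft y \<in> W i" "rgt y \<in> W j" "i < k" "j < k" by blast
      have m: "4 * i + stage (lft y) < 4 * k + stage y" "4 * j + stage (rgt y) < 4 * k + stage y"
        using ij stage_le[of "lft y"] stage_le[of "rgt y"] by linarith+
      have yL: "lft y \<in> left_sections H" "rgt y \<in> right_sections H" using less.prems(5) nf by (auto simp: left_sections_def right_sections_def)
      have s: "chi2 y = (chi1 (lft y) \<noteq> chi1 (rgt y))" "(chi1 y \<noteq> chi2 y) = (chi2 (lft y) \<noteq> chi2 (rgt y))"
        using chi2_sections[of y] by (simp_all add: chi2_def[of y])
      show ?thesis
      proof (cases "(chi1 (lft y) \<or> chi2 (lft y)) \<and> (chi1 (lft y) \<noteq> chi1 (rgt u) \<or> chi2 (lft y) \<noteq> chi2 (rgt u))")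
        case True then show ?thesis using left[OF yL(1) ij(1) m(1)] by blast
      next
        case False
        \<comment> \<open>The values of \<open>chi1\<close> and \<open>chi2\<close> on the two
          sections add up to the shifted values of \<open>y\<close>, which are neither trivial nor
          those of \<open>rgt u\<close>. So both sections cannot fail.\<close>
        then have "(chi1 (rgt y) \<or> chi2 (rgt y)) \<and> (chi1 (rgt y) \<noteq> chi1 (rgt u) \<or> chi2 (rgt y) \<noteq> chi2 (rgt u))"
          using s u(6,7) less.prems(7,8) by auto
        then show ?thesis using right[OF yL(2) ij(2) m(2)] by blast
      qed
    qed
  qed
qed

section \<open>Pervova's theorem\<close>

lemma gens_UNIV: assumes "subgrp H" "ga \<in> H" "klein \<subseteq> H" shows "H = UNIV"
proof -
  have "g \<in> H" for g
  proof (induction g rule: grig_induct)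
    case one show ?case by (rule subgrpD(1)[OF assms(1)])
  next
    case (a g) show ?case by (rule subgrpD(2)[OF assms(1,2) a])
  next
    case (b g) show ?case by (rule subgrpD(2)[OF assms(1) _ b]) (use assms(3) in \<open>auto simp: klein_def\<close>)
  next
    case (c g) show ?case by (rule subgrpD(2)[OF assms(1) _ c]) (use assms(3) in \<open>auto simp: klein_def\<close>)
  next
    case (d g) show ?case by (rule subgrpD(2)[OF assms(1) _ d]) (use assms(3) in \<open>auto simp: klein_def\<close>)
  qed
  then show ?thesis by blast
qed

section \<open>Conjugates of a in the presence of all letters\<close>

fun word :: "grig list \<Rightarrow> grig" where
  "word [] = 1"
| "word (u # us) = u * ga * word us"

lemma word_append: "word (us @ vs) = word us * word vs"
  by (induction us) (simp_all add: mult.assoc)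

lemma word_rev: "set us \<subseteq> klein \<Longrightarrow> inverse (word us) = ga * word (rev us) * ga"
proof (induction us)
  case (Cons u us)
  then have "inverse u = u" using klein_props(4) by simp
  then show ?case using Cons by (simp add: word_append mult.assoc)
qed simp

text \<open>A normal form suited to conjugating \<open>a\<close>: the leading factor
  \<open>e\<close> centralises \<open>a\<close>, and the trailing \<open>v\<close> can be absorbed
  by a group that contains \<open>klein\<close>.\<close>

lemma W_word:
  assumes "x \<in> W k"
  shows "\<exists>e us v. e \<in> {1, ga} \<and> set us \<subseteq> {gb, gc, gd} \<and> v \<in> klein \<and> length us \<le> k \<and> x = e * word us * v"
  using assms
proof (induction k arbitrary: x)
  case 0
  then show ?case
    by (intro exI[of _ x] exI[of _ "[]"] exI[of _ 1]) (auto simp: klein_def)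
next
  case (Suc k)
  then obtain z w e' where z: "z \<in> W k" "w \<in> klein" "e' \<in> {1, ga}" "x = z * w * e'"
    using W_SucE by blast
  obtain e us v where *: "e \<in> {1, ga}" "set us \<subseteq> {gb, gc, gd}" "v \<in> klein" "length us \<le> k" "z = e * word us * v"
    using Suc.IH[OF z(1)] by blast
  define t where "t = v * w"
  have t: "t \<in> klein" unfolding t_def by (rule klein_mult[OF *(3) z(2)])
  have x: "x = e * word us * t * e'" using * z by (simp add: t_def mult.assoc)
  have one: "1 \<in> klein" by (simp add: klein_def)
  show ?case
  proof (cases "e' = 1")
    case True
    then show ?thesis using x * t by (intro exI[of _ e] exI[of _ us] exI[of _ t]) simp
  next
    case False
    then have e': "e' = ga" using z(3) by simp
    show ?thesis
    proof (cases "t = 1")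
      case False
      then show ?thesis using x * t e' one
        by (intro exI[of _ e] exI[of _ "us @ [t]"] exI[of _ 1]) (auto simp: word_append mult.assoc klein_def)
    next
      case True
      show ?thesis
      proof (cases us rule: rev_cases)
        case Nil
        then show ?thesis using x * e' True one
          by (intro exI[of _ "e * ga"] exI[of _ "[]"] exI[of _ 1]) auto
      next
        case (snoc ys y)
        then show ?thesis using x * e' True
          by (intro exI[of _ e] exI[of _ ys] exI[of _ y]) (auto simp: word_append mult.assoc klein_def)
      qed
    qed
  qed
qed

text \<open>The conjugate \<open>x\<close> of \<open>a\<close> by a word has sections
  \<open>t\<close> and \<open>inverse t\<close>, with \<open>t\<close> given here. As
  \<open>lft gb = ga\<close>, conjugating \<open>gb\<close> by \<open>x\<close> produces the right
  section \<open>inverse t * ga * t\<close>: a conjugate of \<open>a\<close> again, with new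
  conjugator \<open>t\<close>.\<close>

definition word_section :: "grig list \<Rightarrow> grig" where "word_section us = lft (inverse (word us) * ga * word us)"

lemma conj_a_sections:
  "flips (inverse s * ga * s)" "rgt (inverse s * ga * s) = inverse (lft (inverse s * ga * s))"
  by (auto simp: mult.assoc)

lemma word_section_snoc:
  assumes "u \<in> klein" shows "word_section (us @ [u]) = rgt u * inverse (word_section us) * lft u"
proof -
  define x where "x = inverse (word us) * ga * word us"
  have x: "flips x" "rgt x = inverse (word_section us)" unfolding x_def word_section_def by (rule conj_a_sections)+
  have "inverse (word (us @ [u])) * ga * word (us @ [u]) = ga * u * x * u * ga"
    using klein_props(4)[OF assms] by (simp add: word_append x_def mult.assoc)
  then have "word_section (us @ [u]) = lft (ga * u * x * u * ga)" by (simp only: word_section_def)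
  then show ?thesis using x klein_props(1)[OF assms] by (simp add: mult.assoc)
qed

lemma word_section_Nil: "word_section [] = 1" by (simp add: word_section_def)

lemma word_section_W: "set us \<subseteq> klein \<Longrightarrow> word_section us \<in> W (length us)"
proof (induction us rule: rev_induct)
  case (snoc u us)
  then have u: "u \<in> klein" by simp
  have "rgt u * inverse (word_section us) * lft u \<in> W (1 + length us)"
    using snoc klein_props(2)[OF u] by (intro W_mult_AA W_mult klein_W klein_props(3)[OF u] W_inverse) auto
  then show ?case by (simp add: word_section_snoc[OF u] del: W.simps)
qed (simp add: word_section_Nil)

text \<open>A letter \<open>d\<close> contributes no \<open>a\<close>, since
  \<open>lft gd = 1\<close>. This leaves a factor \<open>v\<close> from \<open>klein\<close> at the
  right end, and it merges with the right section of the next letter, which saves one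
  letter.\<close>

lemma word_section_short:
  "set us \<subseteq> klein \<Longrightarrow> gd \<in> set us \<Longrightarrow> \<exists>w\<in>W (length us - 1). \<exists>v\<in>klein. word_section us = w * v"
proof (induction us rule: rev_induct)
  case (snoc u us)
  then have u: "u \<in> klein" "set us \<subseteq> klein" by auto
  have one: "1 \<in> klein" by (simp add: klein_def)
  show ?case
  proof (cases "gd \<in> set us")
    case True
    then obtain w v where w: "w \<in> W (length us - 1)" "v \<in> klein" "word_section us = w * v" using snoc u by blast
    have "(rgt u * v) * inverse w * lft u \<in> W (1 + (length us - 1))"
      using klein_props(2)[OF u(1)] by (intro W_mult_AA W_mult klein_W klein_mult klein_props(3)[OF u(1)] W_inverse w)
    moreover have "1 + (length us - 1) = length us" using True by (cases us) auto
    ultimately have "(rgt u * v) * inverse w * lft u \<in> W (length us)" by (simp only:)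
    moreover have "word_section (us @ [u]) = ((rgt u * v) * inverse w * lft u) * 1"
      using klein_props(4)[OF w(2)] by (simp add: word_section_snoc[OF u(1)] w(3) mult.assoc)
    ultimately show ?thesis using one by (metis length_append_singleton diff_Suc_1)
  next
    case False
    then have ud: "u = gd" using snoc by auto
    show ?thesis
    proof (cases us rule: rev_cases)
      case Nil
      have "gb \<in> klein" by (simp add: klein_def)
      then show ?thesis using Nil ud
        by (rule_tac bexI[of _ 1], rule_tac bexI[of _ gb])
          (simp_all add: word_section_snoc[of gd "[]", simplified] word_section_Nil klein_def)
    next
      case (snoc ys y)
      then have y: "y \<in> klein" "set ys \<subseteq> klein" using u by auto
      note y' = klein_props[OF y(1)]
      have "gb * (lft y * word_section ys) \<in> W (1 + (0 + length ys))"
        using y'(2) by (intro W_mult klein_W word_section_W y) (auto simp: klein_def)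
      moreover have "word_section (us @ [u]) = gb * (lft y * word_section ys) * rgt y"
      proof -
        have "word_section (us @ [u]) = rgt gd * inverse (word_section (ys @ [y])) * lft gd"
          unfolding ud snoc by (rule word_section_snoc) (simp add: klein_def)
        then show ?thesis using y'(2) klein_props(4)[OF y'(3)] by (auto simp: word_section_snoc[OF y(1)] mult.assoc)
      qed
      moreover have "length (us @ [u]) - 1 = 1 + (0 + length ys)" using snoc by simp
      ultimately show ?thesis using y'(3) by (metis (no_types))
    qed
  qed
qed simp

lemma word_section_exact:
  "set us \<subseteq> {gb, gc} \<Longrightarrow> \<exists>vs. word_section us = word vs \<and> length vs = length us \<and> set vs = rgt ` set us"
proof (induction us rule: rev_induct)
  case (snoc u us)
  then obtain vs where vs: "word_section us = word vs" "length vs = length us" "set vs = rgt ` set us" by auto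
  have u: "u \<in> klein" "lft u = ga" using snoc.prems by (auto simp: klein_def)
  have "set vs \<subseteq> klein" using vs(3) snoc.prems by (auto simp: klein_def)
  then have "word_section (us @ [u]) = word (rgt u # rev vs)"
    by (simp add: word_section_snoc[OF u(1)] u(2) vs(1) word_rev mult.assoc)
  then show ?case using vs by (intro exI[of _ "rgt u # rev vs"]) auto
qed (auto simp: word_section_Nil intro!: exI[of _ "[]"])

text \<open>Every letter is shifted by \<open>b \<mapsto> c \<mapsto> d\<close> when passing to a section, and a letter \<open>d\<close> makes the
  word shorter.\<close>

lemma dense_word:
  "dense H \<Longrightarrow> klein \<subseteq> H \<Longrightarrow> set us \<subseteq> {gb, gc, gd} \<Longrightarrow> inverse (word us) * ga * word us \<in> H \<Longrightarrow> H = UNIV"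
proof (induction "3 * length us + (if gd \<in> set us then 0 else if gc \<in> set us then 1 else 2)"
    arbitrary: H us rule: less_induct)
  case less
  have sH: "subgrp H" using less.prems(1) by (simp add: dense_def)
  have us: "set us \<subseteq> klein" using less.prems(3) by (auto simp: klein_def)
  show ?case
  proof (cases "us = []")
    case True
    then show ?thesis using gens_UNIV[OF sH _ less.prems(2)] less.prems(4) by simp
  next
    case ne: False
    define x where "x = inverse (word us) * ga * word us"
    have x: "flips x" "rgt x = inverse (word_section us)" unfolding x_def word_section_def by (rule conj_a_sections)+
    have "x * gb * inverse x \<in> H"
      using less.prems(2,4) by (intro subgrpD(2,3)[OF sH]) (auto simp: x_def klein_def)
    then have z: "inverse (word_section us) * ga * word_section us \<in> right_sections H"
      unfolding right_sections_def using x by (intro CollectI exI[of _ "x * gb * inverse x"]) simp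
    have bR: "klein \<subseteq> right_sections H"
    proof -
      have "rgt u \<in> right_sections H" if "u \<in> klein" for u
        unfolding right_sections_def using that less.prems(2) klein_props(1)[OF that] by blast
      from this[of 1] this[of gb] this[of gc] this[of gd] show ?thesis by (simp add: klein_def)
    qed
    have dR: "dense (right_sections H)" by (rule dense_right_sections(1)[OF less.prems(1)])
    have sR: "subgrp (right_sections H)" using dR by (simp add: dense_def)
    show ?thesis
    proof (rule dense_right_sections(2)[OF less.prems(1)])
      show "right_sections H = UNIV"
      proof (cases "gd \<in> set us")
        case True
        obtain w v where w: "w \<in> W (length us - 1)" "v \<in> klein" "word_section us = w * v" using word_section_short[OF us True] by blast
        obtain e vs v' where *: "e \<in> {1, ga}" "set vs \<subseteq> {gb, gc, gd}" "v' \<in> klein" "length vs \<le> length us - 1"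
          "w = e * word vs * v'" using W_word[OF w(1)] by blast
        have e: "inverse e * ga * e = ga" using *(1) by auto
        have vv: "v' * v \<in> right_sections H" using klein_mult[OF *(3) w(2)] bR by blast
        have "(v' * v) * (inverse (word_section us) * ga * word_section us) * inverse (v' * v) \<in> right_sections H"
          by (rule subgrpD(2)[OF sR subgrpD(2)[OF sR vv z] subgrpD(3)[OF sR vv]])
        also have "(v' * v) * (inverse (word_section us) * ga * word_section us) * inverse (v' * v)
           = inverse (word vs) * (inverse e * ga * e) * word vs"
          by (simp add: w(3) *(5) mult.assoc)
        finally have "inverse (word vs) * ga * word vs \<in> right_sections H" unfolding e .
        moreover have "length vs < length us" using *(4) ne by (cases us) auto
        ultimately show ?thesis using * dR bR by (intro less.hyps[of vs]) auto
      next
        case False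
        then have "set us \<subseteq> {gb, gc}" using less.prems(3) by auto
        then obtain vs where vs: "word_section us = word vs" "length vs = length us" "set vs = rgt ` set us"
          using word_section_exact by blast
        have "gc \<in> set us \<or> gb \<in> set us" using \<open>set us \<subseteq> {gb, gc}\<close> ne by (cases us) auto
        then have "gd \<in> set vs \<or> (gc \<notin> set us \<and> gc \<in> set vs)" unfolding vs(3) by force
        moreover have "set vs \<subseteq> {gb, gc, gd}" using \<open>set us \<subseteq> {gb, gc}\<close> unfolding vs(3) by auto
        ultimately show ?thesis using z False dR bR unfolding vs(1)
          by (intro less.hyps[of vs]) (auto simp: vs(2))
      qed
    qed
  qed
qed

lemma dense_klein:
  assumes "dense H" "klein \<subseteq> H" "inverse s * ga * s \<in> H" shows "H = UNIV"
proof -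
  have sH: "subgrp H" using assms(1) by (simp add: dense_def)
  obtain k where "s \<in> W k" using W_ex by blast
  then obtain e us v where *: "e \<in> {1, ga}" "set us \<subseteq> {gb, gc, gd}" "v \<in> klein" "s = e * word us * v"
    using W_word by blast
  have e: "inverse e * ga * e = ga" using *(1) by auto
  have v: "v \<in> H" using *(3) assms(2) by blast
  have "v * (inverse s * ga * s) * inverse v \<in> H"
    by (rule subgrpD(2)[OF sH subgrpD(2)[OF sH v assms(3)] subgrpD(3)[OF sH v]])
  also have "v * (inverse s * ga * s) * inverse v = inverse (word us) * (inverse e * ga * e) * word us"
    by (simp add: *(4) mult.assoc)
  finally show ?thesis using dense_word[OF assms(1,2) *(2)] unfolding e by blast
qed

section \<open>Conjugates of a and of two letters\<close>

lemma left_sections_I: "h \<in> H \<Longrightarrow> \<not> flips h \<Longrightarrow> lft h \<in> left_sections H"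
  unfolding left_sections_def by blast

text \<open>Left multiplication of \<open>l\<close> by an element of \<open>klein\<close> does not
  affect a conjugate \<open>inverse l * v * l\<close> with \<open>v\<close> in \<open>klein\<close>.
  If \<open>l\<close> starts with a letter, \<open>u\<close> cancels it; if it starts with
  \<open>a\<close>, that letter contributes only 1 or \<open>a\<close> to the right section.\<close>

lemma strip_letter:
  assumes "l \<in> W k" "0 < k" shows "\<exists>u\<in>klein. rgt (u * l) \<in> W (k - 1)"
proof -
  obtain j where j: "k = Suc j" using assms(2) by (cases k) auto
  obtain z u e where *: "z \<in> W j" "u \<in> klein" "e \<in> {1, ga}" "inverse l = z * u * e"
    using W_SucE[OF W_inverse[OF assms(1)[unfolded j]]] by metis
  have "l = inverse (z * u * e)" using *(4) by (metis inv_inv)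
  then have l: "l = e * u * inverse z" using *(3) klein_props(4)[OF *(2)] by (auto simp: mult.assoc)
  note u = klein_props[OF *(2)]
  obtain i i' where s: "lft (inverse z) \<in> W i" "rgt (inverse z) \<in> W i'" "i + i' \<le> j"
    using W_sections[OF W_inverse[OF *(1)]] by blast
  show ?thesis
  proof (cases "e = 1")
    case True
    then have "u * l = inverse z" using u(5) by (simp add: l mult.assoc flip: mult.assoc[of u u])
    then show ?thesis using *(2) W_mono[OF s(2), of j] s(3) j by (intro bexI[of _ u]) simp_all
  next
    case False
    then have "rgt (1 * l) = lft u * lft (inverse z)" using *(3) u(1) l by auto
    moreover have "lft u * lft (inverse z) \<in> W (0 + i)" using u(2) by (intro W_mult s(1)) auto
    ultimately have "rgt (1 * l) \<in> W j" using W_mono[of _ i j] s(3) by simp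
    then show ?thesis using j by (intro bexI[of _ 1]) (simp_all add: klein_def)
  qed
qed

definition tripod :: "grig set \<Rightarrow> grig \<Rightarrow> grig \<Rightarrow> grig \<Rightarrow> grig \<Rightarrow> grig \<Rightarrow> bool" where
  "tripod H u v s h l \<longleftrightarrow> dense H \<and> u \<in> klein \<and> v \<in> klein \<and> u \<noteq> 1 \<and> v \<noteq> 1 \<and> u \<noteq> v \<and>
     inverse s * ga * s \<in> H \<and> inverse h * u * h \<in> H \<and> inverse l * v * l \<in> H"

lemma tripod_sym: "tripod H u v s h l \<Longrightarrow> tripod H v u s l h"
  by (auto simp: tripod_def)

lemma tripod_conj_set: assumes "tripod H u v s h l" shows "tripod (conj_set g H) u v (s * inverse g) (h * inverse g) (l * inverse g)"
  using assms dense_conj_set[of H g] by (simp add: tripod_def conj_set_def mult.assoc)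

text \<open>\<open>a\<close> commutes with itself and \<open>klein\<close> is abelian, so the
  conjugators matter only up to these left factors.\<close>

lemma tripod_left:
  assumes "tripod H u v s h l" "e \<in> {1, ga}" "w \<in> klein" "x \<in> klein" shows "tripod H u v (e * s) (w * h) (x * l)"
proof -
  have "inverse e * ga * e = ga" "inverse w * u * w = u" "inverse x * v * x = v"
    using assms by (auto simp: tripod_def klein_def)
  then have "inverse (e * s) * ga * (e * s) = inverse s * ga * s"
    "inverse (w * h) * u * (w * h) = inverse h * u * h" "inverse (x * l) * v * (x * l) = inverse l * v * l"
    by (metis inv_mult mult.assoc)+
  then show ?thesis using assms(1) unfolding tripod_def by simp
qed

text \<open>In coordinates based at \<open>lft s\<close>, the section group at the left vertex contains the sections of
  \<open>h\<^sup>-\<^sup>1 u h\<close> and of its conjugate by \<open>s\<^sup>-\<^sup>1 a s\<close>, which link \<open>lft s\<close> to \<open>rgt s\<close>.\<close>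

lemma tripod_step:
  assumes t: "tripod H u v s h l" and u: "lft u = ga" and W: "s \<in> W ks" "h \<in> W kh"
  shows "\<exists>H' s' h' k1 k2. tripod H' (rgt u) (rgt v) s' h' (rgt l) \<and> (H' = UNIV \<longrightarrow> H = UNIV) \<and>
     s' \<in> W k1 \<and> h' \<in> W k2 \<and> k1 + k2 \<le> ks + kh \<and> (flips h \<noteq> flips l \<longrightarrow> s' = lft h)"
proof -
  define s0 where "s0 = (if flips s then ga * s else s)"
  have W0: "s0 \<in> W ks" using W_mult[of ga 0 s ks] W(1) by (simp add: s0_def)
  have "s0 = (if flips s then ga else 1) * s" by (simp add: s0_def)
  then have t0: "tripod H u v s0 h l" using tripod_left[OF t, of "if flips s then ga else 1" 1 1] by (simp add: klein_def)
  have s0: "\<not> flips s0" by (simp add: s0_def)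
  have H: "dense H" and sH: "subgrp H" using t by (auto simp: tripod_def dense_def)
  have L: "dense (left_sections H)" "subgrp (left_sections H)" using dense_left_sections[OF H] by (auto simp: dense_def)
  define e where "e q = (if q then rgt s0 else lft s0)" for q
  define x where "x = inverse s0 * ga * s0"
  have xH: "x \<in> H" using t0 by (simp add: tripod_def x_def)
  have x: "flips x" "lft x = inverse (lft s0) * rgt s0" "rgt x = inverse (rgt s0) * lft s0"
    using s0 by (simp_all add: x_def)
  have xx: "inverse x = x" by (simp add: x_def mult.assoc)
  define H1 where "H1 = conj_set (lft s0) (left_sections H)"
  have sec: "inverse (lft k * inverse (e (flips k))) * lft w * (lft k * inverse (e (flips k))) \<in> H1 \<and>
     inverse (rgt k * inverse (e (\<not> flips k))) * rgt w * (rgt k * inverse (e (\<not> flips k))) \<in> H1"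
    if w: "w \<in> klein" and k: "inverse k * w * k \<in> H" for w k
  proof -
    note w' = klein_props(1)[OF w]
    have 1: "lft (inverse k * w * k) \<in> left_sections H" by (rule left_sections_I[OF k]) (simp add: w')
    have xk: "x * (inverse k * w * k) * inverse x \<in> H"
      by (rule subgrpD(2)[OF sH subgrpD(2)[OF sH xH k] subgrpD(3)[OF sH xH]])
    have 2: "lft (x * (inverse k * w * k) * inverse x) \<in> left_sections H" by (rule left_sections_I[OF xk]) (simp add: w')
    show ?thesis
    proof (cases "flips k")
      case True
      then show ?thesis using 1 2 w' x
        by (simp add: H1_def conj_set_def e_def mult.assoc)
    next
      case False
      then show ?thesis using 1 2 w' x
        by (simp add: H1_def conj_set_def e_def mult.assoc)
    qed
  qed
  \<comment> \<open>This base point makes the conjugator of \<open>rgt v\<close> exactly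
    \<open>rgt l\<close>.\<close>
  define g where "g = e (\<not> flips l)"
  define H' where "H' = conj_set (inverse g) H1"
  define s' where "s' = lft h * inverse (e (flips h)) * g"
  define h' where "h' = rgt h * inverse (e (\<not> flips h)) * g"
  have uv: "u \<in> klein" "v \<in> klein" and mem: "inverse h * u * h \<in> H" "inverse l * v * l \<in> H"
    and ne: "u \<noteq> 1" "v \<noteq> 1" "u \<noteq> v" using t0 by (auto simp: tripod_def)
  have "dense H'" unfolding H'_def H1_def by (intro dense_conj_set L)
  moreover have "rgt u \<noteq> rgt v" using uv ne by (auto simp: klein_def)
  ultimately have T: "tripod H' (rgt u) (rgt v) s' h' (rgt l)"
    using klein_props(3,8)[OF uv(1)] klein_props(3,8)[OF uv(2)] ne sec[OF uv(1) mem(1)] sec[OF uv(2) mem(2)]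
    unfolding tripod_def u H'_def s'_def h'_def g_def
    by (simp add: conj_set_def mult.assoc)
  have up: "H' = UNIV \<longrightarrow> H = UNIV"
    unfolding H'_def H1_def using conj_set_UNIV dense_left_sections_UNIV[OF H] by blast
  obtain i j where ij: "lft h \<in> W i" "rgt h \<in> W j" "i + j \<le> kh" using W_sections[OF W(2)] by blast
  obtain i' j' where ij': "lft s0 \<in> W i'" "rgt s0 \<in> W j'" "i' + j' \<le> ks" using W_sections[OF W0] by blast
  \<comment> \<open>\<open>s'\<close> and \<open>h'\<close> are based at opposite sides and
    \<open>g\<close> at one of them, so exactly one of the two picks up this factor. Its length is
    paid for by \<open>s0\<close>.\<close>
  have ee: "inverse (e p) * e (\<not> p) \<in> W (i' + j')" for p
    using W_mult[OF W_inverse[OF ij'(1)] ij'(2)] W_mult[OF W_inverse[OF ij'(2)] ij'(1)]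
    by (cases p) (simp_all add: e_def add.commute)
  show ?thesis
  proof (cases "flips h = flips l")
    case True
    have "s' \<in> W (i + (i' + j'))" "h' = rgt h"
      using W_mult[OF ij(1) ee[of "flips h"]] by (simp_all add: s'_def h'_def g_def True mult.assoc)
    moreover have "(i + (i' + j')) + j \<le> ks + kh" using ij(3) ij'(3) by simp
    ultimately show ?thesis using T up True ij(2) by blast
  next
    case False
    then have fl: "flips l \<longleftrightarrow> \<not> flips h" by blast
    have 1: "h' \<in> W (j + (i' + j'))"
      using W_mult[OF ij(2) ee[of "\<not> flips h"]] by (simp add: h'_def g_def fl mult.assoc)
    have 2: "s' = lft h" by (simp add: s'_def g_def fl mult.assoc)
    have "i + (j + (i' + j')) \<le> ks + kh" using ij(3) ij'(3) by simp
    then show ?thesis using T up ij(1) 1 2 by blast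
  qed
qed

lemma tripod_pure:
  assumes t: "tripod H u v s h h" shows "H = UNIV"
proof (rule conj_set_UNIV[of h], rule dense_klein)
  have c: "tripod (conj_set h H) u v (s * inverse h) 1 1" using tripod_conj_set[OF t, of h] by simp
  then show "dense (conj_set h H)" "inverse (s * inverse h) * ga * (s * inverse h) \<in> conj_set h H"
    unfolding tripod_def by blast+
  then have "subgrp (conj_set h H)" by (simp add: dense_def)
  moreover have uv: "u \<in> conj_set h H" "v \<in> conj_set h H" using c by (simp_all add: tripod_def)
  ultimately have "1 \<in> conj_set h H" "u * v \<in> conj_set h H" by (simp_all add: subgrpD)
  moreover have "klein \<subseteq> {1, u, v, u * v}" using c by (auto simp: tripod_def klein_def)
  ultimately show "klein \<subseteq> conj_set h H" using uv by blast
qed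

text \<open>A step never increases the total length, and with \<open>strip_letter\<close> it gains a
  letter at \<open>l\<close> if \<open>lft u = ga\<close> and \<open>l\<close> has positive length
  bound. The obstacles are the letter \<open>d\<close>, with trivial left section, and length hidden
  in \<open>s\<close> alone; both are overcome by a neutral step followed by an exchange of
  \<open>u\<close> and \<open>v\<close>.\<close>

lemma tripod_UNIV:
  "tripod H u v s h l \<Longrightarrow> s \<in> W ks \<Longrightarrow> h \<in> W kh \<Longrightarrow> l \<in> W kl \<Longrightarrow> H = UNIV"
proof (induction "ks + kh + kl" arbitrary: H u v s h l ks kh kl rule: less_induct)
  case less
  define K where "K = ks + kh + kl"
  have IH: "H = UNIV" if "tripod H u v s h l" "s \<in> W ks" "h \<in> W kh" "l \<in> W kl" "ks + kh + kl < K"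
    for H u v s h l ks kh kl using less.hyps that unfolding K_def by blast
  have shrink: "H = UNIV" if t: "tripod H u v s h l" and W: "s \<in> W ks" "h \<in> W kh" "l \<in> W kl"
    and le: "ks + kh + kl \<le> K" and u: "lft u = ga" and kl: "0 < kl" for H u v s h l ks kh kl
  proof -
    obtain w where w: "w \<in> klein" "rgt (w * l) \<in> W (kl - 1)" using strip_letter[OF W(3) kl] by blast
    have "tripod H u v s h (w * l)" using tripod_left[OF t, of 1 1 w] w(1) by (simp add: klein_def)
    from tripod_step[OF this u W(1,2)] obtain H' s' h' k1 k2 where
      *: "tripod H' (rgt u) (rgt v) s' h' (rgt (w * l))" "H' = UNIV \<longrightarrow> H = UNIV" "s' \<in> W k1" "h' \<in> W k2"
        "k1 + k2 \<le> ks + kh" by blast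
    have "k1 + k2 + (kl - 1) < K" using *(5) le kl by linarith
    then show ?thesis using *(2) IH[OF *(1,3,4) w(2)] by blast
  qed
  \<comment> \<open>A step with \<open>h\<close> and \<open>l\<close> different in {1,
    \<open>a\<close>} makes the conjugators of \<open>a\<close> and \<open>rgt v\<close> trivial.
    The length of \<open>s\<close> has passed to \<open>h'\<close>, where it shrinks after the
    exchange of roles.\<close>
  have cross: "H = UNIV" if t: "tripod H u v s h l" and W: "s \<in> W ks" "h \<in> W 0" "l \<in> W 0"
    and le: "ks \<le> K" and u: "lft u = ga" and v: "lft (rgt v) = ga" and hl: "h \<noteq> l" for H u v s h l ks
  proof -
    have fl: "flips h \<noteq> flips l" "lft h = 1" "rgt l = 1" using W(2,3) hl by auto
    from tripod_step[OF t u W(1,2)] fl obtain H' h' k1 k2 where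
      *: "tripod H' (rgt u) (rgt v) 1 h' 1" "H' = UNIV \<longrightarrow> H = UNIV" "h' \<in> W k2" "k1 + k2 \<le> ks + 0"
      by auto
    have "H' = UNIV"
    proof (cases "k2 = 0")
      case True
      then have h': "h' \<in> {1, ga}" using *(3) by simp
      then show ?thesis
      proof
        assume "h' \<in> {ga}"
        then have h': "h' = ga" by simp
        have sH: "subgrp H'" and a: "ga \<in> H'" and m: "ga * rgt u * ga \<in> H'" using *(1) h'
          by (simp_all add: tripod_def dense_def)
        have "ga * (ga * rgt u * ga) * ga \<in> H'" by (rule subgrpD(2)[OF sH subgrpD(2)[OF sH a m] a])
        then have "rgt u \<in> H'" by (simp add: mult.assoc)
        then have "tripod H' (rgt u) (rgt v) 1 1 1" using *(1) by (simp add: tripod_def)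
        then show ?thesis by (rule tripod_pure)
      qed (use *(1) tripod_pure in simp)
    next
      case False
      show ?thesis
        by (rule shrink[OF tripod_sym[OF *(1)], of 0 0 k2]) (use * False le v in simp_all)
    qed
    then show ?thesis using *(2) by blast
  qed
  have ends: "H = UNIV" if t: "tripod H u v s h l" and W: "s \<in> W ks" "h \<in> W 0" "l \<in> W 0"
    and le: "ks \<le> K" for H u v s h l ks
  proof (cases "h = l")
    case True then show ?thesis using t tripod_pure by blast
  next
    case False
    \<comment> \<open>Among the three letters, only \<open>d\<close> has trivial left section and
      only \<open>c\<close> is shifted to \<open>d\<close>.\<close>
    have "(lft u = ga \<and> lft (rgt v) = ga) \<or> (lft v = ga \<and> lft (rgt u) = ga)"
      using t by (auto simp: tripod_def klein_def)
    then show ?thesis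
      using cross[OF t W le _ _ False] cross[OF tripod_sym[OF t] W(1,3,2) le _ _ False[symmetric]] by blast
  qed
  have main: "H = UNIV" if t: "tripod H u v s h l" and W: "s \<in> W ks" "h \<in> W kh" "l \<in> W kl"
    and le: "ks + kh + kl \<le> K" and u: "lft u = ga" for H u v s h l ks kh kl
  proof (cases "kl = 0")
    case False then show ?thesis using shrink[OF t W le u] by blast
  next
    case kl: True
    show ?thesis
    proof (cases "lft v = ga \<and> 0 < kh")
      case True
      show ?thesis by (rule shrink[OF tripod_sym[OF t] W(1,3,2)]) (use True le in auto)
    next
      \<comment> \<open>No strict gain is possible yet, so a neutral step shifts the letters. The
        only letter shifted to \<open>d\<close> is \<open>c\<close>; for \<open>v = c\<close> the
        assumption leaves \<open>kh = 0\<close>, which is the case \<open>ends\<close>.\<close>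
      case nv: False
      have l: "rgt l = 1" using W(3) kl by auto
      from tripod_step[OF t u W(1,2), unfolded l] obtain H' s' h' k1 k2 where
        *: "tripod H' (rgt u) (rgt v) s' h' 1" "H' = UNIV \<longrightarrow> H = UNIV" "s' \<in> W k1" "h' \<in> W k2"
          "k1 + k2 \<le> ks + kh" by blast
      show ?thesis
      proof (cases "lft (rgt v) = ga")
        case True
        have "H' = UNIV"
        proof (cases "k2 = 0")
          case True
          then show ?thesis using ends[OF *(1,3)] *(4,5) le by simp
        next
          case False
          show ?thesis
            by (rule shrink[OF tripod_sym[OF *(1)], of k1 0 k2]) (use * False le True in simp_all)
        qed
        then show ?thesis using *(2) by blast
      next
        case False
        then have "lft v = ga" using t by (auto simp: tripod_def klein_def)
        then have "kh = 0" using nv by simp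
        then show ?thesis using ends[OF t W(1)] W(2,3) kl le by simp
      qed
    qed
  qed
  have "lft u = ga \<or> lft v = ga" using less.prems(1) by (auto simp: tripod_def klein_def)
  then show ?case
  proof
    assume "lft u = ga" then show ?case using main[OF less.prems] by (simp add: K_def)
  next
    assume "lft v = ga"
    then show ?case using main[OF tripod_sym[OF less.prems(1)] less.prems(2,4,3)] by (simp add: K_def)
  qed
qed

theorem dense_UNIV: assumes "dense H" shows "H = UNIV"
proof -
  have two: "H = UNIV" if H: "dense H" and v: "v \<in> klein" "v \<noteq> 1" "v \<in> H" and u: "u \<in> klein" "u \<noteq> v" "u \<noteq> 1"
    "inverse h * u * h \<in> H" for H v u h
  proof (rule dense_left_sections_UNIV[OF H])
    have v': "inverse 1 * v * 1 \<in> H" using v by simp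
    obtain h1 where 1: "inverse h1 * rgt u * h1 \<in> left_sections H" using conj_sections(1)[OF H u(1,4)] ..
    obtain h2 where 2: "inverse h2 * rgt v * h2 \<in> left_sections H" using conj_sections(1)[OF H v(1) v'] ..
    obtain s1 where 3: "inverse s1 * lft u * s1 \<in> left_sections H" using conj_sections(2)[OF H u(1,4)] ..
    obtain s2 where 4: "inverse s2 * lft v * s2 \<in> left_sections H" using conj_sections(2)[OF H v(1) v'] ..
    \<comment> \<open>At most one of the two letters is \<open>d\<close>, so one of them supplies a
      conjugate of \<open>a\<close> in the section group.\<close>
    have "lft u = ga \<or> lft v = ga" using u v by (auto simp: klein_def)
    then obtain s where s: "inverse s * ga * s \<in> left_sections H" using 3 4 by auto
    have "tripod (left_sections H) (rgt u) (rgt v) s h1 h2"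
      unfolding tripod_def using dense_left_sections[OF H] 1 2 s u v by (auto simp: klein_def)
    moreover obtain ks kh kl where "s \<in> W ks" "h1 \<in> W kh" "h2 \<in> W kl" using W_ex by meson
    ultimately show "left_sections H = UNIV" by (rule tripod_UNIV)
  qed
  have one: "H = UNIV" if H: "dense H" and v: "v \<in> klein" "v \<noteq> 1" "v \<in> H" for H v
  proof -
    obtain w where w: "w \<in> klein" "w \<noteq> 1" "w \<noteq> v"
    proof (cases "v = gb")
      case True show ?thesis by (rule that[of gc]) (simp_all add: klein_def True)
    next
      case False show ?thesis by (rule that[of gb]) (use False in \<open>simp_all add: klein_def\<close>)
    qed
    obtain y where y: "y \<in> H" "abtype y = abtype w" using H unfolding dense_def by blast
    obtain k where k: "y \<in> W k" using W_ex by blast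
    show ?thesis
    proof (rule reduce_to_letter[where fl = False and u = v and h = 1 and y = y and k = k])
      show "H' = UNIV" if "dense H'" "v' \<in> klein" "v' \<noteq> 1" "v' \<in> H'" "u \<in> klein" "u \<noteq> v'" "(u = 1) = False"
        "inverse h * u * h \<in> H'" for H' v' u h using two[OF that(1-6) _ that(8)] that(7) by simp
    qed (use H v y k w klein_props(9)[OF w(1)] klein_chi_eq[OF w(1) v(1)] in \<open>auto simp: abtype_eq_iff\<close>)
  qed
  obtain y where y: "y \<in> H" "abtype y = abtype gb" using assms unfolding dense_def by blast
  obtain k where k: "y \<in> W k" using W_ex by blast
  show ?thesis
  \<comment> \<open>The trivial \<open>u\<close> serves as the known letter, so that the reduction
    produces a first letter; the second run, inside \<open>one\<close>, starts from that letter. The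
    flag \<open>fl\<close> records which run it is and is preserved by sections.\<close>
  proof (rule reduce_to_letter[where fl = True and u = 1 and h = 1 and y = y and k = k])
    show "H' = UNIV" if "dense H'" "v' \<in> klein" "v' \<noteq> 1" "v' \<in> H'" "u \<in> klein" "u \<noteq> v'" "(u = 1) = True"
      "inverse h * u * h \<in> H'" for H' v' u h using one[OF that(1-4)] .
    show "inverse 1 * 1 * 1 \<in> H" using assms by (simp add: dense_def subgrp_def)
  qed (use assms y k in \<open>auto simp: abtype_eq_iff klein_def\<close>)
qed

section \<open>Connectivity\<close>

definition gen_by :: "grig set \<Rightarrow> grig set" where
  "gen_by A = {x. \<forall>H. subgrp H \<longrightarrow> A \<subseteq> H \<longrightarrow> x \<in> H}"

lemma subgrp_gen_by: "subgrp (gen_by A)"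
  unfolding gen_by_def subgrp_def by simp

lemma gen_by_incl: "x \<in> A \<Longrightarrow> x \<in> gen_by A"
  unfolding gen_by_def by blast

lemma gen_by_least: "subgrp H \<Longrightarrow> A \<subseteq> H \<Longrightarrow> gen_by A \<subseteq> H"
  unfolding gen_by_def by blast

lemma gen_by_mono: "A \<subseteq> B \<Longrightarrow> gen_by A \<subseteq> gen_by B"
  by (rule gen_by_least[OF subgrp_gen_by]) (use gen_by_incl in blast)

lemma gen_by_hom_nonzero:
  assumes "gen_by A = UNIV" "\<And>g h. f (g * h) \<longleftrightarrow> f g \<noteq> f h" "f g" shows "\<exists>s\<in>A. f s"
proof (rule ccontr)
  assume none: "\<not> (\<exists>s\<in>A. f s)"
  have 1: "\<not> f 1" using assms(2)[of 1 1] by simp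
  have "f (inverse x) \<longleftrightarrow> f x" for x using assms(2)[of "inverse x" x] 1 by simp
  then have "subgrp {g. \<not> f g}" using 1 assms(2) by (simp add: subgrp_def)
  then have "gen_by A \<subseteq> {g. \<not> f g}" by (rule gen_by_least) (use none in blast)
  then show False using assms(1,3) by blast
qed

text \<open>Linear forms on types, obtained by eliminating \<open>x\<close> (a type with \<open>flips\<close>) and then \<open>y\<close>.\<close>

definition elim1 :: "grig \<Rightarrow> grig \<Rightarrow> bool" where
  "elim1 x g \<longleftrightarrow> chi1 g \<noteq> (flips g \<and> chi1 x)"
definition elim2 :: "grig \<Rightarrow> grig \<Rightarrow> grig \<Rightarrow> bool" where
  "elim2 x y g \<longleftrightarrow> (chi2 g \<noteq> (flips g \<and> chi2 x)) \<noteq> (elim1 x g \<and> (chi2 y \<noteq> (flips y \<and> chi2 x)))"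

text \<open>The hypotheses say that the three types form a basis of the abelianisation. Gaussian
  elimination, carried out with the elements themselves, shows density, and
  \<open>dense_UNIV\<close> turns it into generation.\<close>

lemma gen_by_basis:
  assumes "flips x" "elim1 x y" "elim2 x y z" shows "gen_by {x, y, z} = UNIV"
proof (rule dense_UNIV, unfold dense_def, intro conjI allI)
  let ?S = "gen_by {x, y, z}"
  show s: "subgrp ?S" by (rule subgrp_gen_by)
  fix g
  define pw where "pw p t = (if p then t else (1::grig))" for p t
  have pw: "pw p t \<in> ?S" if "t \<in> ?S" for p t using that subgrpD(1)[OF s] by (simp add: pw_def)
  have in_S: "x \<in> ?S" "y \<in> ?S" "z \<in> ?S" by (intro gen_by_incl; simp)+
  define e2 where "e2 = y * pw (flips y) x"
  have e2: "e2 \<in> ?S" unfolding e2_def by (rule subgrpD(2)[OF s in_S(2) pw[OF in_S(1)]])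
  define e3 where "e3 = (z * pw (flips z) x) * pw (elim1 x z) e2"
  have e3: "e3 \<in> ?S" unfolding e3_def
    by (rule subgrpD(2)[OF s subgrpD(2)[OF s in_S(3) pw[OF in_S(1)]] pw[OF e2]])
  have t2: "\<not> flips e2" "chi1 e2" using assms by (auto simp: e2_def pw_def elim1_def)
  have t3: "\<not> flips e3" "\<not> chi1 e3" "chi2 e3" using assms by (auto simp: e3_def e2_def pw_def elim1_def elim2_def)
  define h1 where "h1 = pw (flips g) x"
  define h2 where "h2 = h1 * pw (chi1 h1 \<noteq> chi1 g) e2"
  define h3 where "h3 = h2 * pw (chi2 h2 \<noteq> chi2 g) e3"
  have "h3 \<in> ?S" unfolding h3_def h2_def h1_def
    by (rule subgrpD(2)[OF s subgrpD(2)[OF s pw[OF in_S(1)] pw[OF e2]] pw[OF e3]])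
  moreover have "flips h1 = flips g" using assms(1) by (simp add: h1_def pw_def)
  then have h2: "flips h2 = flips g" "chi1 h2 = chi1 g" using t2 by (auto simp: h2_def pw_def)
  then have "abtype h3 = abtype g" using t3 by (auto simp: h3_def pw_def abtype_eq_iff)
  ultimately show "\<exists>h\<in>?S. abtype h = abtype g" by blast
qed

lemma q_hom: "elim1 x (g * h) \<longleftrightarrow> elim1 x g \<noteq> elim1 x h" "elim2 x y (g * h) \<longleftrightarrow> elim2 x y g \<noteq> elim2 x y h"
  by (auto simp: elim1_def elim2_def)

section \<open>Nielsen moves\<close>

definition nmove :: "grig list \<Rightarrow> grig list \<Rightarrow> bool" where
  "nmove xs ys \<longleftrightarrow> (\<exists>i j. i < length xs \<and> j < length xs \<and> i \<noteq> j \<and>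
     (ys = xs[j := xs ! j * xs ! i] \<or> ys = xs[j := xs ! j * inverse (xs ! i)] \<or>
      ys = xs[j := xs ! i * xs ! j] \<or> ys = xs[j := inverse (xs ! i) * xs ! j]))"

lemma nmove_length: "nmove xs ys \<Longrightarrow> length ys = length xs"
  by (auto simp: nmove_def)

lemma mvI:
  assumes "i < length xs" "j < length xs" "i \<noteq> j"
  shows "nmove xs (xs[j := xs ! j * xs ! i])" "nmove xs (xs[j := xs ! j * inverse (xs ! i)])"
    "nmove xs (xs[j := xs ! i * xs ! j])" "nmove xs (xs[j := inverse (xs ! i) * xs ! j])"
  using assms unfolding nmove_def by blast+

lemma nmove_sym: assumes "nmove xs ys" shows "nmove ys xs"
proof -
  obtain i j where ij: "i < length xs" "j < length xs" "i \<noteq> j"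
    "ys = xs[j := xs ! j * xs ! i] \<or> ys = xs[j := xs ! j * inverse (xs ! i)] \<or>
      ys = xs[j := xs ! i * xs ! j] \<or> ys = xs[j := inverse (xs ! i) * xs ! j]"
    using assms unfolding nmove_def by blast
  have l: "length ys = length xs" using nmove_length[OF assms] .
  have b: "xs = ys[j := xs ! j]" "ys ! i = xs ! i" using ij by auto
  note m = mvI[of i ys j]
  from ij(4) show ?thesis
  proof (elim disjE)
    assume "ys = xs[j := xs ! j * xs ! i]"
    then show ?thesis using m(2) ij l b by (simp add: mult.assoc)
  next
    assume "ys = xs[j := xs ! j * inverse (xs ! i)]"
    then show ?thesis using m(1) ij l b by (simp add: mult.assoc)
  next
    assume "ys = xs[j := xs ! i * xs ! j]"
    then show ?thesis using m(4) ij l b by (simp add: mult.assoc)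
  next
    assume "ys = xs[j := inverse (xs ! i) * xs ! j]"
    then show ?thesis using m(3) ij l b by (simp add: mult.assoc)
  qed
qed

lemma nmove_gen_by: assumes "nmove xs ys" shows "gen_by (set ys) = gen_by (set xs)"
proof -
  have *: "gen_by (set ys) \<subseteq> gen_by (set xs)" if m: "nmove xs ys" for xs ys
  proof (rule gen_by_least[OF subgrp_gen_by])
    note s = subgrpD[OF subgrp_gen_by[of "set xs"]]
    obtain i j where ij: "i < length xs" "j < length xs"
      "ys = xs[j := xs ! j * xs ! i] \<or> ys = xs[j := xs ! j * inverse (xs ! i)] \<or>
        ys = xs[j := xs ! i * xs ! j] \<or> ys = xs[j := inverse (xs ! i) * xs ! j]"
      using m unfolding nmove_def by blast
    have "xs ! i \<in> gen_by (set xs)" "xs ! j \<in> gen_by (set xs)" using ij gen_by_incl by auto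
    then have e: "xs ! j * xs ! i \<in> gen_by (set xs)" "xs ! j * inverse (xs ! i) \<in> gen_by (set xs)"
      "xs ! i * xs ! j \<in> gen_by (set xs)" "inverse (xs ! i) * xs ! j \<in> gen_by (set xs)" by (simp_all add: s)
    have "set (xs[j := y]) \<subseteq> gen_by (set xs)" if "y \<in> gen_by (set xs)" for y
      using that set_update_subset_insert[of xs j y] gen_by_incl by blast
    then show "set ys \<subseteq> gen_by (set xs)" using ij(3) e by blast
  qed
  show ?thesis using *[OF assms] *[OF nmove_sym[OF assms]] by blast
qed

definition gen_lists :: "nat \<Rightarrow> grig list set" where
  "gen_lists n = {xs. length xs = n \<and> gen_by (set xs) = UNIV}"

definition nmoves :: "(grig list \<times> grig list) set" where "nmoves = {(xs, ys). nmove xs ys}"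

lemma nmoves_gen_lists: "(xs, ys) \<in> nmoves\<^sup>* \<Longrightarrow> xs \<in> gen_lists n \<Longrightarrow> ys \<in> gen_lists n"
  by (induction rule: rtrancl_induct) (auto simp: nmoves_def gen_lists_def nmove_gen_by nmove_length)

lemma nmoves_sym: "(xs, ys) \<in> nmoves\<^sup>* \<Longrightarrow> (ys, xs) \<in> nmoves\<^sup>*"
proof -
  have "sym nmoves" unfolding sym_def nmoves_def using nmove_sym by blast
  then show "(xs, ys) \<in> nmoves\<^sup>* \<Longrightarrow> (ys, xs) \<in> nmoves\<^sup>*" using sym_rtrancl symD by metis
qed

definition entries_except :: "nat \<Rightarrow> grig list \<Rightarrow> grig set" where
  "entries_except t xs = {xs ! i | i. i < length xs \<and> i \<noteq> t}"

text \<open>The elements by which entry \<open>t\<close> can be multiplied on the right, whatever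
  its current value, form a subgroup. It contains the other entries, hence is everything.\<close>

lemma nmoves_update_any:
  assumes t: "t < length xs" and sp: "gen_by (entries_except t xs) = UNIV"
  shows "(xs, xs[t := g]) \<in> nmoves\<^sup>*"
proof -
  define S where "S = {w. \<forall>y. (xs[t := y], xs[t := y * w]) \<in> nmoves\<^sup>*}"
  have "subgrp S" unfolding subgrp_def
  proof (intro conjI ballI)
    show "1 \<in> S" by (simp add: S_def)
    show "x * y \<in> S" if "x \<in> S" "y \<in> S" for x y
    proof -
      have "(xs[t := z], xs[t := z * (x * y)]) \<in> nmoves\<^sup>*" for z
      proof -
        have "(xs[t := z], xs[t := z * x]) \<in> nmoves\<^sup>*" "(xs[t := z * x], xs[t := z * x * y]) \<in> nmoves\<^sup>*"
          using that unfolding S_def by blast+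
        then show ?thesis by (simp add: mult.assoc)
      qed
      then show ?thesis by (simp add: S_def)
    qed
    show "inverse x \<in> S" if "x \<in> S" for x
    proof -
      have "(xs[t := z], xs[t := z * inverse x]) \<in> nmoves\<^sup>*" for z
      proof -
        have "(xs[t := z * inverse x], xs[t := z * inverse x * x]) \<in> nmoves\<^sup>*" using that unfolding S_def by blast
        then show ?thesis using nmoves_sym by (simp add: mult.assoc)
      qed
      then show ?thesis by (simp add: S_def)
    qed
  qed
  moreover have "entries_except t xs \<subseteq> S"
  proof
    fix w assume "w \<in> entries_except t xs"
    then obtain i where i: "i < length xs" "i \<noteq> t" "w = xs ! i" by (auto simp: entries_except_def)
    have "(xs[t := y], xs[t := y * w]) \<in> nmoves" for y
      using mvI(1)[of i "xs[t := y]" t] i t by (simp add: nmoves_def)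
    then show "w \<in> S" by (auto simp: S_def)
  qed
  ultimately have "gen_by (entries_except t xs) \<subseteq> S" by (rule gen_by_least)
  then have "inverse (xs ! t) * g \<in> S" using sp by blast
  then have "(xs[t := xs ! t], xs[t := xs ! t * (inverse (xs ! t) * g)]) \<in> nmoves\<^sup>*" unfolding S_def by blast
  then show ?thesis by simp
qed

lemma gen_by_UNIV_mono: "gen_by A = UNIV \<Longrightarrow> A \<subseteq> B \<Longrightarrow> gen_by B = UNIV"
  using gen_by_mono[of A B] by blast

text \<open>Some position \<open>f\<close> is redundant; it takes over the entry of position \<open>t\<close>, which becomes free.\<close>

lemma nmoves_set_entry:
  assumes n: "5 \<le> length xs" and ijk: "i < length xs" "j < length xs" "k < length xs"
    and sp: "gen_by {xs ! i, xs ! j, xs ! k} = UNIV" and t: "t < length xs"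
  shows "\<exists>ys. (xs, ys) \<in> nmoves\<^sup>* \<and> length ys = length xs \<and> ys ! t = g \<and> (\<forall>p\<in>{i, j, k} - {t}. ys ! p = xs ! p)"
proof -
  \<comment> \<open>Here five entries are needed: \<open>i\<close>, \<open>j\<close>,
    \<open>k\<close>, \<open>t\<close> may be four different positions.\<close>
  have "card {i, j, k, t} < card {..<length xs}"
    using n card_length[of "[i, j, k, t]"] by simp
  then have "\<not> {..<length xs} \<subseteq> {i, j, k, t}" using card_mono[of "{i, j, k, t}"] by (meson finite.emptyI finite_insert not_le)
  then obtain f where f: "f < length xs" "f \<notin> {i, j, k, t}" by blast
  define zs where "zs = xs[f := xs ! t]"
  have "{xs ! i, xs ! j, xs ! k} \<subseteq> entries_except f xs" using ijk f by (auto simp: entries_except_def)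
  then have 1: "(xs, zs) \<in> nmoves\<^sup>*" unfolding zs_def
    by (intro nmoves_update_any f(1) gen_by_UNIV_mono[OF sp])
  have p: "xs ! p \<in> entries_except t zs" if "p \<in> {i, j, k}" for p
  proof (cases "p = t")
    case True
    then have "xs ! p = zs ! f" using f by (simp add: zs_def)
    then show ?thesis unfolding entries_except_def using f by (intro CollectI exI[of _ f]) (simp add: zs_def)
  next
    case False
    then show ?thesis unfolding entries_except_def using f ijk that
      by (intro CollectI exI[of _ p]) (auto simp: zs_def)
  qed
  then have "gen_by (entries_except t zs) = UNIV" by (intro gen_by_UNIV_mono[OF sp]) auto
  then have "(zs, zs[t := g]) \<in> nmoves\<^sup>*" using t by (intro nmoves_update_any) (simp_all add: zs_def)
  then have "(xs, zs[t := g]) \<in> nmoves\<^sup>*" using 1 by simp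
  moreover have "\<forall>p\<in>{i, j, k} - {t}. zs[t := g] ! p = xs ! p" using f by (auto simp: zs_def)
  ultimately show ?thesis using t by (intro exI[of _ "zs[t := g]"]) (simp add: zs_def)
qed

lemma ex_position: "gen_by (set xs) = UNIV \<Longrightarrow> (\<And>g h. f (g * h) \<longleftrightarrow> f g \<noteq> f h) \<Longrightarrow> f g \<Longrightarrow> \<exists>i<length xs. f (xs ! i)"
  using gen_by_hom_nonzero[of "set xs" f g] by (auto simp: in_set_conv_nth)

definition std_tuple :: "nat \<Rightarrow> grig list" where "std_tuple n = [ga, gc, gd] @ replicate (n - 3) 1"

text \<open>An exchange argument on types: once an entry is set, a generating triple through all
  positions already set is chosen anew, so that the next change preserves them.\<close>

lemma nmoves_std_tuple:
  assumes xs: "xs \<in> gen_lists n" and n: "5 \<le> n" shows "(xs, std_tuple n) \<in> nmoves\<^sup>*"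
proof -
  have len: "length ys = n" "gen_by (set ys) = UNIV" if "(xs, ys) \<in> nmoves\<^sup>*" for ys
    using nmoves_gen_lists[OF that xs] by (auto simp: gen_lists_def)
  have third: "\<exists>k<n. gen_by {ys ! i, ys ! j, ys ! k} = UNIV"
    if "(xs, ys) \<in> nmoves\<^sup>*" "flips (ys ! i)" "elim1 (ys ! i) (ys ! j)" for ys i j
    using ex_position[of ys "elim2 (ys ! i) (ys ! j)" gd] len[OF that(1)] gen_by_basis[OF that(2,3)] q_hom
    by (auto simp: elim2_def elim1_def)
  have second: "\<exists>j<n. elim1 (ys ! i) (ys ! j)" if "(xs, ys) \<in> nmoves\<^sup>*" for ys i
    using ex_position[of ys "elim1 (ys ! i)" gc] len[OF that(1)] q_hom by (auto simp: elim1_def)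
  have s0: "(xs, xs) \<in> nmoves\<^sup>*" by simp
  obtain i where i: "i < n" "flips (xs ! i)" using ex_position[of xs flips ga] len[OF s0] by auto
  obtain j where j: "j < n" "elim1 (xs ! i) (xs ! j)" using second[OF s0] by blast
  obtain k where k: "k < n" "gen_by {xs ! i, xs ! j, xs ! k} = UNIV" using third[OF s0 i(2) j(2)] by blast
  obtain ys where ys: "(xs, ys) \<in> nmoves\<^sup>*" "ys ! 0 = ga"
    using nmoves_set_entry[of xs i j k 0 ga] n i j k len[OF s0] by auto
  obtain j where j: "j < n" "elim1 (ys ! 0) (ys ! j)" using second[OF ys(1)] by blast
  obtain k where k: "k < n" "gen_by {ys ! 0, ys ! j, ys ! k} = UNIV"
    using third[OF ys(1) _ j(2)] ys(2) by auto
  obtain zs where zs: "(ys, zs) \<in> nmoves\<^sup>*" "zs ! 0 = ga" "zs ! 1 = gc"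
    using nmoves_set_entry[of ys 0 j k 1 gc] n j k len[OF ys(1)] ys(2) by auto
  have xz: "(xs, zs) \<in> nmoves\<^sup>*" using ys zs by simp
  obtain k where k: "k < n" "gen_by {zs ! 0, zs ! 1, zs ! k} = UNIV"
    using third[OF xz, of 0 1] zs(2,3) by (auto simp: elim1_def)
  obtain ws where ws: "(zs, ws) \<in> nmoves\<^sup>*" "ws ! 0 = ga" "ws ! 1 = gc" "ws ! 2 = gd"
    using nmoves_set_entry[of zs 0 1 k 2 gd] n k len[OF xz] zs(2,3) by auto
  have "\<exists>us. (xs, us) \<in> nmoves\<^sup>* \<and> us ! 0 = ga \<and> us ! 1 = gc \<and> us ! 2 = gd \<and> (\<forall>p<n. 3 \<le> p \<and> p < m + 3 \<longrightarrow> us ! p = 1)" for m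
  proof (induction m)
    case 0 show ?case using ws xz by (intro exI[of _ ws]) auto
  next
    case (Suc m)
    then obtain us where us: "(xs, us) \<in> nmoves\<^sup>*" "us ! 0 = ga" "us ! 1 = gc" "us ! 2 = gd"
      "\<forall>p<n. 3 \<le> p \<and> p < m + 3 \<longrightarrow> us ! p = 1" by blast
    note l = len[OF us(1)]
    show ?case
    proof (cases "m + 3 < n")
      case True
      have "{ga, gc, gd} \<subseteq> entries_except (m + 3) us"
      proof -
        have "us ! p \<in> entries_except (m + 3) us" if "p < 3" for p
          unfolding entries_except_def using that l True by (intro CollectI exI[of _ p]) simp
        from this[of 0] this[of 1] this[of 2] show ?thesis using us by simp
      qed
      moreover have "gen_by {ga, gc, gd} = UNIV" by (rule gen_by_basis) (auto simp: elim1_def elim2_def)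
      ultimately have "gen_by (entries_except (m + 3) us) = UNIV" using gen_by_UNIV_mono by blast
      then have "(us, us[m + 3 := 1]) \<in> nmoves\<^sup>*"
        using True l(1) by (intro nmoves_update_any) simp_all
      then have "(xs, us[m + 3 := 1]) \<in> nmoves\<^sup>*" using us(1) by simp
      then show ?thesis using us True l
        by (intro exI[of _ "us[m + 3 := 1]"]) (auto simp: nth_list_update)
    next
      case False
      then show ?thesis using us by (intro exI[of _ us]) auto
    qed
  qed
  from this[of n] obtain us where us: "(xs, us) \<in> nmoves\<^sup>*" "us ! 0 = ga" "us ! 1 = gc" "us ! 2 = gd"
    "\<forall>p<n. 3 \<le> p \<longrightarrow> us ! p = 1" by auto
  have "us = std_tuple n"
  proof (rule nth_equalityI)
    show "length us = length (std_tuple n)" using len[OF us(1)] n by (simp add: std_tuple_def)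
    fix p assume "p < length us"
    then have p: "p < n" using len[OF us(1)] by simp
    consider "p = 0" | "p = 1" | "p = 2" | "3 \<le> p" by linarith
    then show "us ! p = std_tuple n ! p"
      by cases (use us p in \<open>auto simp: std_tuple_def nth_append nth_Cons split: nat.splits\<close>)
  qed
  then show ?thesis using us(1) by simp
qed

section \<open>Growth\<close>

lemma act_wreath:
  "act g (flips g # s) = False # act (lft g) s" "act g ((\<not> flips g) # s) = True # act (rgt g) s"
  using wreath[of g] by (simp_all add: wreath_def)

lemma act_append: "\<exists>h. \<forall>s. act g (u @ s) = act g u @ act h s"
proof (induction u arbitrary: g)
  case (Cons x u)
  show ?case
  proof (cases "x = flips g")
    case True
    obtain h where "\<forall>s. act (lft g) (u @ s) = act (lft g) u @ act h s" using Cons.IH by blast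
    then show ?thesis using act_wreath(1)[of g] True by (intro exI[of _ h]) simp
  next
    case False
    then have x: "x = (\<not> flips g)" by simp
    obtain h where "\<forall>s. act (rgt g) (u @ s) = act (rgt g) u @ act h s" using Cons.IH by blast
    then show ?thesis using act_wreath(2)[of g] x by (intro exI[of _ h]) simp
  qed
qed (auto intro: exI[of _ g])

lemma act_length: "length (act g u) = length u"
proof (induction u arbitrary: g)
  case (Cons x u)
  show ?case
  proof (cases "x = flips g")
    case True then show ?thesis using act_wreath(1)[of g] Cons by simp
  next
    case False
    then have x: "x = (\<not> flips g)" by simp
    then show ?thesis using act_wreath(2)[of g] Cons by simp
  qed
qed simp

lemma act_inverse_act [simp]: "act (inverse g) (act g s) = s" "act g (act (inverse g) s) = s"
  by (simp_all flip: act_simps(2))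

definition rigid_at :: "grig \<Rightarrow> bool list \<Rightarrow> bool" where
  "rigid_at x v \<longleftrightarrow> (\<forall>u s. length u = length v \<longrightarrow> u \<noteq> v \<longrightarrow> act x (u @ s) = u @ s) \<and>
     (\<forall>s. \<exists>t. act x (v @ s) = v @ t) \<and> (\<exists>s. act x (v @ s) \<noteq> v @ s)"

lemma rigid_at_conj: assumes "rigid_at x v" shows "rigid_at (g * x * inverse g) (act g v)"
proof -
  obtain h where h: "\<And>s. act g (v @ s) = act g v @ act h s" using act_append by blast
  obtain k where k: "\<And>s. act (inverse g) (act g v @ s) = v @ act k s"
    using act_append[of "inverse g" "act g v"] by auto
  show ?thesis unfolding rigid_at_def
  proof (intro conjI allI impI)
    fix u s assume u: "length u = length (act g v)" "u \<noteq> act g v"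
    obtain k' where k': "act (inverse g) (u @ s) = act (inverse g) u @ act k' s"
      using act_append[of "inverse g" u] by blast
    have "act (inverse g) u \<noteq> v" using u(2) by auto
    then have "act x (act (inverse g) u @ act k' s) = act (inverse g) u @ act k' s"
      using assms u(1) by (simp add: rigid_at_def act_length)
    then have "act x (act (inverse g) (u @ s)) = act (inverse g) (u @ s)" using k' by simp
    then show "act (g * x * inverse g) (u @ s) = u @ s" by simp
  next
    fix s
    obtain t where "act x (v @ act k s) = v @ t" using assms by (auto simp: rigid_at_def)
    then show "\<exists>t. act (g * x * inverse g) (act g v @ s) = act g v @ t" using k h by simp
  next
    obtain s where s: "act x (v @ s) \<noteq> v @ s" using assms by (auto simp: rigid_at_def)
    have "act (g * x * inverse g) (act g v @ act h s) = act g (act x (v @ s))" by (simp flip: h)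
    moreover have "act g (act x (v @ s)) \<noteq> act g (v @ s)" using s by (metis act_inverse_act(1))
    ultimately show "\<exists>s. act (g * x * inverse g) (act g v @ s) \<noteq> act g v @ s" using h by metis
  qed
qed

text \<open>\<open>S\<close> can be recovered from \<open>y\<close> within level \<open>m\<close>.
  This is what makes tuples built from different vertex sets different.\<close>

definition moves_below :: "bool list set \<Rightarrow> grig \<Rightarrow> nat \<Rightarrow> bool" where
  "moves_below S y m \<longleftrightarrow> (\<forall>u. length u = m \<longrightarrow> ((\<exists>s. act y (u @ s) \<noteq> u @ s) \<longleftrightarrow> u \<in> S))"

lemma moves_below_insert:
  assumes "moves_below S y m" "rigid_at x v" "length v = m" "v \<notin> S" shows "moves_below (insert v S) (y * x) m"
  unfolding moves_below_def
proof (intro allI impI)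
  fix u :: "bool list" assume u: "length u = m"
  show "(\<exists>s. act (y * x) (u @ s) \<noteq> u @ s) \<longleftrightarrow> u \<in> insert v S"
  proof (cases "u = v")
    case True
    have y: "act y (v @ s) = v @ s" for s using assms(1,3,4) unfolding moves_below_def by blast
    obtain s where s: "act x (v @ s) \<noteq> v @ s" using assms(2) unfolding rigid_at_def by blast
    obtain t where "act x (v @ s) = v @ t" using assms(2) unfolding rigid_at_def by blast
    then have "act (y * x) (v @ s) \<noteq> v @ s" using s y by simp
    then show ?thesis using True by blast
  next
    case False
    then have "act x (u @ s) = u @ s" for s using assms(2,3) u by (simp add: rigid_at_def)
    then show ?thesis using False assms(1) u by (simp add: moves_below_def)
  qed
qed

section \<open>Walks in the Schreier graphs and Lysenok words\<close>

datatype letter = LA | LB | LC | LD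

fun ev :: "letter \<Rightarrow> grig" where
  "ev LA = ga" | "ev LB = gb" | "ev LC = gc" | "ev LD = gd"

fun evs :: "letter list \<Rightarrow> grig" where
  "evs [] = 1" | "evs (u # us) = ev u * evs us"

text \<open>The starting points of the steps labelled \<open>a\<close>. Such a step also visits the
  flipped vertex, so they record which \<open>a\<close>-edges of the Schreier graph are
  traversed.\<close>

fun a_steps :: "bool list \<Rightarrow> letter list \<Rightarrow> bool list set" where
  "a_steps v [] = {}"
| "a_steps v (g # w) = (if g = LA then {v} else {}) \<union> a_steps (act (ev g) v) w"

fun visited :: "bool list \<Rightarrow> letter list \<Rightarrow> bool list set" where
  "visited v [] = {v}"
| "visited v (g # w) = insert v (visited (act (ev g) v) w)"

text \<open>Lysenok's substitution.\<close>

fun lys :: "letter \<Rightarrow> letter list" where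
  "lys LA = [LA, LC, LA]" | "lys LB = [LD]" | "lys LC = [LB]" | "lys LD = [LC]"

definition lys_word :: "letter list \<Rightarrow> letter list" where "lys_word us = concat (map lys us)"

lemma lys_word_simps [simp]: "lys_word [] = []" "lys_word (u # us) = lys u @ lys_word us" "lys_word (us @ vs) = lys_word us @ lys_word vs"
  by (simp_all add: lys_word_def)

lemma lys_word_pow_append: "(lys_word ^^ m) (us @ vs) = (lys_word ^^ m) us @ (lys_word ^^ m) vs"
  by (induction m) simp_all

text \<open>The left sections of the substituted letters \<open>aca\<close>, \<open>d\<close>,
  \<open>b\<close>, \<open>c\<close>; their right sections are the original letters. So substitution
  copies a word to the right subtree, with an error on the left that \<open>left_word\<close>
  records.\<close>

fun left_letter :: "letter \<Rightarrow> grig" where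
  "left_letter LA = gd" | "left_letter LB = 1" | "left_letter LC = ga" | "left_letter LD = ga"

fun left_word :: "letter list \<Rightarrow> grig" where
  "left_word [] = 1" | "left_word (u # us) = left_letter u * left_word us"

lemma left_word_append: "left_word (us @ vs) = left_word us * left_word vs"
  by (induction us) (simp_all add: mult.assoc)

lemma evs_lys_word: "\<not> flips (evs (lys_word us)) \<and> lft (evs (lys_word us)) = left_word us \<and> rgt (evs (lys_word us)) = evs us"
proof (induction us)
  case (Cons u us) then show ?case by (cases u) (simp_all add: mult.assoc)
qed simp

lemma lys_word_pow_letter: "L \<noteq> LA \<Longrightarrow> \<exists>L'. L' \<noteq> LA \<and> (lys_word ^^ m) [L] = [L']"
proof (induction m)
  case (Suc m)
  then obtain L' where "L' \<noteq> LA" "(lys_word ^^ m) [L] = [L']" by blast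
  then show ?case by (cases L') auto
qed simp

lemma left_word_pow_letter: "L \<noteq> LA \<Longrightarrow> left_word ((lys_word ^^ m) [L]) \<in> {1, ga}"
proof -
  assume "L \<noteq> LA"
  then obtain L' where "L' \<noteq> LA" "(lys_word ^^ m) [L] = [L']" using lys_word_pow_letter by blast
  then show ?thesis by (cases L') auto
qed

text \<open>The zeroth and first powers give \<open>d\<close> and \<open>dad\<close>, but the second
  gives 1. From there on the recursion \<open>x * e * x\<close> stays inside {1,
  \<open>a\<close>}.\<close>

lemma left_word_pow_LA: "left_word ((lys_word ^^ (m + 2)) [LA]) \<in> {1, ga}"
proof (induction m)
  case 0 show ?case by (simp add: numeral_2_eq_2)
next
  case (Suc m)
  have "(lys_word ^^ (Suc m + 2)) [LA] = (lys_word ^^ (m + 2)) (lys_word [LA])"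
    by (simp only: add_Suc funpow_Suc_right o_apply)
  also have "\<dots> = (lys_word ^^ (m + 2)) ([LA] @ [LC] @ [LA])" by simp
  also have "\<dots> = (lys_word ^^ (m + 2)) [LA] @ (lys_word ^^ (m + 2)) [LC] @ (lys_word ^^ (m + 2)) [LA]"
    by (simp only: lys_word_pow_append)
  finally have "left_word ((lys_word ^^ (Suc m + 2)) [LA]) =
      left_word ((lys_word ^^ (m + 2)) [LA]) * (left_word ((lys_word ^^ (m + 2)) [LC]) * left_word ((lys_word ^^ (m + 2)) [LA]))"
    by (simp only: left_word_append)
  then show ?case using Suc left_word_pow_letter[of LC "m + 2"] by auto
qed

text \<open>Starting at the second power puts the left sections of both letters into {1,
  \<open>a\<close>}, a group of exponent 2. As \<open>abab\<close> is a square, the left error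
  vanishes at every further substitution.\<close>

definition base_word :: "letter list" where "base_word = (lys_word ^^ 2) [LA, LB, LA, LB]"

lemma left_word_pow_base_word: "left_word ((lys_word ^^ m) base_word) = 1"
proof -
  have "(lys_word ^^ m) base_word = (lys_word ^^ (m + 2)) ([LA] @ [LB] @ [LA] @ [LB])"
    unfolding base_word_def by (simp only: funpow_add o_apply append_Cons append_Nil)
  also have "left_word \<dots> = left_word ((lys_word ^^ (m + 2)) [LA]) * (left_word ((lys_word ^^ (m + 2)) [LB]) *
      (left_word ((lys_word ^^ (m + 2)) [LA]) * left_word ((lys_word ^^ (m + 2)) [LB])))"
    by (simp only: lys_word_pow_append left_word_append)
  also have "\<dots> = 1" using left_word_pow_LA[of m] left_word_pow_letter[of LB "m + 2"] by auto
  finally show ?thesis .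
qed

lemma rigid_at_base_word: "rigid_at (evs ((lys_word ^^ m) base_word)) (replicate m True)"
proof (induction m)
  case 0
  have "flip_a (gen_b (flip_a (gen_b [False, False]))) \<noteq> [False, False]" by simp
  then have "\<exists>s. act (evs [LA, LB, LA, LB]) s \<noteq> s"
    by (intro exI[of _ "[False, False]"]) simp
  then obtain s where s: "act (evs [LA, LB, LA, LB]) s \<noteq> s" by blast
  have "act (evs base_word) (True # True # s) = True # True # act (evs [LA, LB, LA, LB]) s"
    using act_wreath(2)[of "evs (lys_word (lys_word [LA, LB, LA, LB]))"] act_wreath(2)[of "evs (lys_word [LA, LB, LA, LB])"]
      evs_lys_word[of "lys_word [LA, LB, LA, LB]"] evs_lys_word[of "[LA, LB, LA, LB]"]
    unfolding base_word_def numeral_2_eq_2 by (simp del: lys_word_simps evs.simps)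
  then have "act (evs base_word) (True # True # s) \<noteq> True # True # s" using s by simp
  then show ?case by (auto simp: rigid_at_def)
next
  case (Suc m)
  let ?x = "evs ((lys_word ^^ m) base_word)" and ?y = "evs ((lys_word ^^ Suc m) base_word)"
  have y: "\<not> flips ?y" "lft ?y = 1" "rgt ?y = ?x"
    using evs_lys_word[of "(lys_word ^^ m) base_word"] left_word_pow_base_word[of m] by simp_all
  have yF: "act ?y (False # s) = False # s" for s using act_wreath(1)[of ?y s] y by simp
  have yT: "act ?y (True # s) = True # act ?x s" for s using act_wreath(2)[of ?y s] y by simp
  show ?case unfolding rigid_at_def
  proof (intro conjI allI impI)
    fix u s :: "bool list" assume u: "length u = length (replicate (Suc m) True)" "u \<noteq> replicate (Suc m) True"
    then obtain x u' where u': "u = x # u'" by (cases u) auto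
    show "act ?y (u @ s) = u @ s"
    proof (cases x)
      case True
      then have e: "u = True # u'" using u' by simp
      then have "act ?x (u' @ s) = u' @ s" using Suc u by (simp add: rigid_at_def)
      then show ?thesis unfolding e by (simp only: append_Cons yT)
    next
      case False
      then have e: "u = False # u'" using u' by simp
      show ?thesis unfolding e by (simp only: append_Cons yF)
    qed
  next
    fix s :: "bool list"
    obtain t where "act ?x (replicate m True @ s) = replicate m True @ t" using Suc unfolding rigid_at_def by blast
    then have "act ?y (replicate (Suc m) True @ s) = replicate (Suc m) True @ t"
      by (simp only: replicate_Suc append_Cons yT)
    then show "\<exists>t. act ?y (replicate (Suc m) True @ s) = replicate (Suc m) True @ t" ..
  next
    obtain s where "act ?x (replicate m True @ s) \<noteq> replicate m True @ s" using Suc unfolding rigid_at_def by blast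
    then have "act ?y (replicate (Suc m) True @ s) \<noteq> replicate (Suc m) True @ s"
      by (simp only: replicate_Suc append_Cons yT) simp
    then show "\<exists>s. act ?y (replicate (Suc m) True @ s) \<noteq> replicate (Suc m) True @ s" ..
  qed
qed

text \<open>A step \<open>a\<close> at \<open>u\<close> lifts to \<open>aca\<close> at
  1\<open>u\<close>: the path goes to 0\<open>u\<close>, then to 0 followed by the flipped
  \<open>u\<close>, where the second \<open>a\<close> starts. Every other letter lifts to one step
  that acts as this letter below 1.\<close>

lemma a_steps_lys_word:
  "(\<lambda>u. True # u) ` a_steps v w \<union> (\<lambda>u. False # flip_a u) ` a_steps v w \<subseteq> a_steps (True # v) (lys_word w)"
proof (induction w arbitrary: v)
  case (Cons g w)
  show ?case
  proof (cases g)
    case LA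
    then show ?thesis using Cons.IH[of "flip_a v"] by auto
  next
    case LB
    then show ?thesis using Cons.IH[of "gen_b v"] by auto
  next
    case LC
    then show ?thesis using Cons.IH[of "gen_c v"] by auto
  next
    case LD
    then show ?thesis using Cons.IH[of "gen_d v"] by auto
  qed
qed simp

text \<open>Every \<open>a\<close>-edge of the level is traversed. An edge one level deeper joins
  1\<open>u'\<close> and 0\<open>u'\<close>; if the old walk applies \<open>a\<close> at
  \<open>u'\<close> or at its flip, one of these two is a starting point of the lifted walk.\<close>

lemma a_steps_cover:
  "length u = Suc m \<Longrightarrow> u \<in> a_steps (replicate (Suc m) True) ((lys_word ^^ m) [LA]) \<or>
     flip_a u \<in> a_steps (replicate (Suc m) True) ((lys_word ^^ m) [LA])"
proof (induction m arbitrary: u)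
  case 0
  then obtain x where "u = [x]" by (cases u) auto
  then show ?case by (cases x) simp_all
next
  case (Suc m)
  then obtain x u' where u': "u = x # u'" "length u' = Suc m" by (cases u) auto
  let ?A = "a_steps (replicate (Suc m) True) ((lys_word ^^ m) [LA])"
  let ?A' = "a_steps (replicate (Suc (Suc m)) True) ((lys_word ^^ Suc m) [LA])"
  have sub: "z \<in> ?A \<Longrightarrow> True # z \<in> ?A'" "z \<in> ?A \<Longrightarrow> False # flip_a z \<in> ?A'" for z
    using a_steps_lys_word[of "replicate (Suc m) True" "(lys_word ^^ m) [LA]"] by auto
  have "(True # u' \<in> ?A') \<or> (False # u' \<in> ?A')"
    using Suc.IH[OF u'(2)] sub(1)[of u'] sub(2)[of "flip_a u'"] by auto
  then show ?case unfolding u' by (cases x) auto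
qed

lemma a_steps_visited: "u \<in> a_steps v w \<Longrightarrow> u \<in> visited v w \<and> flip_a u \<in> visited v w"
proof (induction w arbitrary: v)
  case (Cons g w)
  have "v \<in> visited v w" for v w by (cases w) auto
  then show ?case using Cons by (auto split: if_splits)
qed simp

lemma visited_cover: "length u = Suc m \<Longrightarrow> u \<in> visited (replicate (Suc m) True) ((lys_word ^^ m) [LA])"
  using a_steps_cover[of u m] a_steps_visited[of u] a_steps_visited[of "flip_a u"] by fastforce

fun count_a :: "letter list \<Rightarrow> nat" where
  "count_a [] = 0" | "count_a (u # us) = (if u = LA then 1 else 0) + count_a us"

lemma lys_word_counts: "count_a (lys_word us) = 2 * count_a us" "length (lys_word us) = length us + 2 * count_a us"
proof -
  show "count_a (lys_word us) = 2 * count_a us"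
  proof (induction us)
    case (Cons u us) then show ?case by (cases u) simp_all
  qed simp
  show "length (lys_word us) = length us + 2 * count_a us"
  proof (induction us)
    case (Cons u us) then show ?case by (cases u) simp_all
  qed simp
qed

lemma length_lys_word_pow: "length ((lys_word ^^ m) us) \<le> 2 * 2 ^ m * length us"
proof -
  have A: "count_a ((lys_word ^^ m) us) = 2 ^ m * count_a us" for m by (induction m) (simp_all add: lys_word_counts)
  have "length ((lys_word ^^ m) us) + 2 * count_a us = length us + 2 * 2 ^ m * count_a us"
    by (induction m) (simp_all add: lys_word_counts A)
  moreover have "count_a us \<le> length us" by (induction us) simp_all
  then have "2 * 2 ^ m * count_a us \<le> 2 * 2 ^ m * length us" "count_a us \<le> length us" by simp_all
  moreover have "length us + 2 * 2 ^ m * count_a us \<le> 2 * 2 ^ m * length us + 2 * count_a us"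
  proof -
    obtain d where d: "length us = count_a us + d" using \<open>count_a us \<le> length us\<close> le_Suc_ex by blast
    have "d \<le> 2 * 2 ^ m * d" by simp
    moreover have "2 * 2 ^ m * (count_a us + d) = 2 * 2 ^ m * count_a us + 2 * 2 ^ m * d" by (rule distrib_left)
    ultimately show ?thesis unfolding d by linarith
  qed
  ultimately show ?thesis by linarith
qed

section \<open>Counting the moves\<close>

definition reach_within :: "nat \<Rightarrow> grig list \<Rightarrow> grig list \<Rightarrow> bool" where
  "reach_within k xs ys \<longleftrightarrow> (\<exists>i\<le>k. (xs, ys) \<in> nmoves ^^ i)"

lemma reach_within_refl: "reach_within k xs xs" unfolding reach_within_def by (intro exI[of _ 0]) simp

lemma reach_within_trans: "reach_within k xs ys \<Longrightarrow> reach_within l ys zs \<Longrightarrow> reach_within (k + l) xs zs"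
  unfolding reach_within_def by (metis add_mono relpow_add relcompI)

lemma reach_within_mono: "reach_within k xs ys \<Longrightarrow> k \<le> l \<Longrightarrow> reach_within l xs ys"
  unfolding reach_within_def by (meson le_trans)

lemma reach_within_nmove: "nmove xs ys \<Longrightarrow> reach_within 1 xs ys"
  unfolding reach_within_def by (intro exI[of _ 1]) (simp add: nmoves_def)

definition tuple_xy :: "nat \<Rightarrow> grig \<Rightarrow> grig \<Rightarrow> grig list" where
  "tuple_xy n x y = [ga, gc, gd, x, y] @ replicate (n - 5) 1"

lemma tuple_xy_nmove:
  "nmove (tuple_xy n x y) (tuple_xy n x (y * x))"
  "t \<in> {ga, gc, gd} \<Longrightarrow> nmove (tuple_xy n x y) (tuple_xy n (x * t) y)"
  "t \<in> {ga, gc, gd} \<Longrightarrow> nmove (tuple_xy n x y) (tuple_xy n (t * x) y)"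
proof -
  show "nmove (tuple_xy n x y) (tuple_xy n x (y * x))"
    using mvI(1)[of 3 "tuple_xy n x y" 4] by (simp add: tuple_xy_def)
  assume "t \<in> {ga, gc, gd}"
  then consider "t = ga" | "t = gc" | "t = gd" by blast
  then show "nmove (tuple_xy n x y) (tuple_xy n (x * t) y)" "nmove (tuple_xy n x y) (tuple_xy n (t * x) y)"
    using mvI(1)[of 0 "tuple_xy n x y" 3] mvI(3)[of 0 "tuple_xy n x y" 3] mvI(1)[of 1 "tuple_xy n x y" 3]
      mvI(3)[of 1 "tuple_xy n x y" 3] mvI(1)[of 2 "tuple_xy n x y" 3] mvI(3)[of 2 "tuple_xy n x y" 3]
    by (cases; simp add: tuple_xy_def)+
qed

text \<open>The tuple contains \<open>a\<close>, \<open>c\<close>, \<open>d\<close> but not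
  \<open>b = cd\<close>, so a letter costs up to two moves.\<close>

lemma tuple_xy_right: "reach_within 2 (tuple_xy n x y) (tuple_xy n (x * ev g) y)"
proof -
  have 1: "reach_within 2 (tuple_xy n x y) (tuple_xy n (x * t) y)" if "t \<in> {ga, gc, gd}" for t
    using reach_within_mono[OF reach_within_nmove[OF tuple_xy_nmove(2)[OF that]]] by simp
  show ?thesis
  proof (cases g)
    case LB
    have "reach_within (1 + 1) (tuple_xy n x y) (tuple_xy n (x * gc * gd) y)"
      by (rule reach_within_trans[OF reach_within_nmove[OF tuple_xy_nmove(2)] reach_within_nmove[OF tuple_xy_nmove(2)]]) simp_all
    then show ?thesis using LB by (simp add: mult.assoc numeral_2_eq_2)
  qed (use 1 in simp_all)
qed

lemma tuple_xy_left: "reach_within 2 (tuple_xy n x y) (tuple_xy n (ev g * x) y)"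
proof -
  have 1: "reach_within 2 (tuple_xy n x y) (tuple_xy n (t * x) y)" if "t \<in> {ga, gc, gd}" for t
    using reach_within_mono[OF reach_within_nmove[OF tuple_xy_nmove(3)[OF that]]] by simp
  show ?thesis
  proof (cases g)
    case LB
    have "reach_within (1 + 1) (tuple_xy n x y) (tuple_xy n (gc * (gd * x)) y)"
      by (rule reach_within_trans[OF reach_within_nmove[OF tuple_xy_nmove(3)] reach_within_nmove[OF tuple_xy_nmove(3)]]) simp_all
    then show ?thesis using LB by (simp add: numeral_2_eq_2)
  qed (use 1 in simp_all)
qed

lemma ev_inverse: "inverse (ev g) = ev g" by (cases g) simp_all

lemma tuple_xy_word: "reach_within (2 * length us) (tuple_xy n x y) (tuple_xy n (x * evs us) y)"
proof (induction us arbitrary: x)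
  case Nil show ?case by (simp add: reach_within_refl)
next
  case (Cons u us)
  from reach_within_trans[OF tuple_xy_right Cons[of "x * ev u"]] show ?case by (simp add: mult.assoc)
qed

text \<open>While \<open>x\<close> is conjugated along the walk, it is multiplied into \<open>y\<close> whenever a new vertex of the
  target set is reached.\<close>

lemma tuple_xy_walk:
  "rigid_at x v \<Longrightarrow> length v = m \<Longrightarrow> moves_below S y m \<Longrightarrow> S \<subseteq> S' \<Longrightarrow> S' \<subseteq> S \<union> visited v w \<Longrightarrow>
    \<exists>x' y'. moves_below S' y' m \<and> reach_within (5 * length w + 1) (tuple_xy n x y) (tuple_xy n x' y')"
proof (induction w arbitrary: x v S y)
  case Nil
  show ?case
  proof (cases "v \<in> S' \<and> v \<notin> S")
    case True
    then have "S' = insert v S" using Nil by auto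
    then have "moves_below S' (y * x) m" using moves_below_insert[OF Nil.prems(3,1,2)] True by simp
    moreover have "reach_within 1 (tuple_xy n x y) (tuple_xy n x (y * x))" by (rule reach_within_nmove[OF tuple_xy_nmove(1)])
    ultimately show ?thesis by auto
  next
    case False
    then have "S' = S" using Nil by auto
    then show ?thesis using Nil.prems(3) reach_within_refl by blast
  qed
next
  case (Cons g w)
  obtain y1 where y1: "moves_below (S \<union> (S' \<inter> {v})) y1 m" "reach_within 1 (tuple_xy n x y) (tuple_xy n x y1)"
  proof (cases "v \<in> S' \<and> v \<notin> S")
    case True
    then have "S \<union> (S' \<inter> {v}) = insert v S" by auto
    then have "moves_below (S \<union> (S' \<inter> {v})) (y * x) m" using moves_below_insert[OF Cons.prems(3,1,2)] True by simp
    then show ?thesis using that reach_within_nmove[OF tuple_xy_nmove(1)] by blast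
  next
    case False
    then have "S \<union> (S' \<inter> {v}) = S" by auto
    then show ?thesis using that[of y] Cons.prems(3) reach_within_refl by simp
  qed
  have "reach_within (2 + 2) (tuple_xy n x y1) (tuple_xy n (ev g * x * ev g) y1)"
    by (rule reach_within_trans[OF tuple_xy_left tuple_xy_right])
  \<comment> \<open>Five moves per letter: one to update \<open>y\<close> and two on each side of
    \<open>x\<close>. The last vertex of the walk accounts for the additional 1.\<close>
  then have p: "reach_within (1 + (2 + 2)) (tuple_xy n x y) (tuple_xy n (ev g * x * ev g) y1)" by (rule reach_within_trans[OF y1(2)])
  have r: "rigid_at (ev g * x * ev g) (act (ev g) v)" using rigid_at_conj[OF Cons.prems(1), of "ev g"] by (simp add: ev_inverse)
  have l: "length (act (ev g) v) = m" using Cons.prems(2) by (simp add: act_length)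
  have "S \<union> (S' \<inter> {v}) \<subseteq> S'" "S' \<subseteq> S \<union> (S' \<inter> {v}) \<union> visited (act (ev g) v) w"
    using Cons.prems(4,5) by auto
  from Cons.IH[OF r l y1(1) this] obtain x' y' where
    *: "moves_below S' y' m" "reach_within (5 * length w + 1) (tuple_xy n (ev g * x * ev g) y1) (tuple_xy n x' y')" by blast
  from reach_within_trans[OF p *(2)] *(1) show ?case by (intro exI[of _ x'] exI[of _ y']) simp
qed

text \<open>The constant is 139 = 128 + 10 + 1. The rigid word has at most 64 * 2^m letters at two
  moves each, the walk at most 2 * 2^m letters at five moves each, and the final update costs
  one.\<close>

lemma many_tuples:
  assumes S: "S \<subseteq> {u. length u = Suc m}"
  shows "\<exists>x y. moves_below S y (Suc m) \<and> reach_within (139 * 2 ^ m) (tuple_xy n 1 1) (tuple_xy n x y)"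
proof -
  let ?x = "evs ((lys_word ^^ Suc m) base_word)"
  have 1: "reach_within (2 * length ((lys_word ^^ Suc m) base_word)) (tuple_xy n 1 1) (tuple_xy n ?x 1)"
    using tuple_xy_word[of "(lys_word ^^ Suc m) base_word" n 1 1] by simp
  have "moves_below {} 1 (Suc m)" by (simp add: moves_below_def)
  moreover have "S \<subseteq> {} \<union> visited (replicate (Suc m) True) ((lys_word ^^ m) [LA])"
    using S visited_cover by blast
  ultimately obtain x y where 2: "moves_below S y (Suc m)"
    "reach_within (5 * length ((lys_word ^^ m) [LA]) + 1) (tuple_xy n ?x 1) (tuple_xy n x y)"
    using tuple_xy_walk[OF rigid_at_base_word[of "Suc m"] length_replicate, of "{}" 1 S "(lys_word ^^ m) [LA]" n] by blast
  have "length base_word = 16" by (simp add: base_word_def numeral_2_eq_2)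
  then have "length ((lys_word ^^ Suc m) base_word) \<le> 64 * 2 ^ m" using length_lys_word_pow[of "Suc m" base_word] by simp
  moreover have "length ((lys_word ^^ m) [LA]) \<le> 2 * 2 ^ m" using length_lys_word_pow[of m "[LA]"] by simp
  moreover have "(1::nat) \<le> 2 ^ m" by simp
  ultimately have "2 * length ((lys_word ^^ Suc m) base_word) + (5 * length ((lys_word ^^ m) [LA]) + 1) \<le> 139 * 2 ^ m"
    by linarith
  then show ?thesis using reach_within_mono[OF reach_within_trans[OF 1 2(2)]] 2(1) by blast
qed

section \<open>The product replacement graph\<close>

lemma Bij_UNIV: "Bij (UNIV :: 'a set) = {f. bij f}"
  by (auto simp: Bij_def extensional_def)

lemma BijGroup_act:
  defines "Q \<equiv> BijGroup (UNIV :: bool list set)"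
  shows "act g \<otimes>\<^bsub>Q\<^esub> act h = act (g * h)" "\<one>\<^bsub>Q\<^esub> = act 1" "inv\<^bsub>Q\<^esub> (act g) = act (inverse g)"
proof -
  have b: "act g \<in> carrier Q" for g
    using grig_maps_bij[OF act] by (simp add: Q_def BijGroup_def Bij_UNIV)
  have m: "act g \<otimes>\<^bsub>Q\<^esub> act h = act (g * h)" for g h
    using b[of g] b[of h] by (simp add: Q_def BijGroup_def compose_def fun_eq_iff)
  then show "act g \<otimes>\<^bsub>Q\<^esub> act h = act (g * h)" .
  show o: "\<one>\<^bsub>Q\<^esub> = act 1" by (simp add: Q_def BijGroup_def fun_eq_iff)
  have "group Q" unfolding Q_def by (rule group_BijGroup)
  then show "inv\<^bsub>Q\<^esub> (act g) = act (inverse g)"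
    by (rule group.inv_equality) (simp_all add: m b o)
qed

text \<open>Stated for any \<open>Q\<close> with these laws, because it serves twice: for the group
  of all bijections, to find the carrier, and for \<open>Grigorchuk\<close>, whose inverse is taken
  in the smaller carrier.\<close>

lemma generate_act:
  assumes "\<And>g h. act g \<otimes>\<^bsub>Q\<^esub> act h = act (g * h)" "\<one>\<^bsub>Q\<^esub> = act 1"
    "\<And>g. inv\<^bsub>Q\<^esub> (act g) = act (inverse g)"
  shows "generate Q (act ` A) = act ` gen_by A"
proof (intro equalityI subsetI)
  note s = subgrpD[OF subgrp_gen_by[of A]]
  fix f assume "f \<in> generate Q (act ` A)"
  then show "f \<in> act ` gen_by A"
  proof induction
    case one show ?case unfolding assms(2) by (rule imageI[OF s(1)])
  next
    case (incl h) then show ?case using gen_by_incl by blast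
  next
    case (inv h)
    then obtain g where "g \<in> A" "h = act g" by blast
    then show ?case using assms(3) s(3)[OF gen_by_incl] by auto
  next
    case (eng h k)
    then obtain g g' where g: "g \<in> gen_by A" "h = act g" "g' \<in> gen_by A" "k = act g'" by blast
    show ?case unfolding g(2,4) assms(1) by (rule imageI[OF s(2)[OF g(1,3)]])
  qed
next
  define S where "S = {x. act x \<in> generate Q (act ` A) \<and> act (inverse x) \<in> generate Q (act ` A)}"
  have "subgrp S" unfolding subgrp_def
  proof (intro conjI ballI)
    show "1 \<in> S" using generate.one[of Q "act ` A"] unfolding assms(2) by (simp add: S_def)
    show "x * y \<in> S" if "x \<in> S" "y \<in> S" for x y
      using generate.eng[of "act x" Q "act ` A" "act y"] generate.eng[of "act (inverse y)" Q "act ` A" "act (inverse x)"]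
        that unfolding assms(1) by (simp add: S_def)
    show "inverse x \<in> S" if "x \<in> S" for x using that by (simp add: S_def)
  qed
  moreover have "A \<subseteq> S"
  proof
    fix x assume "x \<in> A"
    then have "act x \<in> generate Q (act ` A)" "inv\<^bsub>Q\<^esub> (act x) \<in> generate Q (act ` A)"
      by (auto intro: generate.incl generate.inv)
    then show "x \<in> S" unfolding assms(3) by (simp add: S_def)
  qed
  ultimately have "gen_by A \<subseteq> S" by (rule gen_by_least)
  then show "f \<in> generate Q (act ` A)" if "f \<in> act ` gen_by A" for f using that by (auto simp: S_def)
qed

lemma Grigorchuk_carrier: "carrier Grigorchuk = range act"
proof -
  have "gen_by {ga, gb, gc, gd} = UNIV"
    by (rule gens_UNIV[OF subgrp_gen_by])
      (auto intro!: gen_by_incl simp: klein_def subgrpD(1)[OF subgrp_gen_by])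
  moreover have "{flip_a, gen_b, gen_c, gen_d} = act ` {ga, gb, gc, gd}" by simp
  ultimately show ?thesis
    unfolding Grigorchuk_def using generate_act[OF BijGroup_act, of "{ga, gb, gc, gd}"] by simp
qed

lemma Grigorchuk_act:
  "act g \<otimes>\<^bsub>Grigorchuk\<^esub> act h = act (g * h)" "\<one>\<^bsub>Grigorchuk\<^esub> = act 1"
  "inv\<^bsub>Grigorchuk\<^esub> (act g) = act (inverse g)"
proof -
  show m: "act g \<otimes>\<^bsub>Grigorchuk\<^esub> act h = act (g * h)" for g h
    using BijGroup_act(1) by (simp add: Grigorchuk_def)
  show o: "\<one>\<^bsub>Grigorchuk\<^esub> = act 1"
    using BijGroup_act(2) by (simp add: Grigorchuk_def)
  have "group Grigorchuk"
  proof (rule groupI, unfold Grigorchuk_carrier o)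
    fix x assume "x \<in> range act"
    then obtain g where "x = act g" by blast
    then show "\<exists>y\<in>range act. y \<otimes>\<^bsub>Grigorchuk\<^esub> x = act 1"
      by (intro bexI[of _ "act (inverse g)"]) (simp_all add: m)
  qed (auto simp: m mult.assoc)
  then show "inv\<^bsub>Grigorchuk\<^esub> (act g) = act (inverse g)"
    by (rule group.inv_equality) (simp_all add: m o Grigorchuk_carrier)
qed

lemma gen_tuples_act: "map act xs \<in> gen_tuples Grigorchuk n \<longleftrightarrow> xs \<in> gen_lists n"
proof -
  have "generate Grigorchuk (set (map act xs)) = act ` gen_by (set xs)"
    using generate_act[OF Grigorchuk_act, of "set xs"] by simp
  moreover have "act ` gen_by (set xs) = range act \<longleftrightarrow> gen_by (set xs) = UNIV"
    by (rule inj_image_eq_iff) (simp add: inj_def act_inject)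
  ultimately show ?thesis by (auto simp: gen_tuples_def gen_lists_def Grigorchuk_carrier)
qed

lemma gen_tuples_lift:
  assumes "zs \<in> gen_tuples Grigorchuk n" obtains xs where "zs = map act xs" "xs \<in> gen_lists n"
proof -
  have "\<forall>z\<in>set zs. \<exists>x. z = act x" using assms by (auto simp: gen_tuples_def Grigorchuk_carrier)
  then have "zs \<in> lists (range act)" by auto
  then obtain xs where "zs = map act xs" by (metis ex_map_conv \<open>\<forall>z\<in>set zs. \<exists>x. z = act x\<close>)
  then show ?thesis using that assms gen_tuples_act by blast
qed

lemma pr_move_act: "pr_move Grigorchuk (map act xs) zs \<longleftrightarrow> (\<exists>ys. zs = map act ys \<and> nmove xs ys)"
proof -
  have e: "map act xs ! j \<otimes>\<^bsub>Grigorchuk\<^esub> map act xs ! i = act (xs ! j * xs ! i)"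
    "map act xs ! j \<otimes>\<^bsub>Grigorchuk\<^esub> inv\<^bsub>Grigorchuk\<^esub> (map act xs ! i) = act (xs ! j * inverse (xs ! i))"
    "map act xs ! i \<otimes>\<^bsub>Grigorchuk\<^esub> map act xs ! j = act (xs ! i * xs ! j)"
    "inv\<^bsub>Grigorchuk\<^esub> (map act xs ! i) \<otimes>\<^bsub>Grigorchuk\<^esub> map act xs ! j = act (inverse (xs ! i) * xs ! j)"
    if "i < length xs" "j < length xs" for i j
    using that by (simp_all only: nth_map Grigorchuk_act)
  show ?thesis
  proof
    assume "pr_move Grigorchuk (map act xs) zs"
    then obtain i j where ij: "i < length xs" "j < length xs" "i \<noteq> j"
      "zs = map act (xs[j := xs ! j * xs ! i]) \<or> zs = map act (xs[j := xs ! j * inverse (xs ! i)]) \<or>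
       zs = map act (xs[j := xs ! i * xs ! j]) \<or> zs = map act (xs[j := inverse (xs ! i) * xs ! j])"
      unfolding pr_move_def length_map map_update using e by metis
    then show "\<exists>ys. zs = map act ys \<and> nmove xs ys" using mvI[OF ij(1-3)] by blast
  next
    assume "\<exists>ys. zs = map act ys \<and> nmove xs ys"
    then obtain i j where ij: "i < length xs" "j < length xs" "i \<noteq> j"
      "zs = map act (xs[j := xs ! j * xs ! i]) \<or> zs = map act (xs[j := xs ! j * inverse (xs ! i)]) \<or>
       zs = map act (xs[j := xs ! i * xs ! j]) \<or> zs = map act (xs[j := inverse (xs ! i) * xs ! j])"
      unfolding nmove_def by blast
    show "pr_move Grigorchuk (map act xs) zs"
      unfolding pr_move_def length_map
      by (rule exI[of _ i], rule exI[of _ j]) (simp only: e[OF ij(1,2)] map_update[symmetric] ij simp_thms)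
  qed
qed

lemma pr_edges_act: "xs \<in> gen_lists n \<Longrightarrow> nmove xs ys \<Longrightarrow> (map act xs, map act ys) \<in> pr_edges Grigorchuk n"
  using nmoves_gen_lists[of xs ys n] pr_move_act by (auto simp: pr_edges_def gen_tuples_act nmoves_def)

lemma pr_edges_lift:
  assumes "(map act xs, zs) \<in> pr_edges Grigorchuk n" shows "\<exists>ys. zs = map act ys \<and> nmove xs ys"
proof -
  obtain ys where ys: "zs = map act ys"
    using assms gen_tuples_lift unfolding pr_edges_def by blast
  have inj: "map act us = map act vs \<longleftrightarrow> us = vs" for us vs
    by (rule inj_map_eq_map) (simp add: inj_def act_inject)
  have "nmove xs ys \<or> nmove ys xs"
    using assms unfolding pr_edges_def ys by (auto simp: pr_move_act inj)
  then show ?thesis using nmove_sym ys by blast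
qed

lemma finite_nmove: "finite {ys. nmove xs ys}"
proof -
  have "{ys. nmove xs ys} \<subseteq> (\<Union>i<length xs. \<Union>j<length xs.
      {xs[j := xs ! j * xs ! i], xs[j := xs ! j * inverse (xs ! i)],
       xs[j := xs ! i * xs ! j], xs[j := inverse (xs ! i) * xs ! j]})"
    by (auto simp: nmove_def)
  then show ?thesis by (rule finite_subset) simp
qed

text \<open>\<open>card\<close> is 0 on infinite sets, so comparing cardinalities of balls requires
  finiteness; it follows from each tuple having finitely many moves.\<close>

lemma finite_ball:
  assumes "v \<in> gen_tuples Grigorchuk n" shows "finite (graph_ball (pr_edges Grigorchuk n) v r)"
proof -
  let ?E = "pr_edges Grigorchuk n"
  have fin: "finite (?E `` {x})" for x
  proof (cases "x \<in> gen_tuples Grigorchuk n")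
    case True
    then obtain xs where "x = map act xs" using gen_tuples_lift by blast
    then have "?E `` {x} \<subseteq> map act ` {ys. nmove xs ys}" using pr_edges_lift by blast
    then show ?thesis by (rule finite_subset) (simp add: finite_nmove)
  next
    case False
    then have "?E `` {x} = {}" by (auto simp: pr_edges_def)
    then show ?thesis by simp
  qed
  have "finite ((?E ^^ k) `` {v})" for k
  proof (induction k)
    case (Suc k)
    have "(?E ^^ Suc k) `` {v} = (\<Union>x\<in>(?E ^^ k) `` {v}. ?E `` {x})" by auto
    then show ?case using Suc fin by simp
  qed simp
  moreover have "graph_ball ?E v r = (\<Union>k\<le>r. (?E ^^ k) `` {v})" by (auto simp: graph_ball_def)
  ultimately show ?thesis by simp
qed

lemma nmoves_relpow_edges:
  "(xs, ys) \<in> nmoves ^^ k \<Longrightarrow> xs \<in> gen_lists n \<Longrightarrow> (map act xs, map act ys) \<in> pr_edges Grigorchuk n ^^ k"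
proof (induction k arbitrary: ys)
  case (Suc k)
  then obtain zs where z: "(xs, zs) \<in> nmoves ^^ k" "nmove zs ys" by (auto simp: nmoves_def)
  have "zs \<in> gen_lists n" by (rule nmoves_gen_lists[OF relpow_imp_rtrancl[OF z(1)] Suc.prems(2)])
  then show ?case using Suc.IH[OF z(1) Suc.prems(2)] pr_edges_act z(2) by auto
qed simp

lemma std_tuple_gen_lists: assumes "5 \<le> n" shows "std_tuple n \<in> gen_lists n"
proof -
  have "gen_by {ga, gc, gd} = UNIV" by (rule gen_by_basis) (auto simp: elim1_def elim2_def)
  then have "gen_by (set (std_tuple n)) = UNIV" by (rule gen_by_UNIV_mono) (auto simp: std_tuple_def)
  then show ?thesis using assms by (simp add: gen_lists_def std_tuple_def)
qed

lemma ball_card: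
  assumes n: "5 \<le> n"
  shows "2 ^ 2 ^ Suc m \<le> card (graph_ball (pr_edges Grigorchuk n) (map act (std_tuple n)) (139 * 2 ^ m))"
proof -
  have s: "std_tuple n = tuple_xy n 1 1"
  proof -
    have "n - 3 = Suc (Suc (n - 5))" using n by simp
    then show ?thesis by (simp add: std_tuple_def tuple_xy_def)
  qed
  note g = std_tuple_gen_lists[OF n]
  let ?P = "Pow {u :: bool list. length u = Suc m}"
  let ?B = "graph_ball (pr_edges Grigorchuk n) (map act (std_tuple n)) (139 * 2 ^ m)"
  have "\<exists>F. \<forall>S\<in>?P. \<exists>x. moves_below S (F S) (Suc m) \<and> reach_within (139 * 2 ^ m) (std_tuple n) (tuple_xy n x (F S))"
    unfolding s using many_tuples by (intro bchoice) blast
  then obtain F where F: "\<And>S. S \<in> ?P \<Longrightarrow> \<exists>x. moves_below S (F S) (Suc m) \<and> reach_within (139 * 2 ^ m) (std_tuple n) (tuple_xy n x (F S))"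
    by blast
  then obtain x where x: "\<And>S. S \<in> ?P \<Longrightarrow> moves_below S (F S) (Suc m)"
    "\<And>S. S \<in> ?P \<Longrightarrow> reach_within (139 * 2 ^ m) (std_tuple n) (tuple_xy n (x S) (F S))" by metis
  let ?f = "\<lambda>S. map act (tuple_xy n (x S) (F S))"
  have "inj_on ?f ?P"
  proof (rule inj_onI)
    fix S T assume *: "S \<in> ?P" "T \<in> ?P" "?f S = ?f T"
    then have "F S = F T" by (simp add: tuple_xy_def act_inject)
    then have "u \<in> S \<longleftrightarrow> u \<in> T" if "length u = Suc m" for u
      using x(1)[OF *(1)] x(1)[OF *(2)] that unfolding moves_below_def by auto
    then show "S = T" using *(1,2) by blast
  qed
  moreover have "?f ` ?P \<subseteq> ?B"
  proof
    fix z assume "z \<in> ?f ` ?P"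
    then obtain S where S: "S \<in> ?P" "z = ?f S" by blast
    then obtain i where "i \<le> 139 * 2 ^ m" "(std_tuple n, tuple_xy n (x S) (F S)) \<in> nmoves ^^ i"
      using x(2)[OF S(1)] unfolding reach_within_def by blast
    then show "z \<in> ?B" using nmoves_relpow_edges[OF _ g] S(2) unfolding graph_ball_def by blast
  qed
  moreover have "finite ?B" by (rule finite_ball) (simp only: gen_tuples_act g)
  ultimately have "card ?P \<le> card ?B" by (rule card_inj_on_le)
  moreover have "card ?P = 2 ^ 2 ^ Suc m"
  proof -
    have "finite {u :: bool list. length u = Suc m}" "card {u :: bool list. length u = Suc m} = 2 ^ Suc m"
      using card_lists_length_eq[of "UNIV :: bool set" "Suc m"] finite_lists_length_eq[of "UNIV :: bool set" "Suc m"]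
      by simp_all
    then show ?thesis by (simp add: card_Pow)
  qed
  ultimately show ?thesis by simp
qed

theorem theorem5p3:
  fixes n :: nat
  assumes "n \<ge> 5"
  shows "has_exp_growth (gen_tuples Grigorchuk n) (pr_edges Grigorchuk n)"
proof -
  let ?E = "pr_edges Grigorchuk n" and ?V = "gen_tuples Grigorchuk n"
  have edges: "(map act xs, map act ys) \<in> ?E\<^sup>*" if "(xs, ys) \<in> nmoves\<^sup>*" "xs \<in> gen_lists n" for xs ys
    using that nmoves_relpow_edges relpow_imp_rtrancl rtrancl_imp_relpow by metis
  have "graph_connected ?V ?E" unfolding graph_connected_def
  proof (intro ballI)
    fix v w assume "v \<in> ?V" "w \<in> ?V"
    obtain xs where xs: "v = map act xs" "xs \<in> gen_lists n" using gen_tuples_lift[OF \<open>v \<in> ?V\<close>] .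
    obtain ys where ys: "w = map act ys" "ys \<in> gen_lists n" using gen_tuples_lift[OF \<open>w \<in> ?V\<close>] .
    have "(xs, ys) \<in> nmoves\<^sup>*"
      using nmoves_std_tuple[OF xs(2) assms] nmoves_sym[OF nmoves_std_tuple[OF ys(2) assms]] by (rule rtrancl_trans)
    then show "(v, w) \<in> ?E\<^sup>*" using edges xs ys by blast
  qed
  moreover have base: "map act (std_tuple n) \<in> ?V" unfolding gen_tuples_act by (rule std_tuple_gen_lists[OF assms])
  moreover have "exp_growth_from ?E (map act (std_tuple n))"
    unfolding exp_growth_from_def eventually_sequentially
  proof (intro exI conjI allI impI)
    \<comment> \<open>For the largest \<open>m\<close> with 139 * 2^m at most \<open>r\<close>, the
      radius \<open>r\<close> is below 139 * 2^(m+1). The sets are taken in level m+1, so the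
      exponent 2^(m+1) absorbs the factor 2 lost in rounding \<open>r\<close> down.\<close>
    show "(2::real) powr (1 / 139) > 1" by simp
    fix r :: nat assume r: "139 \<le> r"
    let ?B = "graph_ball ?E (map act (std_tuple n))"
    define m where "m = Max {m. 139 * 2 ^ m \<le> r}"
    have bd: "k \<le> r" if "139 * 2 ^ k \<le> r" for k :: nat
      using that less_exp[of k] by linarith
    have fin: "finite {m. 139 * 2 ^ m \<le> r}" by (rule finite_subset[of _ "{..r}"]) (use bd in auto)
    have "0 \<in> {m. 139 * 2 ^ m \<le> r}" using r by simp
    then have m: "139 * 2 ^ m \<le> r" using Max_in[OF fin] unfolding m_def by blast
    have "\<not> 139 * 2 ^ Suc m \<le> r"
    proof
      assume "139 * 2 ^ Suc m \<le> r"
      then have "Suc m \<le> m" unfolding m_def by (intro Max_ge[OF fin]) simp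
      then show False by simp
    qed
    then have "r \<le> 139 * 2 ^ Suc m" by linarith
    then have "real r \<le> real (139 * 2 ^ Suc m)" by (rule of_nat_mono)
    then have "real r / 139 \<le> 2 ^ Suc m" by simp
    then have "(2::real) powr (real r / 139) \<le> 2 powr (2 ^ Suc m)" by (intro powr_mono) simp_all
    also have "\<dots> = 2 ^ 2 ^ Suc m"
      using powr_realpow[of 2 "2 ^ Suc m"] by simp
    also have "\<dots> \<le> real (card (?B (139 * 2 ^ m)))"
    proof -
      have "real (2 ^ 2 ^ Suc m) \<le> real (card (?B (139 * 2 ^ m)))"
        by (rule of_nat_mono[OF ball_card[OF assms]])
      then show ?thesis by simp
    qed
    also have "\<dots> \<le> real (card (?B r))"
    proof -
      have "?B (139 * 2 ^ m) \<subseteq> ?B r" using m unfolding graph_ball_def by (blast intro: le_trans)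
      then show ?thesis by (intro of_nat_mono card_mono finite_ball base)
    qed
    finally show "real (card (?B r)) \<ge> ((2::real) powr (1 / 139)) ^ r"
      by (simp add: powr_power)
  qed
  ultimately show ?thesis unfolding has_exp_growth_def by blast
qed

end
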